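(* Let $W\equiv(\Bbbk[x_1,\dots,x_n],W)\in\mathcal{LG}$. Then the Serre automorphism $S_W\colon W\to W$ satisfies $S_W\cong I_W[n]$ in $\mathcal{LG}(W,W)$.
   Context: **The bicategory $\mathcal{LG}$.** Fix a field $\Bbbk$ of characteristic zero. An object of $\mathcal{LG}$ is either $(\Bbbk,0)$ or a pair $(\Bbbk[x_1,\dots,x_n],W)$ with $n\in\mathbb{Z}_{\geq 0}$ and $W\in\Bbbk[x_1,\dots,x_n]$ a potential, i.e. the Jacobi algebra $\mathrm{Jac}_W=\Bbbk[x_1,\dots,x_n]/(\partial_{x_1}W,\dots,\partial_{x_n}W)$ is finite-dimensional over $\Bbbk$. Lists of variables are abbreviated $x$, and $(\Bbbk[x],W)$ is abbreviated $W$. A matrix factorisation of $V-W$ over $\Bbbk[x,z]$ is a free $\mathbb{Z}_2$-graded $\Bbbk[x,z]$-module $X=X^0\oplus X^1$ with an odd endomorphism $d_X$ satisfying $d_X^2=(V-W)\cdot\mathrm{id}_X$. On $\mathrm{Hom}_{\Bbbk[x,z]}(X,X')$ one has the differential $\delta_{X,X'}(\zeta)=d_{X'}\circ\zeta-(-1)^{|\zeta|}\zeta\circ d_X$. The Hom category $\mathcal{LG}(W,V)$ has as objects (the 1-morphisms $W\to V$) the matrix factorisations of $V-W$ which are, in the homotopy category of all matrix factorisations, direct summands of finite-rank ones, and as morphisms (2-morphisms of $\mathcal{LG}$) the even cohomology classes of $\delta_{X,X'}$. The shift functor is $[1]\colon(X^0\oplus X^1,d_X)\mapsto(X^1\oplus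 X^0,-d_X)$, so $[2]=\mathrm{Id}$; $[n]$ is its $n$-th power. Horizontal composition of $X\colon W_1\to W_2$ ($W_2\in\Bbbk[y]$) and $Y\colon W_2\to W_3$ is $Y\otimes X:=Y\otimes_{\Bbbk[y]}X$ with $d_{Y\otimes X}=d_Y\otimes1+1\otimes d_X$. The unit 1-morphism on $(\Bbbk[x_1,\dots,x_n],W)$ is $1_W=I_W=\bigwedge\big(\bigoplus_{i=1}^n\Bbbk[x,x']\theta_i\big)$ with $d_{I_W}=\sum_i\big(\partial^{x',x}_{[i]}W\cdot\theta_i\wedge(-)+(x_i'-x_i)\theta_i^*\big)$, where $\partial^{x',x}_{[i]}W=\frac{W(x_1,\dots,x_{i-1},x_i',\dots,x_n')-W(x_1,\dots,x_i,x_{i+1}',\dots,x_n')}{x_i'-x_i}$ and $\theta_i^*$ is contraction (an odd derivation with $\theta_i^*(\theta_j)=\delta_{i,j}$). **Symmetric monoidal structure and duality.** The monoidal product $\square$ is $(\Bbbk[x],W)\square(\Bbbk[z],V)=(\Bbbk[x,z],W+V)$ on objects and $\otimes_\Bbbk$ on 1- and 2-morphisms; the unit object is $\mathds{I}=(\Bbbk,0)$. The right unitor $r$ and its inverse $r^-$ have 1-morphism components $r_{(W,* )}\colon W\square\mathds{I}\to W$ and $r_W^-\colon W\to W\square\mathds{I}$ given by $I_W$; the associator has components $a_{((U,V),W)}=I_{U+V+W}$ (suppressed below); the braiding has components $b_{(V,W)}\colon V\square W\to W\square V$ given by $I_{V+W}\cong I_V\square I_W$ up to reordering of variables. The (left and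 right) dual of $W$ is $W^*=-W$, with $\widetilde{\mathrm{ev}}_W=I_W$ viewed as a 1-morphism $W\square(-W)\to\mathds{I}$. The right adjoint of $X\colon(\Bbbk[x_1,\dots,x_n],W)\to(\Bbbk[z_1,\dots,z_m],V)$ is $X^\dagger=X^\vee[n]$, where $X^\vee=\mathrm{Hom}_{\Bbbk[x,z]}(X,\Bbbk[x,z])$ with $d_{X^\vee}(\phi)=(-1)^{|\phi|+1}\phi\circ d_X$. **Serre automorphism.** For a fully dualisable object $A$ of a symmetric monoidal bicategory (here $\mathcal{LG}$, all of whose objects are fully dualisable), the Serre automorphism is the 1-morphism $$S_A:=r_{(A,* )}\otimes\big(1_A\square\widetilde{\mathrm{ev}}_A\big)\otimes\big(b_{(A,A)}\square1_{A^*}\big)\otimes\big(1_A\square\widetilde{\mathrm{ev}}_A^{\,\dagger}\big)\otimes r_A^-\colon A\to A.$$ *)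

theory Defs
  imports "HOL-Library.Poly_Mapping"
begin

section \<open>Polynomials\<close>

text \<open>
  A monomial is a finitely supported exponent function, a polynomial a finitely supported
  function from monomials to coefficients; multiplication is the convolution product of
  \<^theory>\<open>HOL-Library.Poly_Mapping\<close>.  The ring \<open>k[x\<^sub>0, ..., x\<^sub>n\<^sub>-\<^sub>1]\<close> is \<open>polys {..<n}\<close>.
\<close>

type_synonym 'v mon = "'v \<Rightarrow>\<^sub>0 nat"
type_synonym ('v, 'k) mpoly = "'v mon \<Rightarrow>\<^sub>0 'k"

definition polys :: "'v set \<Rightarrow> ('v, 'k::field_char_0) mpoly set" where
  "polys A = {p. \<forall>m\<in>Poly_Mapping.keys p. Poly_Mapping.keys m \<subseteq> A}"

definition cst :: "'k \<Rightarrow> ('v, 'k::field_char_0) mpoly" where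
  "cst a = Poly_Mapping.single 0 a"

definition var :: "'v \<Rightarrow> ('v, 'k::field_char_0) mpoly" where
  "var v = Poly_Mapping.single (Poly_Mapping.single v 1) 1"

definition rename_mon :: "('v \<Rightarrow> 'w) \<Rightarrow> 'v mon \<Rightarrow> 'w mon" where
  "rename_mon \<rho> m =
     (\<Sum>v\<in>Poly_Mapping.keys m. Poly_Mapping.single (\<rho> v) (Poly_Mapping.lookup m v))"

definition rename :: "('v \<Rightarrow> 'w) \<Rightarrow> ('v, 'k::field_char_0) mpoly \<Rightarrow> ('w, 'k) mpoly" where
  "rename \<rho> p =
     (\<Sum>m\<in>Poly_Mapping.keys p. Poly_Mapping.single (rename_mon \<rho> m) (Poly_Mapping.lookup p m))"

definition partial :: "'v \<Rightarrow> ('v, 'k::field_char_0) mpoly \<Rightarrow> ('v, 'k) mpoly" where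
  "partial v p =
     (\<Sum>m\<in>Poly_Mapping.keys p.
        Poly_Mapping.single (m - Poly_Mapping.single v 1)
          (of_nat (Poly_Mapping.lookup m v) * Poly_Mapping.lookup p m))"


section \<open>Objects\<close>

text \<open>The pair \<open>(n, W)\<close> stands for \<open>(k[x\<^sub>0, ..., x\<^sub>n\<^sub>-\<^sub>1], W)\<close>.\<close>

type_synonym 'k obj = "nat \<times> (nat, 'k) mpoly"

definition jacobi_ideal :: "'k::field_char_0 obj \<Rightarrow> (nat, 'k) mpoly set" where
  "jacobi_ideal = (\<lambda>(n, W). {\<Sum>i<n. a i * partial i W | a. \<forall>i<n. a i \<in> polys {..<n}})"

text \<open>The Jacobi algebra is finite-dimensional: the classes of some finite \<open>F\<close> span the quotient.\<close>

definition potential :: "'k::field_char_0 obj \<Rightarrow> bool" where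
  "potential = (\<lambda>(n, W). W \<in> polys {..<n} \<and>
     (\<exists>F. finite F \<and> F \<subseteq> polys {..<n} \<and>
        (\<forall>p\<in>polys {..<n}. \<exists>c. p - (\<Sum>f\<in>F. cst (c f) * f) \<in> jacobi_ideal (n, W))))"

definition unit_obj :: "'k::field_char_0 obj" where
  "unit_obj = (0, 0)"

definition lg_object :: "'k::field_char_0 obj \<Rightarrow> bool" where
  "lg_object A \<longleftrightarrow> A = unit_obj \<or> potential A"

text \<open>
  In the product the variables of the second factor are shifted past those of the first.  This is
  strictly associative and strictly unital.
\<close>

definition box_obj :: "'k::field_char_0 obj \<Rightarrow> 'k obj \<Rightarrow> 'k obj" (infixr \<open>\<box>\<^sub>o\<close> 70) where
  "A \<box>\<^sub>o B = (fst A + fst B, snd A + rename (\<lambda>i. fst A + i) (snd B))"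

definition dual_obj :: "'k::field_char_0 obj \<Rightarrow> 'k obj" where
  "dual_obj A = (fst A, - snd A)"


section \<open>Free modules\<close>

text \<open>
  An element of the free module on basis \<open>B\<close> over \<open>R\<close> is a finitely supported coefficient
  function \<open>'b \<Rightarrow>\<^sub>0 R\<close> with support in \<open>B\<close>.
\<close>

definition smul :: "'r::comm_ring_1 \<Rightarrow> ('b \<Rightarrow>\<^sub>0 'r) \<Rightarrow> ('b \<Rightarrow>\<^sub>0 'r)" where
  "smul r v = Poly_Mapping.map (\<lambda>a. r * a) v"

abbreviation bas :: "'b \<Rightarrow> ('b \<Rightarrow>\<^sub>0 'r::comm_ring_1)" where
  "bas b \<equiv> Poly_Mapping.single b 1"

definition lin_ext :: "('b \<Rightarrow> ('c \<Rightarrow>\<^sub>0 'r)) \<Rightarrow> ('b \<Rightarrow>\<^sub>0 'r) \<Rightarrow> ('c \<Rightarrow>\<^sub>0 'r::comm_ring_1)" where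
  "lin_ext f v = (\<Sum>b\<in>Poly_Mapping.keys v. smul (Poly_Mapping.lookup v b) (f b))"

text \<open>\<open>base_change \<beta> \<phi>\<close> sends \<open>\<Sum> p\<^sub>b b\<close> to \<open>\<Sum> \<phi>(p\<^sub>b) \<beta>(b)\<close>.\<close>

definition base_change ::
    "('b \<Rightarrow> 'c) \<Rightarrow> ('r::comm_ring_1 \<Rightarrow> 's::comm_ring_1) \<Rightarrow> ('b \<Rightarrow>\<^sub>0 'r) \<Rightarrow> ('c \<Rightarrow>\<^sub>0 's)" where
  "base_change \<beta> \<phi> v =
     (\<Sum>b\<in>Poly_Mapping.keys v. Poly_Mapping.single (\<beta> b) (\<phi> (Poly_Mapping.lookup v b)))"

text \<open>Signs and degrees: the degree \<open>1 \<in> \<int>\<^sub>2\<close> is \<open>True\<close>, and \<open>ksign p\<close> is \<open>(-1)\<^sup>p\<close>.\<close>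

definition ksign :: "bool \<Rightarrow> 'r::comm_ring_1" where
  "ksign p = (if p then -1 else 1)"


section \<open>Matrix factorisations\<close>

text \<open>
  A 1-morphism from \<open>(k[x], W)\<close> to \<open>(k[z], V)\<close> lives over \<open>k[x, z]\<close>, with \<open>x\<^sub>i\<close> written \<open>Src i\<close>
  and \<open>z\<^sub>j\<close> written \<open>Tgt j\<close>.  The free \<open>\<int>\<^sub>2\<close>-graded module is given by a homogeneous basis, which
  may be infinite, and the endomorphism by its values \<open>dcol\<close> on basis elements.
\<close>

datatype bvar = Src nat | Tgt nat

record (overloaded) ('b, 'k) mor1 =
  src :: "'k obj"
  tgt :: "'k obj"
  basis :: "'b set"
  par :: "'b \<Rightarrow> bool"
  dcol :: "'b \<Rightarrow> ('b \<Rightarrow>\<^sub>0 (bvar, 'k) mpoly)"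

definition base_ring :: "('b, 'k::field_char_0) mor1 \<Rightarrow> (bvar, 'k) mpoly set" where
  "base_ring X = polys (Src ` {..<fst (src X)} \<union> Tgt ` {..<fst (tgt X)})"

definition elems :: "('b, 'k::field_char_0) mor1 \<Rightarrow> ('b \<Rightarrow>\<^sub>0 (bvar, 'k) mpoly) set" where
  "elems X = {v. Poly_Mapping.keys v \<subseteq> basis X \<and> (\<forall>b. Poly_Mapping.lookup v b \<in> base_ring X)}"

definition homog :: "('b, 'k::field_char_0) mor1 \<Rightarrow> bool \<Rightarrow> ('b \<Rightarrow>\<^sub>0 (bvar, 'k) mpoly) set" where
  "homog X p = {v \<in> elems X. \<forall>b\<in>Poly_Mapping.keys v. par X b = p}"

definition dif ::
    "('b, 'k::field_char_0) mor1 \<Rightarrow> ('b \<Rightarrow>\<^sub>0 (bvar, 'k) mpoly) \<Rightarrow> ('b \<Rightarrow>\<^sub>0 (bvar, 'k) mpoly)" where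
  "dif X = lin_ext (dcol X)"

text \<open>
  \<open>hom X Y p\<close>: linear maps of degree \<open>p\<close>, for \<open>X\<close> and \<open>Y\<close> with the same source and target.  Only
  the values on \<open>elems X\<close> matter.
\<close>

definition hom ::
    "('b, 'k::field_char_0) mor1 \<Rightarrow> ('c, 'k) mor1 \<Rightarrow> bool
      \<Rightarrow> (('b \<Rightarrow>\<^sub>0 (bvar, 'k) mpoly) \<Rightarrow> ('c \<Rightarrow>\<^sub>0 (bvar, 'k) mpoly)) set" where
  "hom X Y p = {f.
     (\<forall>u\<in>elems X. \<forall>v\<in>elems X. f (u + v) = f u + f v) \<and>
     (\<forall>r\<in>base_ring X. \<forall>v\<in>elems X. f (smul r v) = smul r (f v)) \<and>
     (\<forall>q. \<forall>v\<in>homog X q. f v \<in> homog Y (q \<noteq> p))}"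

definition delta ::
    "('b, 'k::field_char_0) mor1 \<Rightarrow> ('c, 'k) mor1 \<Rightarrow> bool
      \<Rightarrow> (('b \<Rightarrow>\<^sub>0 (bvar, 'k) mpoly) \<Rightarrow> ('c \<Rightarrow>\<^sub>0 (bvar, 'k) mpoly))
      \<Rightarrow> (('b \<Rightarrow>\<^sub>0 (bvar, 'k) mpoly) \<Rightarrow> ('c \<Rightarrow>\<^sub>0 (bvar, 'k) mpoly))" where
  "delta X Y p f = (\<lambda>v. dif Y (f v) - smul (ksign p) (f (dif X v)))"

definition is_mf :: "'k::field_char_0 obj \<Rightarrow> 'k obj \<Rightarrow> ('b, 'k) mor1 \<Rightarrow> bool" where
  "is_mf A B X \<longleftrightarrow> src X = A \<and> tgt X = B \<and> dif X \<in> hom X X True \<and>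
     (\<forall>v\<in>elems X. dif X (dif X v) = smul (rename Tgt (snd B) - rename Src (snd A)) v)"

text \<open>
  Even cocycles, and equality of their cohomology classes.  The homotopy category of matrix
  factorisations has these classes as morphisms.
\<close>

definition cocycles ::
    "('b, 'k::field_char_0) mor1 \<Rightarrow> ('c, 'k) mor1
      \<Rightarrow> (('b \<Rightarrow>\<^sub>0 (bvar, 'k) mpoly) \<Rightarrow> ('c \<Rightarrow>\<^sub>0 (bvar, 'k) mpoly)) set" where
  "cocycles X Y = {f \<in> hom X Y False. \<forall>v\<in>elems X. delta X Y False f v = 0}"

definition cohomologous ::
    "('b, 'k::field_char_0) mor1 \<Rightarrow> ('c, 'k) mor1
      \<Rightarrow> (('b \<Rightarrow>\<^sub>0 (bvar, 'k) mpoly) \<Rightarrow> ('c \<Rightarrow>\<^sub>0 (bvar, 'k) mpoly))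
      \<Rightarrow> (('b \<Rightarrow>\<^sub>0 (bvar, 'k) mpoly) \<Rightarrow> ('c \<Rightarrow>\<^sub>0 (bvar, 'k) mpoly)) \<Rightarrow> bool" where
  "cohomologous X Y f g \<longleftrightarrow> (\<exists>h\<in>hom X Y True. \<forall>v\<in>elems X. f v - g v = delta X Y True h v)"

definition iso_hmf :: "('b, 'k::field_char_0) mor1 \<Rightarrow> ('c, 'k) mor1 \<Rightarrow> bool" where
  "iso_hmf X Y \<longleftrightarrow> (\<exists>f\<in>cocycles X Y. \<exists>g\<in>cocycles Y X.
     cohomologous X X (g \<circ> f) id \<and> cohomologous Y Y (f \<circ> g) id)"

definition dsum :: "('b, 'k::field_char_0) mor1 \<Rightarrow> ('c, 'k) mor1 \<Rightarrow> ('b + 'c, 'k) mor1" where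
  "dsum X Y = \<lparr>
     src = src X, tgt = tgt X,
     basis = Inl ` basis X \<union> Inr ` basis Y,
     par = case_sum (par X) (par Y),
     dcol = case_sum (\<lambda>b. base_change Inl id (dcol X b)) (\<lambda>c. base_change Inr id (dcol Y c)) \<rparr>"

text \<open>
  Objects of the Hom category: direct summands, in the homotopy category, of finite-rank matrix
  factorisations.  Taking the basis of the complement \<open>X'\<close> inside \<open>nat\<close> loses no generality: the
  complement splits an idempotent endomorphism of the finite-rank \<open>Y\<close>, hence is isomorphic in
  the homotopy category to a mapping telescope of countable rank.
\<close>

definition lg_mor :: "'k::field_char_0 obj \<Rightarrow> 'k obj \<Rightarrow> ('b, 'k) mor1 \<Rightarrow> bool" where
  "lg_mor A B X \<longleftrightarrow> is_mf A B X \<and>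
     (\<exists>(Y :: (nat, 'k) mor1) (X' :: (nat, 'k) mor1).
        is_mf A B Y \<and> finite (basis Y) \<and> is_mf A B X' \<and> iso_hmf (dsum X X') Y)"

definition lg_iso :: "'k::field_char_0 obj \<Rightarrow> 'k obj \<Rightarrow> ('b, 'k) mor1 \<Rightarrow> ('c, 'k) mor1 \<Rightarrow> bool" where
  "lg_iso A B X Y \<longleftrightarrow> lg_mor A B X \<and> lg_mor A B Y \<and> iso_hmf X Y"


section \<open>Shift and adjoint\<close>

definition shift :: "('b, 'k::field_char_0) mor1 \<Rightarrow> ('b, 'k) mor1" where
  "shift X = X\<lparr> par := (\<lambda>b. \<not> par X b), dcol := (\<lambda>b. - dcol X b) \<rparr>"

definition shift_pow :: "nat \<Rightarrow> ('b, 'k::field_char_0) mor1 \<Rightarrow> ('b, 'k) mor1" where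
  "shift_pow n = (shift ^^ n)"

fun swap_bvar :: "bvar \<Rightarrow> bvar" where
  "swap_bvar (Src i) = Tgt i"
| "swap_bvar (Tgt i) = Src i"

text \<open>
  The module dual of \<open>X\<close>, for \<open>X\<close> of finite rank, on the dual basis: \<open>b\<close> stands for the functional
  \<open>b\<^sup>*\<close>, and a functional \<open>\<phi>\<close> for the coefficient function \<open>b' \<mapsto> \<phi>(b')\<close>.  Thus \<open>b\<^sup>* \<circ> d\<close> has
  \<open>b'\<close>-coefficient equal to the \<open>b\<close>-coefficient of \<open>d(b')\<close>.  As a 1-morphism it goes in the
  opposite direction, so source and target variables are exchanged.
\<close>

definition vee :: "('b, 'k::field_char_0) mor1 \<Rightarrow> ('b, 'k) mor1" where
  "vee X = \<lparr>
     src = tgt X, tgt = src X,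
     basis = basis X,
     par = par X,
     dcol = (\<lambda>b. \<Sum>b'\<in>basis X. Poly_Mapping.single b'
               (ksign (\<not> par X b) * rename swap_bvar (Poly_Mapping.lookup (dcol X b') b))) \<rparr>"

definition right_adj :: "('b, 'k::field_char_0) mor1 \<Rightarrow> ('b, 'k) mor1" where
  "right_adj X = shift_pow (fst (src X)) (vee X)"


section \<open>Horizontal composition\<close>

text \<open>
  For \<open>X\<close> over \<open>k[x, y]\<close> and \<open>Y\<close> over \<open>k[y, z]\<close>, free on \<open>B\<close> and \<open>C\<close>, the module \<open>Y \<otimes>\<^bsub>k[y]\<^esub> X\<close>
  is free over \<open>k[x, y, z]\<close> on the \<open>c \<otimes> b\<close>.  Over \<open>k[x, z]\<close> it is therefore free on the
  \<open>c \<otimes> y\<^sup>\<mu> b\<close>, encoded as triples \<open>(c, \<mu>, b)\<close>.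
\<close>

datatype tvar = XV nat | YV nat | ZV nat

fun xy_var :: "bvar \<Rightarrow> tvar" where
  "xy_var (Src i) = XV i"
| "xy_var (Tgt j) = YV j"

fun yz_var :: "bvar \<Rightarrow> tvar" where
  "yz_var (Src j) = YV j"
| "yz_var (Tgt l) = ZV l"

definition y_part :: "tvar mon \<Rightarrow> nat mon" where
  "y_part m = (\<Sum>v\<in>Poly_Mapping.keys m. case v of
     XV i \<Rightarrow> 0 | YV j \<Rightarrow> Poly_Mapping.single j (Poly_Mapping.lookup m v) | ZV l \<Rightarrow> 0)"

definition xz_part :: "tvar mon \<Rightarrow> bvar mon" where
  "xz_part m = (\<Sum>v\<in>Poly_Mapping.keys m. case v of
     XV i \<Rightarrow> Poly_Mapping.single (Src i) (Poly_Mapping.lookup m v)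
   | YV j \<Rightarrow> 0
   | ZV l \<Rightarrow> Poly_Mapping.single (Tgt l) (Poly_Mapping.lookup m v))"

text \<open>Writing \<open>p = \<Sum> p\<^sub>\<mu> y\<^sup>\<mu>\<close> with \<open>p\<^sub>\<mu>\<close> in \<open>k[x, z]\<close>, this is the function \<open>\<mu> \<mapsto> p\<^sub>\<mu>\<close>.\<close>

definition y_coeffs :: "(tvar, 'k::field_char_0) mpoly \<Rightarrow> (nat mon \<Rightarrow>\<^sub>0 (bvar, 'k) mpoly)" where
  "y_coeffs p = (\<Sum>m\<in>Poly_Mapping.keys p.
     Poly_Mapping.single (y_part m) (Poly_Mapping.single (xz_part m) (Poly_Mapping.lookup p m)))"

text \<open>The element \<open>v \<otimes> u\<close> of \<open>Y \<otimes>\<^bsub>k[y]\<^esub> X\<close>, for \<open>v\<close> in \<open>Y\<close> and \<open>u\<close> in \<open>X\<close>.\<close>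

definition tens ::
    "('c \<Rightarrow>\<^sub>0 (bvar, 'k::field_char_0) mpoly) \<Rightarrow> ('b \<Rightarrow>\<^sub>0 (bvar, 'k) mpoly)
      \<Rightarrow> ('c \<times> nat mon \<times> 'b \<Rightarrow>\<^sub>0 (bvar, 'k) mpoly)" where
  "tens v u = (\<Sum>c\<in>Poly_Mapping.keys v. \<Sum>b\<in>Poly_Mapping.keys u.
     base_change (\<lambda>\<mu>. (c, \<mu>, b)) id
       (y_coeffs (rename yz_var (Poly_Mapping.lookup v c) * rename xy_var (Poly_Mapping.lookup u b))))"

text \<open>The sign in the second summand is the Koszul sign of moving the odd \<open>d\<^sub>X\<close> past \<open>c\<close>.\<close>

definition comp ::
    "('c, 'k::field_char_0) mor1 \<Rightarrow> ('b, 'k) mor1 \<Rightarrow> ('c \<times> nat mon \<times> 'b, 'k) mor1"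
    (infixr \<open>\<odot>\<close> 65) where
  "Y \<odot> X = \<lparr>
     src = src X, tgt = tgt Y,
     basis = {(c, \<mu>, b). c \<in> basis Y \<and> Poly_Mapping.keys \<mu> \<subseteq> {..<fst (tgt X)} \<and> b \<in> basis X},
     par = (\<lambda>(c, \<mu>, b). par Y c \<noteq> par X b),
     dcol = (\<lambda>(c, \<mu>, b).
       let y\<mu> = Poly_Mapping.single (rename_mon Tgt \<mu>) 1 in
         tens (dcol Y c) (smul y\<mu> (bas b))
         + smul (ksign (par Y c)) (tens (bas c) (smul y\<mu> (dcol X b)))) \<rparr>"


section \<open>Monoidal product of 1-morphisms\<close>

fun shift_bvar :: "nat \<Rightarrow> nat \<Rightarrow> bvar \<Rightarrow> bvar" where
  "shift_bvar n m (Src i) = Src (n + i)"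
| "shift_bvar n m (Tgt j) = Tgt (m + j)"

definition box ::
    "('b, 'k::field_char_0) mor1 \<Rightarrow> ('c, 'k) mor1 \<Rightarrow> ('b \<times> 'c, 'k) mor1" (infixr \<open>\<box>\<close> 70) where
  "X \<box> Y = \<lparr>
     src = src X \<box>\<^sub>o src Y, tgt = tgt X \<box>\<^sub>o tgt Y,
     basis = basis X \<times> basis Y,
     par = (\<lambda>(b, c). par X b \<noteq> par Y c),
     dcol = (\<lambda>(b, c).
       base_change (\<lambda>b'. (b', c)) id (dcol X b)
       + smul (ksign (par X b))
           (base_change (\<lambda>c'. (b, c')) (rename (shift_bvar (fst (src X)) (fst (tgt X))))
             (dcol Y c))) \<rparr>"


section \<open>Unit 1-morphisms\<close>

text \<open>
  The exterior algebra on \<open>\<theta>\<^sub>0, ..., \<theta>\<^sub>n\<^sub>-\<^sub>1\<close> has the basis \<open>\<theta>\<^sub>T\<close>, \<open>T \<subseteq> {..<n}\<close>, where \<open>\<theta>\<^sub>T\<close> is the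
  wedge product of the \<open>\<theta>\<^sub>i\<close>, \<open>i \<in> T\<close>, in increasing order.
\<close>

definition theta_sign :: "nat \<Rightarrow> nat set \<Rightarrow> 'r::comm_ring_1" where
  "theta_sign i T = (-1) ^ card {j \<in> T. j < i}"

definition wedge :: "nat \<Rightarrow> nat set \<Rightarrow> (nat set \<Rightarrow>\<^sub>0 'r::comm_ring_1)" where
  "wedge i T = (if i \<in> T then 0 else Poly_Mapping.single (insert i T) (theta_sign i T))"

definition contract :: "nat \<Rightarrow> nat set \<Rightarrow> (nat set \<Rightarrow>\<^sub>0 'r::comm_ring_1)" where
  "contract i T = (if i \<in> T then Poly_Mapping.single (T - {i}) (theta_sign i T) else 0)"

text \<open>
  \<open>mixed i W\<close> is \<open>W(x\<^sub>0, ..., x\<^sub>i\<^sub>-\<^sub>1, x'\<^sub>i, ..., x'\<^sub>n\<^sub>-\<^sub>1)\<close>, with \<open>x\<close> the source and \<open>x'\<close> the target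
  variables.
\<close>

definition mixed :: "nat \<Rightarrow> (nat, 'k::field_char_0) mpoly \<Rightarrow> (bvar, 'k) mpoly" where
  "mixed i W = rename (\<lambda>j. if j < i then Src j else Tgt j) W"

definition diff_quot :: "nat \<Rightarrow> (nat, 'k::field_char_0) mpoly \<Rightarrow> (bvar, 'k) mpoly" where
  "diff_quot i W = (THE q. q * (var (Tgt i) - var (Src i)) = mixed i W - mixed (Suc i) W)"

definition unit1 :: "'k::field_char_0 obj \<Rightarrow> (nat set, 'k) mor1" where
  "unit1 A = \<lparr>
     src = A, tgt = A,
     basis = Pow {..<fst A},
     par = (\<lambda>T. odd (card T)),
     dcol = (\<lambda>T. \<Sum>i<fst A.
       smul (diff_quot i (snd A)) (wedge i T)
       + smul (var (Tgt i) - var (Src i)) (contract i T)) \<rparr>"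


section \<open>Structure 1-morphisms and the Serre automorphism\<close>

text \<open>
  \<open>relabel A B \<rho> X\<close> is the matrix factorisation \<open>X\<close> viewed as a 1-morphism from \<open>A\<close> to \<open>B\<close>, after
  renaming its variables by \<open>\<rho>\<close>.
\<close>

definition relabel ::
    "'k::field_char_0 obj \<Rightarrow> 'k obj \<Rightarrow> (bvar \<Rightarrow> bvar) \<Rightarrow> ('b, 'k) mor1 \<Rightarrow> ('b, 'k) mor1" where
  "relabel A B \<rho> X =
     X\<lparr> src := A, tgt := B, dcol := (\<lambda>b. base_change id (rename \<rho>) (dcol X b)) \<rparr>"

definition runit :: "'k::field_char_0 obj \<Rightarrow> (nat set, 'k) mor1" where
  "runit A = relabel (A \<box>\<^sub>o unit_obj) A id (unit1 A)"

definition runit_inv :: "'k::field_char_0 obj \<Rightarrow> (nat set, 'k) mor1" where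
  "runit_inv A = relabel A (A \<box>\<^sub>o unit_obj) id (unit1 A)"

text \<open>
  The unit on \<open>A \<box>\<^sub>o B\<close> has target variables \<open>(a', b')\<close>; in the target \<open>B \<box>\<^sub>o A\<close> of the braiding
  they are listed as \<open>(b', a')\<close>.
\<close>

fun braid_var :: "nat \<Rightarrow> nat \<Rightarrow> bvar \<Rightarrow> bvar" where
  "braid_var n m (Src i) = Src i"
| "braid_var n m (Tgt j) = Tgt (if j < n then m + j else j - n)"

definition braiding :: "'k::field_char_0 obj \<Rightarrow> 'k obj \<Rightarrow> (nat set, 'k) mor1" where
  "braiding A B =
     relabel (A \<box>\<^sub>o B) (B \<box>\<^sub>o A) (braid_var (fst A) (fst B)) (unit1 (A \<box>\<^sub>o B))"

text \<open>
  The unit on \<open>A\<close> is a matrix factorisation of \<open>W(x') - W(x)\<close>; in the source of \<open>ev\<close>, with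
  potential \<open>W(x) - W(x')\<close>, the variables are listed as \<open>(x, x')\<close>.
\<close>

fun ev_var :: "nat \<Rightarrow> bvar \<Rightarrow> bvar" where
  "ev_var n (Src i) = Src i"
| "ev_var n (Tgt i) = Src (n + i)"

definition ev :: "'k::field_char_0 obj \<Rightarrow> (nat set, 'k) mor1" where
  "ev A = relabel (A \<box>\<^sub>o dual_obj A) unit_obj (ev_var (fst A)) (unit1 A)"

text \<open>Associators do not appear: \<open>\<box>\<^sub>o\<close> is strictly associative.  \<open>\<odot>\<close> brackets to the right.\<close>

definition serre where
  "serre (A :: 'k::field_char_0 obj) =
     runit A
     \<odot> (unit1 A \<box> ev A)
     \<odot> (braiding A A \<box> unit1 (dual_obj A))
     \<odot> (unit1 A \<box> right_adj (ev A))
     \<odot> runit_inv A"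

end

theory Submission
  imports Defs Complex_Main "HOL-Library.Nat_Bijection"
begin

text \<open>
  All five factors of the Serre automorphism are Koszul matrix factorisations, so up to signs the
  composite is one Koszul complex on \<open>9 n\<close> exterior generators, over the polynomial ring in the source,
  target and internal variables.  For \<open>8 n\<close> of the generators one of the two coefficients is, up to
  sign, the difference of an internal variable \<open>v\<close> and another variable \<open>a\<close>.  Such a generator and
  \<open>v\<close> can be eliminated at the price of the substitution \<open>v = a\<close>, up to homotopy over the
  source and target variables only.  What remains are the \<open>n\<close> generators of the leftmost factor
  \<open>r\<close>, with exactly the differential of the unit.  The other coefficients never matter: no
  comparison of different Koszul factorisations of \<open>W(x') - W(x)\<close> is needed.

  If the difference is the coefficient of the contraction, the quotient has the parity and the
  differential of the remaining generators.  If it is the coefficient of the multiplication, the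
  quotient is spanned by the multiples of the generator, which shifts the parity and changes the sign
  of the differential.  The latter happens exactly for the \<open>n\<close> generators of the adjoint of \<open>ev\<close>,
  which is the origin of the shift by \<open>n\<close>.
\<close>

section \<open>Finitely supported functions and polynomials\<close>

text \<open>A composite has infinite rank over the source and target variables, because internal
  monomials sit in its basis. Flattening moves them into the coefficients and leaves a finite-rank
  module over a larger ring, with restricted scalars. Only these scalars have to be respected: the
  contracting homotopy divides by \<open>v - a\<close>, which commutes with polynomials free of
  \<open>v\<close> but not with \<open>v\<close>. Hence the names of source and target variables
  must avoid the eliminated ones. The obstacle is that the projection to \<open>v = a\<close> has an
  obvious linear section but not an obvious chain section, since the other coefficients may contain
  \<open>v\<close>. The linear section is corrected to a chain map; this uses that the square of the
  differential is a scalar from the base ring, so the sum of the \<open>p i * q i\<close> is tracked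
  through every elimination. The order of elimination follows the strand from the source through the
  braiding and the loop formed by \<open>ev\<close> and its adjoint: each generator then identifies
  a new copy of a variable with one already replaced by the source variable. The finite-rank
  remainder also shows that the composite is a 1-morphism of the Hom category.\<close>

abbreviation "lookup \<equiv> Poly_Mapping.lookup"
abbreviation "single \<equiv> Poly_Mapping.single"
abbreviation "keys \<equiv> Poly_Mapping.keys"

lemma sum_keys_single:
  fixes F :: "'b \<Rightarrow> 'r::zero \<Rightarrow> 'c::comm_monoid_add"
  assumes "F b 0 = 0"
  shows "(\<Sum>k\<in>keys (single b r). F k (lookup (single b r) k)) = F b r"
  using assms by auto

lemma sum_keys_add:
  fixes F :: "'b \<Rightarrow> 'r::monoid_add \<Rightarrow> 'c::comm_monoid_add"
  assumes "\<And>b. F b 0 = 0" "\<And>b x y. F b (x + y) = F b x + F b y"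
  shows "(\<Sum>b\<in>keys (u + v). F b (lookup (u + v) b)) =
         (\<Sum>b\<in>keys u. F b (lookup u b)) + (\<Sum>b\<in>keys v. F b (lookup v b))"
  by (rule setsum_keys_plus_distrib) (use assms in auto)

lemma sum_keys_superset:
  fixes F :: "'b \<Rightarrow> 'r::zero \<Rightarrow> 'c::comm_monoid_add"
  assumes "finite S" "keys v \<subseteq> S" "\<And>b. F b 0 = 0"
  shows "(\<Sum>b\<in>keys v. F b (lookup v b)) = (\<Sum>b\<in>S. F b (lookup v b))"
  by (rule sum.mono_neutral_left) (use assms in \<open>auto simp: in_keys_iff\<close>)

lemma sum_single_keys:
  fixes v :: "'b \<Rightarrow>\<^sub>0 'r::comm_monoid_add"
  shows "(\<Sum>b\<in>keys v. single b (lookup v b)) = v"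
proof (rule poly_mapping_eqI)
  fix k
  have "lookup (\<Sum>b\<in>keys v. single b (lookup v b)) k =
      (\<Sum>b\<in>keys v. if b = k then lookup v b else 0)"
    unfolding lookup_sum by (rule sum.cong) (auto simp: lookup_single when_def)
  also have "\<dots> = lookup v k" by (auto simp: sum.delta in_keys_iff)
  finally show "lookup (\<Sum>b\<in>keys v. single b (lookup v b)) k = lookup v k" .
qed

lemma sum_single_superset:
  fixes v :: "'b \<Rightarrow>\<^sub>0 'r::comm_monoid_add"
  assumes "finite S" "keys v \<subseteq> S"
  shows "(\<Sum>b\<in>S. single b (lookup v b)) = v"
  using sum_keys_superset[OF assms, of single] sum_single_keys[of v] by simp

lemma poly_mapping_add_induct [case_names zero single add]:
  fixes v :: "'b \<Rightarrow>\<^sub>0 'r::comm_monoid_add"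
  assumes "P 0" "\<And>b c. P (single b c)" "\<And>u v. P u \<Longrightarrow> P v \<Longrightarrow> P (u + v)"
  shows "P v"
proof -
  have "P (\<Sum>b\<in>B. single b (lookup v b))" for B
    by (induction B rule: infinite_finite_induct) (auto intro: assms)
  from this[of "keys v"] show ?thesis by (simp add: sum_single_keys)
qed

lemma additiveI_sum_keys:
  fixes F :: "'b \<Rightarrow> 'r::ab_group_add \<Rightarrow> 'c::ab_group_add"
  assumes "\<And>b. additive (F b)"
  shows "additive (\<lambda>v. \<Sum>b\<in>keys v. F b (lookup v b))"
  by (standard, rule sum_keys_add) (use assms in \<open>auto simp: additive.add additive.zero\<close>)

text \<open>Several maps below, division by a difference of variables among them, are additive but
  not linear over all polynomials. Identities are therefore tested on single-term vectors with their
  actual coefficient instead of on basis vectors.\<close>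

lemma additive_eqI:
  fixes f g :: "('b \<Rightarrow>\<^sub>0 'r::ab_group_add) \<Rightarrow> 'c::ab_group_add"
  assumes "additive f" "additive g" "\<And>b. b \<in> keys v \<Longrightarrow> f (single b (lookup v b)) = g (single b (lookup v b))"
  shows "f v = g v"
proof -
  have "f (\<Sum>b\<in>keys v. single b (lookup v b)) = g (\<Sum>b\<in>keys v. single b (lookup v b))"
    using assms by (simp add: additive.sum)
  then show ?thesis by (simp add: sum_single_keys)
qed

lemma additive_comp: "additive f \<Longrightarrow> additive g \<Longrightarrow> additive (\<lambda>x. f (g x))"
  by (simp add: additive_def)

lemma additive_sum: "(\<And>i. i \<in> I \<Longrightarrow> additive (f i)) \<Longrightarrow> additive (\<lambda>x. \<Sum>i\<in>I. f i x)"
  by (simp add: additive_def sum.distrib)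

lemma additive_id: "additive (\<lambda>x. x)"
  by (simp add: additive_def)

lemma additive_single: "additive (single b)"
  by (simp add: additive_def single_add)

lemma lookup_smul [simp]: "lookup (smul r v) b = r * lookup v b"
  by (simp add: smul_def Poly_Mapping.map.rep_eq when_def)

interpretation smul: module smul
  by standard (auto intro!: poly_mapping_eqI simp: lookup_add algebra_simps)

lemma smul_single [simp]: "smul r (single b s) = single b (r * s)"
  by (simp add: smul_def)

lemma keys_smul: "keys (smul r v) \<subseteq> keys v"
  by (auto simp: in_keys_iff)


subsection \<open>Extension by linearity\<close>

lemma additive_lin_ext: "additive (lin_ext f)"
  unfolding lin_ext_def
  by (rule additiveI_sum_keys) (simp add: additive_def smul.scale_left_distrib)

lemma lin_ext_single [simp]: "lin_ext f (single b r) = smul r (f b)"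
  unfolding lin_ext_def by (subst sum_keys_single) auto

lemmas lin_ext_add = additive.add[OF additive_lin_ext]
  and lin_ext_minus = additive.minus[OF additive_lin_ext]
  and lin_ext_zero [simp] = additive.zero[OF additive_lin_ext]
  and lin_ext_sum = additive.sum[OF additive_lin_ext]

lemma lin_ext_smul: "lin_ext f (smul r v) = smul r (lin_ext f v)"
  by (rule additive_eqI[where v = v])
     (auto simp: additive_def lin_ext_add smul.scale_right_distrib)

lemma additive_base_change:
  assumes "additive \<phi>"
  shows "additive (base_change \<beta> \<phi>)"
  unfolding base_change_def
  by (rule additiveI_sum_keys) (use assms in \<open>auto simp: additive_def single_add\<close>)

lemma base_change_single [simp]: "\<phi> 0 = 0 \<Longrightarrow> base_change \<beta> \<phi> (single b r) = single (\<beta> b) (\<phi> r)"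
  unfolding base_change_def by (subst sum_keys_single) auto

lemma lookup_base_change_id:
  assumes "\<phi> 0 = 0"
  shows "lookup (base_change id \<phi> v) b = \<phi> (lookup v b)"
proof -
  have "lookup (base_change id \<phi> v) b = (\<Sum>c\<in>keys v. if c = b then \<phi> (lookup v c) else 0)"
    unfolding base_change_def lookup_sum by (rule sum.cong) (auto simp: lookup_single when_def)
  also have "\<dots> = \<phi> (lookup v b)" using assms by (auto simp: sum.delta in_keys_iff)
  finally show ?thesis .
qed

subsection \<open>Polynomial subrings\<close>

definition mons :: "'v set \<Rightarrow> 'v mon set" where
  "mons S = {m. keys m \<subseteq> S}"

lemma polys_iff: "p \<in> polys S \<longleftrightarrow> keys p \<subseteq> mons S"
  by (auto simp: polys_def mons_def)

lemma mons_zero [simp]: "0 \<in> mons S"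
  by (simp add: mons_def)

lemma mons_add [intro]: "m \<in> mons S \<Longrightarrow> m' \<in> mons S \<Longrightarrow> m + m' \<in> mons S"
  using keys_add[of m m'] by (auto simp: mons_def)

lemma mons_single [simp]: "v \<in> S \<Longrightarrow> single v k \<in> mons S"
  by (simp add: mons_def)

lemma mons_mono: "S \<subseteq> T \<Longrightarrow> mons S \<subseteq> mons T"
  by (auto simp: mons_def)

lemma polys_zero [simp]: "0 \<in> polys S"
  and polys_one [simp]: "1 \<in> polys S"
  and polys_single: "m \<in> mons S \<Longrightarrow> single m c \<in> polys S"
  and polys_var: "v \<in> S \<Longrightarrow> var v \<in> polys S"
  by (auto simp: polys_iff var_def)

lemma polys_add [intro]: "p \<in> polys S \<Longrightarrow> q \<in> polys S \<Longrightarrow> p + q \<in> polys S"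
  using keys_add[of p q] by (auto simp: polys_iff)

lemma polys_minus_iff [simp]: "- p \<in> polys S \<longleftrightarrow> p \<in> polys S"
  by (simp add: polys_def in_keys_iff)

lemma polys_diff [intro]: "p \<in> polys S \<Longrightarrow> q \<in> polys S \<Longrightarrow> p - q \<in> polys S"
  using polys_add[of p S "- q"] by simp

lemma polys_mult [intro]: "p \<in> polys S \<Longrightarrow> q \<in> polys S \<Longrightarrow> p * q \<in> polys S"
  using keys_mult[of p q] by (fastforce simp: polys_iff)

lemma polys_sum [intro]: "(\<And>i. i \<in> I \<Longrightarrow> f i \<in> polys S) \<Longrightarrow> (\<Sum>i\<in>I. f i) \<in> polys S"
  by (induction I rule: infinite_finite_induct) auto

lemma polys_mono: "S \<subseteq> T \<Longrightarrow> polys S \<subseteq> polys T"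
  by (auto simp: polys_def)

lemma polys_ksign [simp]: "ksign e \<in> polys S"
  by (simp add: ksign_def)

lemma polys_UNIV [simp]: "p \<in> polys UNIV"
  by (simp add: polys_def)

text \<open>Constants and variables generate the ring. Statements compatible with sums and products,
  such as the effect of renaming or the divisibility of \<open>p - rename (id(v := a)) p\<close>,
  then need no computation with monomials.\<close>

lemma polys_induct [consumes 1, case_names cst var add mult]:
  assumes p: "p \<in> polys S"
    and cst: "\<And>c. P (cst c)" and var: "\<And>v. v \<in> S \<Longrightarrow> P (var v)"
    and add: "\<And>p q. p \<in> polys S \<Longrightarrow> q \<in> polys S \<Longrightarrow> P p \<Longrightarrow> P q \<Longrightarrow> P (p + q)"
    and mult: "\<And>p q. p \<in> polys S \<Longrightarrow> q \<in> polys S \<Longrightarrow> P p \<Longrightarrow> P q \<Longrightarrow> P (p * q)"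
  shows "P p"
proof -
  have cstp: "cst c \<in> polys S" for c :: 'b by (simp add: cst_def polys_single)
  have sv: "single (single v k) (1::'b) \<in> polys S \<and> P (single (single v k) (1::'b))" if "v \<in> S" for v k
  proof (induction k)
    case 0
    then show ?case using cst[of 1] cstp[of 1] by (simp add: cst_def)
  next
    case (Suc k)
    have "single (single v (Suc k)) (1::'b) = var v * single (single v k) 1"
      by (simp add: var_def mult_single flip: single_add)
    moreover have "var v * single (single v k) (1::'b) \<in> polys S"
      using Suc that by (intro polys_mult polys_var) auto
    moreover have "P (var v * single (single v k) (1::'b))"
      using Suc that by (intro mult polys_var var) auto
    ultimately show ?case by simp
  qed
  have mon: "m \<in> mons S \<longrightarrow> P (single m (1::'b))" for m
  proof (induction m rule: poly_mapping_add_induct)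
    case zero
    then show ?case using cst[of 1] by (simp add: cst_def)
  next
    case (single v)
    then show ?case using sv cst[of 1] by (auto simp: mons_def in_keys_iff cst_def)
  next
    case (add u w)
    have eq: "single (u + w) (1::'b) = single u 1 * single w 1" by (simp add: mult_single)
    show ?case
    proof
      assume "u + w \<in> mons S"
      then have "u \<in> mons S" "w \<in> mons S"
        by (auto simp: mons_def in_keys_iff lookup_add subset_iff)
      then show "P (single (u + w) (1::'b))"
        unfolding eq using add by (auto intro!: mult polys_single)
    qed
  qed
  have mon': "m \<in> mons S \<Longrightarrow> P (single m c)" for m c
  proof -
    assume m: "m \<in> mons S"
    have "single m c = cst c * single m 1" by (simp add: cst_def mult_single)
    then show ?thesis using m mon cst by (auto intro!: mult cstp polys_single)
  qed
  have "p \<in> polys S \<longrightarrow> P p"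
  proof -
    have "(\<Sum>m\<in>M. single m (lookup p m)) \<in> polys S \<and> P (\<Sum>m\<in>M. single m (lookup p m))"
      if "M \<subseteq> keys p" for M
      using finite_subset[OF that finite_keys] that
    proof (induction M)
      case empty
      then show ?case using cst[of 0] by (simp add: cst_def)
    next
      case (insert m M)
      have "m \<in> mons S" using insert p by (auto simp: polys_iff)
      then show ?case using insert by (auto intro!: add mon' polys_single)
    qed
    from this[of "keys p"] show ?thesis by (simp add: sum_single_keys)
  qed
  then show ?thesis using p by simp
qed


subsection \<open>Renaming of variables\<close>

lemma rename_mon_zero [simp]: "rename_mon nm 0 = 0"
  by (simp add: rename_mon_def)

lemma rename_mon_single [simp]: "rename_mon nm (single v k) = single (nm v) k"
  unfolding rename_mon_def by (subst sum_keys_single) auto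

lemma rename_mon_add: "rename_mon nm (m + m') = rename_mon nm m + rename_mon nm m'"
  unfolding rename_mon_def by (rule sum_keys_add) (auto simp: single_add)

lemma rename_mon_comp: "rename_mon \<sigma> (rename_mon nm m) = rename_mon (\<sigma> \<circ> nm) m"
  by (induction m rule: poly_mapping_add_induct) (auto simp: rename_mon_add)

lemma rename_mon_cong:
  assumes "\<And>v. v \<in> keys m \<Longrightarrow> nm v = \<sigma> v"
  shows "rename_mon nm m = rename_mon \<sigma> m"
  using assms by (simp add: rename_mon_def)

lemma rename_mon_id [simp]: "rename_mon id m = m" "rename_mon (\<lambda>v. v) m = m"
  by (simp_all add: rename_mon_def sum_single_keys)

lemma keys_rename_mon: "keys (rename_mon nm m) \<subseteq> nm ` keys m"
proof -
  have "keys (rename_mon nm m) \<subseteq> (\<Union>v\<in>keys m. keys (single (nm v) (lookup m v)))"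
    unfolding rename_mon_def by (rule keys_sum)
  also have "\<dots> \<subseteq> nm ` keys m" by (auto split: if_splits)
  finally show ?thesis .
qed

lemma rename_mon_mons: "m \<in> mons S \<Longrightarrow> nm ` S \<subseteq> T \<Longrightarrow> rename_mon nm m \<in> mons T"
  using keys_rename_mon[of nm m] by (fastforce simp: mons_def)

lemma additive_rename: "additive (rename nm)"
  unfolding rename_def by (rule additiveI_sum_keys) (auto simp: additive_def single_add)

lemma rename_single [simp]: "rename nm (single m c) = single (rename_mon nm m) c"
  unfolding rename_def by (subst sum_keys_single) auto

lemmas rename_add = additive.add[OF additive_rename]
  and rename_diff = additive.diff[OF additive_rename]
  and rename_minus = additive.minus[OF additive_rename]
  and rename_zero [simp] = additive.zero[OF additive_rename]
  and rename_sum = additive.sum[OF additive_rename]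

lemma rename_one [simp]: "rename nm 1 = 1"
  using rename_single[of nm 0 1] by simp

lemma rename_mult: "rename nm (p * q) = rename nm p * rename nm q"
proof (rule additive_eqI[where v = p])
  fix m
  show "rename nm (single m (lookup p m) * q) = rename nm (single m (lookup p m)) * rename nm q"
    by (rule additive_eqI[where v = q])
       (auto simp: additive_def rename_add distrib_left mult_single rename_mon_add)
qed (auto simp: additive_def rename_add distrib_right)

lemma rename_var [simp]: "rename nm (var v) = var (nm v)"
  by (simp add: var_def)

lemma rename_cst [simp]: "rename nm (cst c) = cst c"
  by (simp add: cst_def)

lemma rename_ksign [simp]: "rename nm (ksign e) = ksign e"
  by (simp add: ksign_def rename_minus)

lemma rename_comp: "rename \<sigma> (rename nm p) = rename (\<sigma> \<circ> nm) p"
proof (rule additive_eqI[where v = p])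
  show "additive (\<lambda>p. rename \<sigma> (rename nm p))" by (simp add: additive_def rename_add)
qed (simp_all add: additive_rename rename_mon_comp o_def)

lemma rename_cong:
  assumes "p \<in> polys S" "\<And>v. v \<in> S \<Longrightarrow> nm v = \<sigma> v"
  shows "rename nm p = rename \<sigma> p"
  unfolding rename_def
  by (intro sum.cong refl arg_cong2[where f = single] rename_mon_cong)
     (use assms in \<open>auto simp: polys_def\<close>)

lemma rename_id [simp]: "rename id p = p" "rename (\<lambda>v. v) p = p"
  by (simp_all add: rename_def sum_single_keys)

lemma rename_idI: "p \<in> polys S \<Longrightarrow> (\<And>v. v \<in> S \<Longrightarrow> nm v = v) \<Longrightarrow> rename nm p = p"
  using rename_cong[of p S nm id] by simp

lemma rename_polys: "p \<in> polys S \<Longrightarrow> nm ` S \<subseteq> T \<Longrightarrow> rename nm p \<in> polys T"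
  by (induction p rule: polys_induct)
     (auto simp: rename_add rename_mult polys_var cst_def polys_single)


subsection \<open>Division by a difference of two variables\<close>

lemma lookup_var_mult:
  "lookup (var v * q) m = (if v \<in> keys m then lookup q (m - single v 1) else 0)"
  for q :: "('v, 'k::field_char_0) mpoly"
proof (rule additive_eqI[where v = q and f = "\<lambda>q. lookup (var v * q) m"])
  show "additive (\<lambda>q. lookup (var v * q) m)"
    by (auto simp: additive_def algebra_simps lookup_add)
  show "additive (\<lambda>q. if v \<in> keys m then lookup q (m - single v 1) else 0)"
    by (auto simp: additive_def lookup_add)
next
  fix l
  \<comment> \<open>Subtraction of exponents is truncated; \<open>v \<in> keys m\<close> makes it a
    true inverse of adding \<open>v\<close>.\<close>
  have "single v 1 + l = m \<longleftrightarrow> v \<in> keys m \<and> l = m - single v 1"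
  proof
    assume "v \<in> keys m \<and> l = m - single v 1"
    then have "0 < lookup m v" "l = m - single v 1" by (auto simp: in_keys_iff)
    then show "single v 1 + l = m"
      by (intro poly_mapping_eqI) (auto simp: lookup_add lookup_minus lookup_single when_def)
  qed (auto simp: in_keys_iff lookup_add)
  then show "lookup (var v * single l (lookup q l)) m =
      (if v \<in> keys m then lookup (single l (lookup q l)) (m - single v 1) else 0)"
    by (auto simp: var_def mult_single lookup_single when_def)
qed

text \<open>Comparison of top degrees: if \<open>m\<close> has maximal \<open>v\<close>-degree in
  \<open>q\<close>, then raising \<open>m\<close> by \<open>v\<close> gives a monomial whose
  coefficient in \<open>var v * q\<close> is that of \<open>m\<close>, while
  \<open>var a * q\<close> has none there. Uniqueness of all quotients below rests on this.\<close>

lemma var_diff_mult_eq_0: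
  fixes q :: "('v, 'k::field_char_0) mpoly"
  assumes "v \<noteq> a" "(var v - var a) * q = 0"
  shows "q = 0"
proof (rule ccontr)
  assume "q \<noteq> 0"
  then have ne: "keys q \<noteq> {}" by simp
  define N where "N = Max ((\<lambda>m. lookup m v) ` keys q)"
  have "N \<in> (\<lambda>m. lookup m v) ` keys q" unfolding N_def using ne by (intro Max_in) auto
  then obtain m where m: "m \<in> keys q" "lookup m v = N" by auto
  have max: "lookup l v \<le> N" if "l \<in> keys q" for l
    unfolding N_def using that by (intro Max_ge) auto
  let ?l = "m + single v 1"
  have "lookup (var v * q) ?l = lookup q m" by (simp add: lookup_var_mult in_keys_iff lookup_add)
  moreover have "lookup (var a * q) ?l = 0"
  proof -
    have "lookup (?l - single a 1) v = Suc N"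
      using assms(1) m by (simp add: lookup_add lookup_minus lookup_single when_def)
    then have "?l - single a 1 \<notin> keys q" using max[of "?l - single a 1"] by auto
    then show ?thesis unfolding lookup_var_mult by (simp add: in_keys_iff)
  qed
  ultimately have "lookup ((var v - var a) * q) ?l = lookup q m"
    by (simp add: left_diff_distrib lookup_minus)
  then show False using assms(2) m by (simp add: in_keys_iff)
qed

text \<open>A twisted Leibniz rule,
  \<open>p p' - s(p) s(p') = p (p' - s(p')) + (p - s(p)) s(p')\<close> for the substitution
  \<open>s\<close>, carries divisibility from factors to products. Keeping the quotient in
  \<open>polys S\<close> ensures that no new variables enter.\<close>

lemma ex_var_diff_quot:
  fixes p :: "('v, 'k::field_char_0) mpoly"
  assumes "p \<in> polys S" "v \<in> S" "a \<in> S"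
  shows "\<exists>q\<in>polys S. p - rename (id(v := a)) p = (var v - var a) * q"
  using assms(1)
proof (induction rule: polys_induct)
  case (var w)
  then show ?case
    by (cases "w = v") (auto intro: bexI[of _ 1] bexI[of _ 0])
next
  case (add p p')
  then obtain q q' where "q \<in> polys S" "q' \<in> polys S"
    "p - rename (id(v := a)) p = (var v - var a) * q"
    "p' - rename (id(v := a)) p' = (var v - var a) * q'" by blast
  then have "p + p' - rename (id(v := a)) (p + p') = (var v - var a) * (q + q')"
    by (simp only: rename_add add_diff_add distrib_left)
  then show ?case by (rule bexI) (intro polys_add; fact)
next
  case (mult p p')
  then obtain q q' where q: "q \<in> polys S" "q' \<in> polys S"
    "p - rename (id(v := a)) p = (var v - var a) * q"
    "p' - rename (id(v := a)) p' = (var v - var a) * q'" by blast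
  have "p * p' - rename (id(v := a)) (p * p') =
      p * (p' - rename (id(v := a)) p') + (p - rename (id(v := a)) p) * rename (id(v := a)) p'"
    by (simp add: rename_mult algebra_simps)
  also have "\<dots> = (var v - var a) * (p * q' + q * rename (id(v := a)) p')"
    unfolding q by (simp add: algebra_simps)
  finally show ?case
  proof (rule bexI)
    show "p * q' + q * rename (id(v := a)) p' \<in> polys S"
      using q(1,2) mult.hyps assms(2,3) by (intro polys_add polys_mult rename_polys[of p' S]) auto
  qed
qed (auto intro: bexI[of _ 0])

lemma diff_quot_eqI:
  assumes "q * (var (Tgt i) - var (Src i)) = mixed i W - mixed (Suc i) W"
  shows "diff_quot i W = q"
  unfolding diff_quot_def
proof (rule the_equality)
  fix q' assume "q' * (var (Tgt i) - var (Src i)) = mixed i W - mixed (Suc i) W"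
  then have "q' * (var (Tgt i) - var (Src i)) - q * (var (Tgt i) - var (Src i)) = 0" using assms by simp
  then have "(var (Tgt i) - var (Src i)) * (q' - q) = 0" by (simp add: algebra_simps)
  then show "q' = q" using var_diff_mult_eq_0[of "Tgt i" "Src i" "q' - q"] by simp
qed (use assms in simp)

text \<open>Setting \<open>Tgt i\<close> to \<open>Src i\<close> turns \<open>mixed i W\<close> into
  \<open>mixed (Suc i) W\<close>, so the divisibility above applies and the definite description in
  \<open>diff_quot\<close> denotes the quotient.\<close>

lemma diff_quot:
  fixes W :: "(nat, 'k::field_char_0) mpoly"
  assumes "W \<in> polys {..<n}" "i < n"
  shows "diff_quot i W * (var (Tgt i) - var (Src i)) = mixed i W - mixed (Suc i) W"
    and "diff_quot i W \<in> polys (Src ` {..<n} \<union> Tgt ` {..<n})"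
proof -
  let ?S = "Src ` {..<n} \<union> Tgt ` {..<n}"
  have mem: "mixed i W \<in> polys ?S" unfolding mixed_def by (rule rename_polys[OF assms(1)]) auto
  have mixed: "rename (id(Tgt i := Src i)) (mixed i W) = mixed (Suc i) W"
    unfolding mixed_def rename_comp by (rule rename_cong[OF assms(1)]) auto
  obtain q where q: "q \<in> polys ?S"
    "mixed i W - rename (id(Tgt i := Src i)) (mixed i W) = (var (Tgt i) - var (Src i)) * q"
    using ex_var_diff_quot[OF mem, of "Tgt i" "Src i"] assms(2) by auto
  then have *: "q * (var (Tgt i) - var (Src i)) = mixed i W - mixed (Suc i) W"
    unfolding mixed by (simp add: mult.commute)
  then have "diff_quot i W = q" by (rule diff_quot_eqI)
  with * q show "diff_quot i W * (var (Tgt i) - var (Src i)) = mixed i W - mixed (Suc i) W"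
    and "diff_quot i W \<in> polys ?S" by auto
qed

text \<open>The differences telescope from all target variables to all source variables; this is the
  factorisation property of the unit.\<close>

lemma sum_diff_quot:
  fixes W :: "(nat, 'k::field_char_0) mpoly"
  assumes "W \<in> polys {..<n}"
  shows "(\<Sum>i<n. diff_quot i W * (var (Tgt i) - var (Src i))) = rename Tgt W - rename Src W"
proof -
  have "(\<Sum>i<n. diff_quot i W * (var (Tgt i) - var (Src i))) = (\<Sum>i<n. mixed i W - mixed (Suc i) W)"
    by (rule sum.cong) (use diff_quot(1)[OF assms] in auto)
  also have "\<dots> = mixed 0 W - mixed n W" by (rule sum_lessThan_telescope')
  also have "mixed 0 W = rename Tgt W" by (simp add: mixed_def)
  also have "mixed n W = rename Src W"
    unfolding mixed_def by (rule rename_cong[OF assms]) auto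
  finally show ?thesis .
qed

text \<open>The divided difference: the quotient of division by \<open>v - a\<close>, with the
  substitution \<open>v = a\<close> as remainder. It supplies the contracting homotopy of the
  elimination.\<close>

definition var_quot :: "'v \<Rightarrow> 'v \<Rightarrow> ('v, 'k::field_char_0) mpoly \<Rightarrow> ('v, 'k) mpoly" where
  "var_quot v a p = (THE q. p - rename (id(v := a)) p = (var v - var a) * q)"

lemma var_quot_eqI:
  assumes "v \<noteq> a" "p - rename (id(v := a)) p = (var v - var a) * q"
  shows "var_quot v a p = q"
  unfolding var_quot_def
proof (rule the_equality)
  fix q' assume "p - rename (id(v := a)) p = (var v - var a) * q'"
  then have "(var v - var a) * q' - (var v - var a) * q = 0" using assms by simp
  then have "(var v - var a) * (q' - q) = 0" by (simp add: algebra_simps)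
  then show "q' = q" using var_diff_mult_eq_0[OF assms(1), of "q' - q"] by simp
qed (fact assms(2))

lemma var_quot:
  assumes "v \<noteq> a"
  shows "(var v - var a) * var_quot v a p = p - rename (id(v := a)) p"
  using ex_var_diff_quot[of p UNIV v a] var_quot_eqI[OF assms, of p] by auto

lemma var_quot_polys:
  assumes "v \<noteq> a" "p \<in> polys S" "v \<in> S" "a \<in> S"
  shows "var_quot v a p \<in> polys S"
  using ex_var_diff_quot[OF assms(2-4)] var_quot_eqI[OF assms(1), of p] by auto

lemma additive_var_quot:
  assumes "v \<noteq> a"
  shows "additive (var_quot v a)"
  by standard (rule var_quot_eqI[OF assms], simp add: rename_add distrib_left var_quot[OF assms])

lemma var_quot_cancel:
  assumes "v \<noteq> a"
  shows "var_quot v a ((var v - var a) * p) = p"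
  by (rule var_quot_eqI[OF assms]) (simp add: rename_mult rename_diff)

text \<open>A factor fixed by the substitution can be pulled out of both sides of the division. This
  is why the elimination is stated over a base ring whose variables avoid \<open>v\<close>.\<close>

lemma var_quot_mult:
  assumes "v \<noteq> a" "rename (id(v := a)) r = r"
  shows "var_quot v a (r * p) = r * var_quot v a p"
proof (rule var_quot_eqI[OF assms(1)])
  have "r * p - rename (id(v := a)) (r * p) = r * (p - rename (id(v := a)) p)"
    by (simp add: rename_mult assms(2) right_diff_distrib)
  also have "\<dots> = (var v - var a) * (r * var_quot v a p)"
    by (simp add: mult.left_commute flip: var_quot[OF assms(1)])
  finally show "r * p - rename (id(v := a)) (r * p) = (var v - var a) * (r * var_quot v a p)" .
qed

section \<open>Homotopy equivalence of graded modules with an odd endomorphism\<close>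

text \<open>Carriers are subsets of a type and scalars act through a function, so that one notion
  covers a 1-morphism over its base ring and a Koszul module over a larger ring with restricted
  scalars.\<close>

record ('a, 'r) cx =
  car :: "'a set"
  hp :: "bool \<Rightarrow> 'a set"
  act :: "'r \<Rightarrow> 'a \<Rightarrow> 'a"
  dff :: "'a \<Rightarrow> 'a"

definition cx_map ::
    "'r set \<Rightarrow> ('a::ab_group_add, 'r) cx \<Rightarrow> ('b::ab_group_add, 'r) cx \<Rightarrow> bool \<Rightarrow> ('a \<Rightarrow> 'b) \<Rightarrow> bool" where
  "cx_map Q C D e f \<longleftrightarrow>
     (\<forall>u\<in>car C. \<forall>v\<in>car C. f (u + v) = f u + f v) \<and>
     (\<forall>r\<in>Q. \<forall>v\<in>car C. f (act C r v) = act D r (f v)) \<and>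
     (\<forall>q. \<forall>v\<in>hp C q. f v \<in> hp D (q \<noteq> e))"

locale graded =
  fixes Q :: "'r set" and C :: "('a::ab_group_add, 'r) cx"
  assumes hp_zero: "0 \<in> hp C q"
    and hp_add: "u \<in> hp C q \<Longrightarrow> v \<in> hp C q \<Longrightarrow> u + v \<in> hp C q"
    and hp_minus: "u \<in> hp C q \<Longrightarrow> - u \<in> hp C q"
    and hp_disjoint: "u \<in> hp C False \<Longrightarrow> u \<in> hp C True \<Longrightarrow> u = 0"
    and car_eq: "car C = {u + v | u v. u \<in> hp C False \<and> v \<in> hp C True}"
    and act_hp: "r \<in> Q \<Longrightarrow> u \<in> hp C q \<Longrightarrow> act C r u \<in> hp C q"
    and act_additive: "additive (act C r)"
begin

lemma hp_car: "u \<in> hp C q \<Longrightarrow> u \<in> car C"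
  using hp_zero[of True] hp_zero[of False] unfolding car_eq by (cases q) force+

lemma car_zero: "0 \<in> car C"
  using hp_car hp_zero by blast

lemma car_add: "u \<in> car C \<Longrightarrow> v \<in> car C \<Longrightarrow> u + v \<in> car C"
  unfolding car_eq
proof clarify
  fix u v u' v' assume "u \<in> hp C False" "v \<in> hp C True" "u' \<in> hp C False" "v' \<in> hp C True"
  then show "\<exists>a b. u + v + (u' + v') = a + b \<and> a \<in> hp C False \<and> b \<in> hp C True"
    by (intro exI[of _ "u + u'"] exI[of _ "v + v'"]) (auto intro: hp_add simp: algebra_simps)
qed

lemma car_minus: "u \<in> car C \<Longrightarrow> - u \<in> car C"
  unfolding car_eq
proof clarify
  fix u v assume "u \<in> hp C False" "v \<in> hp C True"
  then show "\<exists>a b. - (u + v) = a + b \<and> a \<in> hp C False \<and> b \<in> hp C True"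
    by (intro exI[of _ "- u"] exI[of _ "- v"]) (auto intro: hp_minus)
qed

lemma car_diff: "u \<in> car C \<Longrightarrow> v \<in> car C \<Longrightarrow> u - v \<in> car C"
  using car_add[of u "- v"] car_minus[of v] by simp

lemma act_car: "r \<in> Q \<Longrightarrow> u \<in> car C \<Longrightarrow> act C r u \<in> car C"
  unfolding car_eq using act_hp by (force simp: additive.add[OF act_additive])

lemma hp_split:
  assumes "u + v \<in> hp C q" "u \<in> hp C q" "v \<in> hp C (\<not> q)"
  shows "v = 0"
proof -
  have "v \<in> hp C q" using hp_add[OF assms(1) hp_minus[OF assms(2)]] by simp
  with assms(3) show ?thesis using hp_disjoint by (cases q) auto
qed

end

lemma cx_map_add: "cx_map Q C D e f \<Longrightarrow> u \<in> car C \<Longrightarrow> v \<in> car C \<Longrightarrow> f (u + v) = f u + f v"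
  and cx_map_act: "cx_map Q C D e f \<Longrightarrow> r \<in> Q \<Longrightarrow> v \<in> car C \<Longrightarrow> f (act C r v) = act D r (f v)"
  and cx_map_hp: "cx_map Q C D e f \<Longrightarrow> v \<in> hp C q \<Longrightarrow> f v \<in> hp D (q \<noteq> e)"
  by (auto simp: cx_map_def)

lemma cx_map_diff:
  assumes "cx_map Q C D e f" "graded Q C" "u \<in> car C" "v \<in> car C"
  shows "f (u - v) = f u - f v"
  using cx_map_add[OF assms(1) graded.car_diff[OF assms(2-4)] assms(4)] by simp

lemma cx_map_zero:
  assumes "cx_map Q C D e f" "graded Q C"
  shows "f 0 = 0"
  using cx_map_diff[OF assms, of 0 0] graded.car_zero[OF assms(2)] by simp

lemma cx_map_car:
  assumes f: "cx_map Q C D e f" and C: "graded Q C" and D: "graded Q D" and v: "v \<in> car C"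
  shows "f v \<in> car D"
proof -
  interpret C: graded Q C by (fact C)
  interpret D: graded Q D by (fact D)
  obtain a b where ab: "a \<in> hp C False" "b \<in> hp C True" "v = a + b"
    using v unfolding C.car_eq by auto
  then have "f v = f a + f b" using f by (simp add: cx_map_add C.hp_car)
  moreover have "f a \<in> car D" "f b \<in> car D"
    using cx_map_hp[OF f ab(1)] cx_map_hp[OF f ab(2)] by (auto intro: D.hp_car)
  ultimately show ?thesis by (simp add: D.car_add)
qed

lemma cx_map_id: "cx_map Q C C False (\<lambda>v. v)"
  by (simp add: cx_map_def)

lemma cx_map_comp:
  assumes "cx_map Q C D e f" "cx_map Q D E e' g" "graded Q C" "graded Q D"
  shows "cx_map Q C E (e \<noteq> e') (\<lambda>v. g (f v))"
  unfolding cx_map_def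
proof (intro conjI ballI allI)
  fix q v assume "v \<in> hp C q"
  from cx_map_hp[OF assms(2) cx_map_hp[OF assms(1) this]]
  show "g (f v) \<in> hp E (q \<noteq> (e \<noteq> e'))" by (cases e; cases e') auto
qed (use assms in \<open>auto simp: cx_map_add cx_map_act cx_map_car[OF assms(1,3,4)]\<close>)

lemma cx_map_plus:
  assumes "cx_map Q C D e f" "cx_map Q C D e g" "graded Q D"
  shows "cx_map Q C D e (\<lambda>v. f v + g v)"
  using assms unfolding cx_map_def
  by (auto simp: additive.add[OF graded.act_additive[OF assms(3)]] graded.hp_add)

lemma cx_map_uminus:
  assumes "cx_map Q C D e f" "graded Q D"
  shows "cx_map Q C D e (\<lambda>v. - f v)"
  using assms unfolding cx_map_def
  by (auto simp: additive.minus[OF graded.act_additive[OF assms(2)]] graded.hp_minus)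

lemma cx_map_zero_fun: "graded Q D \<Longrightarrow> cx_map Q C D e (\<lambda>v. 0)"
  by (auto simp: cx_map_def graded.hp_zero additive.zero[OF graded.act_additive])

text \<open>The square of the differential is left open because matrix factorisations are curved;
  where its value matters, it enters as a separate hypothesis.\<close>

definition cx :: "'r set \<Rightarrow> ('a::ab_group_add, 'r) cx \<Rightarrow> bool" where
  "cx Q C \<longleftrightarrow> graded Q C \<and> cx_map Q C C True (dff C)"

lemma cxD: "cx Q C \<Longrightarrow> graded Q C" "cx Q C \<Longrightarrow> cx_map Q C C True (dff C)"
  by (simp_all add: cx_def)

section \<open>Chain maps, homotopy equivalence and transitivity\<close>

definition chain_map ::
    "'r set \<Rightarrow> ('a::ab_group_add, 'r) cx \<Rightarrow> ('b::ab_group_add, 'r) cx \<Rightarrow> ('a \<Rightarrow> 'b) \<Rightarrow> bool" where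
  "chain_map Q C D f \<longleftrightarrow> cx_map Q C D False f \<and> (\<forall>v\<in>car C. dff D (f v) = f (dff C v))"

definition null_homotopic :: "'r set \<Rightarrow> ('a::ab_group_add, 'r) cx \<Rightarrow> ('a \<Rightarrow> 'a) \<Rightarrow> bool" where
  "null_homotopic Q C f \<longleftrightarrow> (\<exists>h. cx_map Q C C True h \<and> (\<forall>v\<in>car C. f v = dff C (h v) + h (dff C v)))"

definition heq :: "'r set \<Rightarrow> ('a::ab_group_add, 'r) cx \<Rightarrow> ('b::ab_group_add, 'r) cx \<Rightarrow> bool" where
  "heq Q C D \<longleftrightarrow> (\<exists>f g. chain_map Q C D f \<and> chain_map Q D C g \<and>
     null_homotopic Q C (\<lambda>v. g (f v) - v) \<and> null_homotopic Q D (\<lambda>v. f (g v) - v))"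

lemma heq_sym: "heq Q C D \<Longrightarrow> heq Q D C"
  unfolding heq_def by blast

lemma chain_map_comp:
  assumes "chain_map Q C D f" "chain_map Q D E g" "graded Q C" "graded Q D"
  shows "chain_map Q C E (\<lambda>v. g (f v))"
  using assms cx_map_comp[of Q C D False f E False g] cx_map_car[of Q C D False f]
  by (auto simp: chain_map_def)

text \<open>From \<open>g g' f' f - 1 = g (g' f' - 1) f + (g f - 1)\<close> one reads off the
  homotopy \<open>h + g k f\<close>.\<close>

lemma null_homotopic_trans:
  assumes f: "chain_map Q C D f" "chain_map Q D C g" and h: "null_homotopic Q C (\<lambda>v. g (f v) - v)"
    and f': "null_homotopic Q D (\<lambda>v. g' (f' v) - v)"
    and g': "\<And>v. v \<in> car D \<Longrightarrow> g' (f' v) \<in> car D"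
    and C: "cx Q C" and D: "cx Q D"
  shows "null_homotopic Q C (\<lambda>v. g (g' (f' (f v))) - v)"
proof -
  interpret C: graded Q C by (fact cxD(1)[OF C])
  interpret D: graded Q D by (fact cxD(1)[OF D])
  obtain h where h: "cx_map Q C C True h" "\<And>v. v \<in> car C \<Longrightarrow> g (f v) - v = dff C (h v) + h (dff C v)"
    using h by (auto simp: null_homotopic_def)
  obtain k where k: "cx_map Q D D True k" "\<And>v. v \<in> car D \<Longrightarrow> g' (f' v) - v = dff D (k v) + k (dff D v)"
    using f' by (auto simp: null_homotopic_def)
  have fm: "cx_map Q C D False f" and gm: "cx_map Q D C False g"
    and fd: "\<And>v. v \<in> car C \<Longrightarrow> dff D (f v) = f (dff C v)"
    and gd: "\<And>v. v \<in> car D \<Longrightarrow> dff C (g v) = g (dff D v)"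
    using f by (auto simp: chain_map_def)
  note dC = cxD(2)[OF C] and dD = cxD(2)[OF D]
  note carC = C.car_add C.car_diff cx_map_car[OF gm D.graded_axioms C.graded_axioms]
    cx_map_car[OF h(1) C.graded_axioms C.graded_axioms] cx_map_car[OF dC C.graded_axioms C.graded_axioms]
  note carD = cx_map_car[OF fm C.graded_axioms D.graded_axioms]
    cx_map_car[OF k(1) D.graded_axioms D.graded_axioms] cx_map_car[OF dD D.graded_axioms D.graded_axioms]
  have "cx_map Q C C True (\<lambda>v. h v + g (k (f v)))"
    using cx_map_comp[OF cx_map_comp[OF fm k(1)] gm] h(1)
    by (intro cx_map_plus) (auto intro: C.graded_axioms D.graded_axioms)
  moreover have "g (g' (f' (f v))) - v =
      dff C (h v + g (k (f v))) + (h (dff C v) + g (k (f (dff C v))))" if v: "v \<in> car C" for v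
  proof -
    have "g (g' (f' (f v))) - g (f v) = g (g' (f' (f v)) - f v)"
      using v by (subst cx_map_diff[OF gm D.graded_axioms]) (auto intro: carD g')
    also have "\<dots> = g (dff D (k (f v)) + k (dff D (f v)))"
      using v by (subst k(2)) (auto intro: carD)
    also have "\<dots> = dff C (g (k (f v))) + g (k (f (dff C v)))"
      using v by (subst cx_map_add[OF gm]) (auto intro: carD carC simp: gd fd carD carC)
    finally have 1: "g (g' (f' (f v))) - g (f v) = dff C (g (k (f v))) + g (k (f (dff C v)))" .
    have 2: "dff C (h v + g (k (f v))) = dff C (h v) + dff C (g (k (f v)))"
      using v by (subst cx_map_add[OF dC]) (auto intro: carC carD)
    show ?thesis unfolding 2 using 1 h(2)[OF v] by (simp add: algebra_simps)
  qed
  ultimately show ?thesis unfolding null_homotopic_def by blast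
qed

lemma heq_trans:
  assumes "heq Q C D" "heq Q D E" "cx Q C" "cx Q D" "cx Q E"
  shows "heq Q C E"
proof -
  obtain f g where f: "chain_map Q C D f" "chain_map Q D C g"
    "null_homotopic Q C (\<lambda>v. g (f v) - v)" "null_homotopic Q D (\<lambda>v. f (g v) - v)"
    using assms(1) by (auto simp: heq_def)
  obtain f' g' where f': "chain_map Q D E f'" "chain_map Q E D g'"
    "null_homotopic Q D (\<lambda>v. g' (f' v) - v)" "null_homotopic Q E (\<lambda>v. f' (g' v) - v)"
    using assms(2) by (auto simp: heq_def)
  note gr = cxD(1)[OF assms(3)] cxD(1)[OF assms(4)] cxD(1)[OF assms(5)]
  have c: "f (g v) \<in> car D" "g' (f' v) \<in> car D" if "v \<in> car D" for v
    using that f(1,2) f'(1,2) unfolding chain_map_def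
    by (auto intro: cx_map_car[OF _ gr(1,2)] cx_map_car[OF _ gr(2,1)]
        cx_map_car[OF _ gr(2,3)] cx_map_car[OF _ gr(3,2)])
  show ?thesis
    unfolding heq_def
  proof (intro exI conjI)
    show "null_homotopic Q C (\<lambda>v. g (g' (f' (f v))) - v)"
      by (rule null_homotopic_trans[where f = f and g = g and f' = f' and g' = g'])
         (fact f f' c assms)+
    show "null_homotopic Q E (\<lambda>v. f' (f (g (g' v))) - v)"
      by (rule null_homotopic_trans[where f = g' and g = f' and f' = g and g' = f])
         (fact f f' c assms)+
    show "chain_map Q C E (\<lambda>v. f' (f v))" by (rule chain_map_comp[OF f(1) f'(1) gr(1,2)])
    show "chain_map Q E C (\<lambda>v. g (g' v))" by (rule chain_map_comp[OF f'(2) f(2) gr(3,2)])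
  qed
qed

lemma null_homotopic_zero:
  assumes "\<And>v. v \<in> car C \<Longrightarrow> f v = 0" "cx Q C"
  shows "null_homotopic Q C f"
  unfolding null_homotopic_def
  by (rule exI[of _ "\<lambda>v. 0"])
     (use assms in \<open>auto simp: cx_map_zero[OF cxD(2,1)] intro: cx_map_zero_fun cxD\<close>)

text \<open>Parity and linearity of the differential of \<open>C\<close> are pulled back along the
  bijection. This serves the flattening map, whose target is a Koszul complex with known
  properties.\<close>

lemma cx_isoI:
  assumes C: "graded Q C" and D: "cx Q D" and f: "cx_map Q C D False f"
    and bij: "bij_betw f (car C) (car D)"
    and d: "\<And>v. v \<in> car C \<Longrightarrow> dff C v \<in> car C"
    and chain: "\<And>v. v \<in> car C \<Longrightarrow> f (dff C v) = dff D (f v)"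
  shows "cx Q C" and "heq Q C D"
proof -
  interpret C: graded Q C by (fact C)
  interpret D: graded Q D by (fact cxD(1)[OF D])
  note dD = cxD(2)[OF D]
  define g where "g = inv_into (car C) f"
  have fcar: "v \<in> car C \<Longrightarrow> f v \<in> car D" for v using bij by (auto simp: bij_betw_def)
  have gcar: "w \<in> car D \<Longrightarrow> g w \<in> car C" for w
    using bij_betw_inv_into[OF bij] by (auto simp: bij_betw_def g_def)
  have gf: "v \<in> car C \<Longrightarrow> g (f v) = v" for v
    using bij_betw_inv_into_left[OF bij] by (auto simp: g_def)
  have fg: "w \<in> car D \<Longrightarrow> f (g w) = w" for w
    using bij_betw_inv_into_right[OF bij] by (auto simp: g_def)
  have eqI: "u = v" if "u \<in> car C" "v \<in> car C" "f u = f v" for u v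
    using bij that by (auto simp: bij_betw_def inj_on_def)
  \<comment> \<open>The component \<open>b\<close> of the wrong parity is sent into both homogeneous
    parts of \<open>D\<close>, hence to zero, and injectivity kills it.\<close>
  have hpI: "u \<in> hp C q" if u: "u \<in> car C" "f u \<in> hp D q" for u q
  proof -
    obtain a b where ab: "a \<in> hp C q" "b \<in> hp C (\<not> q)" "u = a + b"
      using u(1) unfolding C.car_eq by (cases q) (auto simp: add.commute)
    have "f u = f a + f b" using ab by (simp add: cx_map_add[OF f] C.hp_car)
    then have "f b = 0"
      using D.hp_split[of "f a" "f b" q] u(2) cx_map_hp[OF f ab(1)] cx_map_hp[OF f ab(2)] by simp
    then have "b = 0" using ab(2) by (intro eqI) (auto intro: C.hp_car C.car_zero simp: cx_map_zero[OF f C])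
    then show ?thesis using ab by simp
  qed
  have g: "cx_map Q D C False g"
    unfolding cx_map_def
  proof (intro conjI ballI allI)
    fix u v assume "u \<in> car D" "v \<in> car D"
    then show "g (u + v) = g u + g v"
      by (intro eqI) (auto intro: gcar C.car_add D.car_add simp: fg cx_map_add[OF f] D.car_add gcar)
  next
    fix r v assume "r \<in> Q" "v \<in> car D"
    then show "g (act D r v) = act C r (g v)"
      by (intro eqI) (auto intro: gcar C.act_car D.act_car simp: fg cx_map_act[OF f] D.act_car gcar)
  next
    fix q v assume "v \<in> hp D q"
    then show "g v \<in> hp C (q \<noteq> False)"
      using D.hp_car by (auto intro!: hpI gcar simp: fg)
  qed
  have dm: "cx_map Q C C True (dff C)"
    unfolding cx_map_def
  proof (intro conjI ballI allI)
    fix u v assume "u \<in> car C" "v \<in> car C"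
    then show "dff C (u + v) = dff C u + dff C v"
      by (intro eqI) (auto intro!: d C.car_add
        simp: chain cx_map_add[OF f] cx_map_add[OF dD] d C.car_add fcar)
  next
    fix r v assume "r \<in> Q" "v \<in> car C"
    then show "dff C (act C r v) = act C r (dff C v)"
      by (intro eqI) (auto intro!: d C.act_car
        simp: chain cx_map_act[OF f] cx_map_act[OF dD] d C.act_car fcar)
  next
    fix q v assume v: "v \<in> hp C q"
    then have "v \<in> car C" by (rule C.hp_car)
    moreover have "dff D (f v) \<in> hp D (q \<noteq> True)"
      using cx_map_hp[OF dD cx_map_hp[OF f v]] by simp
    ultimately show "dff C v \<in> hp C (q \<noteq> True)" by (intro hpI d) (auto simp: chain)
  qed
  then show cxC: "cx Q C" using C by (simp add: cx_def)
  have "chain_map Q D C g"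
    unfolding chain_map_def
  proof (intro conjI ballI g)
    fix w assume w: "w \<in> car D"
    then have "dff D w = f (dff C (g w))" by (simp add: chain gcar fg)
    then show "dff C (g w) = g (dff D w)" using w by (simp add: gf d gcar)
  qed
  then show "heq Q C D"
    unfolding heq_def using f chain
    by (intro exI[of _ f] exI[of _ g]) (auto intro!: null_homotopic_zero cxC D simp: chain_map_def gf fg)
qed

text \<open>The correction \<open>1 - (dh + hd)\<close> turns a module section of \<open>pr\<close> into a chain map, because it
  vanishes on the kernel of \<open>pr\<close> and commutes with \<open>d\<close>, the latter as \<open>d\<^sup>2\<close> is a scalar.\<close>

lemma heq_retractI:
  assumes C: "cx Q C" and D: "cx Q D"
    and w: "w \<in> Q" "\<And>v. v \<in> car C \<Longrightarrow> dff C (dff C v) = act C w v"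
    and pr: "chain_map Q C D pr"
    and \<sigma>: "cx_map Q D C False \<sigma>" "\<And>v. v \<in> car D \<Longrightarrow> pr (\<sigma> v) = v"
    and h: "cx_map Q C C True h" "\<And>v. v \<in> car C \<Longrightarrow> pr (h v) = 0"
      "\<And>v. v \<in> car C \<Longrightarrow> pr v = 0 \<Longrightarrow> dff C (h v) + h (dff C v) = v"
  shows "heq Q C D"
proof -
  interpret C: graded Q C by (fact cxD(1)[OF C])
  interpret D: graded Q D by (fact cxD(1)[OF D])
  note gC = C.graded_axioms and gD = D.graded_axioms
  note dC = cxD(2)[OF C] and dD = cxD(2)[OF D]
  have prm: "cx_map Q C D False pr" and prd: "\<And>v. v \<in> car C \<Longrightarrow> dff D (pr v) = pr (dff C v)"
    using pr by (auto simp: chain_map_def)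
  note car = cx_map_car[OF dC gC gC] cx_map_car[OF dD gD gD] cx_map_car[OF prm gC gD]
    cx_map_car[OF \<sigma>(1) gD gC] cx_map_car[OF h(1) gC gC]
  define P where "P v = v - (dff C (h v) + h (dff C v))" for v
  have Pm: "cx_map Q C C False P"
  proof -
    have "cx_map Q C C False (\<lambda>v. v + - (dff C (h v) + h (dff C v)))"
      using cx_map_comp[OF h(1) dC gC gC] cx_map_comp[OF dC h(1) gC gC]
      by (intro cx_map_plus cx_map_uminus cx_map_id gC) auto
    then show ?thesis by (simp only: P_def[abs_def] add_uminus_conv_diff)
  qed
  have Pker: "P v = 0" if "v \<in> car C" "pr v = 0" for v using h(3)[OF that] by (simp add: P_def)
  have Peq: "P u = P v" if "u \<in> car C" "v \<in> car C" "pr u = pr v" for u v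
  proof -
    have "P (u - v) = 0" using that by (intro Pker) (auto simp: C.car_diff cx_map_diff[OF prm gC])
    then show ?thesis using that by (simp add: cx_map_diff[OF Pm gC])
  qed
  have prP: "pr (P v) = pr v" if v: "v \<in> car C" for v
  proof -
    have "pr (P v) = pr v - (pr (dff C (h v)) + pr (h (dff C v)))"
      using v unfolding P_def by (simp add: cx_map_diff[OF prm gC] cx_map_add[OF prm] car C.car_add)
    also have "pr (dff C (h v)) = 0" using v by (simp add: car h(2) cx_map_zero[OF dD gD] flip: prd)
    also have "pr (h (dff C v)) = 0" using v by (simp add: car h(2))
    finally show ?thesis by simp
  qed
  have Pd: "P (dff C v) = dff C (P v)" if v: "v \<in> car C" for v
  proof -
    have "dff C (P v) = dff C v - (dff C (dff C (h v)) + dff C (h (dff C v)))"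
      using v unfolding P_def by (simp add: cx_map_diff[OF dC gC] cx_map_add[OF dC] car C.car_add)
    also have "dff C (dff C (h v)) = h (dff C (dff C v))"
      using v by (simp add: w car cx_map_act[OF h(1)])
    finally show ?thesis by (simp add: P_def add.commute)
  qed
  have "chain_map Q D C (\<lambda>v. P (\<sigma> v))"
    unfolding chain_map_def
  proof (intro conjI ballI)
    show "cx_map Q D C False (\<lambda>v. P (\<sigma> v))" using cx_map_comp[OF \<sigma>(1) Pm gD gC] by simp
    fix v assume v: "v \<in> car D"
    \<comment> \<open>\<open>\<sigma>\<close> may fail to commute with the differentials, but both
      arguments have the same image under \<open>pr\<close>, and \<open>P\<close> depends on nothing
      else.\<close>
    have "P (dff C (\<sigma> v)) = P (\<sigma> (dff D v))"
      using v by (intro Peq) (auto intro: car simp: \<sigma>(2) car simp flip: prd)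
    then show "dff C (P (\<sigma> v)) = P (\<sigma> (dff D v))" using v by (simp add: Pd car)
  qed
  moreover have "null_homotopic Q C (\<lambda>v. P (\<sigma> (pr v)) - v)"
    unfolding null_homotopic_def
  proof (intro exI[of _ "\<lambda>v. - h v"] conjI ballI cx_map_uminus h(1) gC)
    fix v assume v: "v \<in> car C"
    have "P (\<sigma> (pr v)) = P v" using v by (intro Peq) (auto intro: car simp: \<sigma>(2) car)
    moreover have "dff C (- h v) = - dff C (h v)"
      using v cx_map_diff[OF dC gC, of 0 "h v"] by (simp add: car C.car_zero cx_map_zero[OF dC gC])
    ultimately show "P (\<sigma> (pr v)) - v = dff C (- h v) + - h (dff C v)" by (simp add: P_def)
  qed
  moreover have "null_homotopic Q D (\<lambda>v. pr (P (\<sigma> v)) - v)"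
    by (rule null_homotopic_zero[OF _ D]) (simp add: prP car \<sigma>(2))
  ultimately show ?thesis unfolding heq_def using pr by blast
qed


subsection \<open>Matrix factorisations as such modules\<close>

definition cx_of :: "('b, 'k::field_char_0) mor1 \<Rightarrow> ('b \<Rightarrow>\<^sub>0 (bvar, 'k) mpoly, (bvar, 'k) mpoly) cx" where
  "cx_of X = \<lparr>car = elems X, hp = homog X, act = smul, dff = dif X\<rparr>"

lemma hom_iff_cx_map: "f \<in> hom X Y e \<longleftrightarrow> cx_map (base_ring X) (cx_of X) (cx_of Y) e f"
  by (simp add: hom_def cx_map_def cx_of_def)

text \<open>\<open>delta\<close> carries the sign of the degree: it is \<open>d f - f d\<close> on
  even maps and \<open>d h + h d\<close> on odd ones, so cohomologous means homotopic.\<close>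

lemma iso_hmfI:
  assumes "heq (base_ring X) (cx_of X) (cx_of Y)" "base_ring Y = base_ring X"
  shows "iso_hmf X Y"
proof -
  obtain f g h k where *:
    "chain_map (base_ring X) (cx_of X) (cx_of Y) f" "chain_map (base_ring X) (cx_of Y) (cx_of X) g"
    "cx_map (base_ring X) (cx_of X) (cx_of X) True h"
    "\<forall>v\<in>elems X. g (f v) - v = dif X (h v) + h (dif X v)"
    "cx_map (base_ring X) (cx_of Y) (cx_of Y) True k"
    "\<forall>v\<in>elems Y. f (g v) - v = dif Y (k v) + k (dif Y v)"
    using assms(1) unfolding heq_def null_homotopic_def by (auto simp: cx_of_def)
  have ks: "smul (ksign False) v = v" "smul (ksign True) v = - v" for v :: "'c \<Rightarrow>\<^sub>0 (bvar, 'a) mpoly"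
    by (simp_all add: ksign_def)
  have ks': "smul (ksign False) v = v" "smul (ksign True) v = - v" for v :: "'b \<Rightarrow>\<^sub>0 (bvar, 'a) mpoly"
    by (simp_all add: ksign_def)
  show ?thesis
    unfolding iso_hmf_def cohomologous_def cocycles_def delta_def
  proof (intro bexI[of _ f] bexI[of _ g] conjI bexI[of _ h] bexI[of _ k])
    show "f \<in> {f \<in> hom X Y False. \<forall>v\<in>elems X. dif Y (f v) - smul (ksign False) (f (dif X v)) = 0}"
      using *(1) by (auto simp: chain_map_def hom_iff_cx_map ks) (simp add: cx_of_def)
    show "g \<in> {f \<in> hom Y X False. \<forall>v\<in>elems Y. dif X (f v) - smul (ksign False) (f (dif Y v)) = 0}"
      using *(2) assms(2) by (auto simp: chain_map_def hom_iff_cx_map ks') (simp add: cx_of_def)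
  qed (use * assms(2) in \<open>auto simp: hom_iff_cx_map ks ks'\<close>)
qed

section \<open>Koszul complexes\<close>

subsection \<open>Graded free modules\<close>

definition fmod :: "'b set \<Rightarrow> 'v set \<Rightarrow> ('b \<Rightarrow>\<^sub>0 ('v, 'k::field_char_0) mpoly) set" where
  "fmod B S = {v. keys v \<subseteq> B \<and> (\<forall>b. lookup v b \<in> polys S)}"

definition pmod ::
    "'b set \<Rightarrow> 'v set \<Rightarrow> ('b \<Rightarrow> bool) \<Rightarrow> bool \<Rightarrow> ('b \<Rightarrow>\<^sub>0 ('v, 'k::field_char_0) mpoly) set" where
  "pmod B S pr e = {v \<in> fmod B S. \<forall>b\<in>keys v. pr b = e}"

text \<open>With a constant parity every element is homogeneous, so the closure properties of the
  ungraded module are instances of those of the graded one.\<close>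

lemma fmod_eq_pmod: "fmod B S = pmod B S (\<lambda>_. False) False"
  by (simp add: pmod_def)

lemma pmod_fmod: "v \<in> pmod B S pr e \<Longrightarrow> v \<in> fmod B S"
  by (simp add: pmod_def)

lemma pmod_iff: "v \<in> pmod B S pr e \<longleftrightarrow> (\<forall>b. lookup v b \<noteq> 0 \<longrightarrow> b \<in> B \<and> pr b = e) \<and> (\<forall>b. lookup v b \<in> polys S)"
  by (auto simp: pmod_def fmod_def in_keys_iff)

lemma pmod_zero [simp]: "0 \<in> pmod B S pr e"
  by (simp add: pmod_def fmod_def)

lemma pmod_add: "u \<in> pmod B S pr e \<Longrightarrow> v \<in> pmod B S pr e \<Longrightarrow> u + v \<in> pmod B S pr e"
  by (auto simp: pmod_iff lookup_add) (metis add.right_neutral)+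

lemma pmod_minus: "u \<in> pmod B S pr e \<Longrightarrow> - u \<in> pmod B S pr e"
  by (simp add: pmod_iff)

lemma pmod_smul: "r \<in> polys S \<Longrightarrow> u \<in> pmod B S pr e \<Longrightarrow> smul r u \<in> pmod B S pr e"
  unfolding pmod_iff by (metis lookup_smul mult_zero_right polys_mult)

lemma pmod_sum: "(\<And>i. i \<in> I \<Longrightarrow> f i \<in> pmod B S pr e) \<Longrightarrow> (\<Sum>i\<in>I. f i) \<in> pmod B S pr e"
  by (induction I rule: infinite_finite_induct) (auto intro: pmod_add)

lemma pmod_single: "b \<in> B \<Longrightarrow> r \<in> polys S \<Longrightarrow> pr b = e \<Longrightarrow> single b r \<in> pmod B S pr e"
  by (auto simp: pmod_iff lookup_single when_def)

lemma fmod_zero [simp]: "0 \<in> fmod B S"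
  and fmod_add: "u \<in> fmod B S \<Longrightarrow> v \<in> fmod B S \<Longrightarrow> u + v \<in> fmod B S"
  and fmod_minus: "u \<in> fmod B S \<Longrightarrow> - u \<in> fmod B S"
  and fmod_smul: "r \<in> polys S \<Longrightarrow> u \<in> fmod B S \<Longrightarrow> smul r u \<in> fmod B S"
  and fmod_sum: "(\<And>i. i \<in> I \<Longrightarrow> f i \<in> fmod B S) \<Longrightarrow> (\<Sum>i\<in>I. f i) \<in> fmod B S"
  and fmod_single: "b \<in> B \<Longrightarrow> r \<in> polys S \<Longrightarrow> single b r \<in> fmod B S"
  by (simp_all add: fmod_eq_pmod pmod_add pmod_minus pmod_smul pmod_sum pmod_single)

lemma lin_ext_pmod:
  assumes "v \<in> pmod B S pr e" "\<And>b. b \<in> B \<Longrightarrow> f b \<in> pmod B' S pr' (pr b \<noteq> d)"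
  shows "lin_ext f v \<in> pmod B' S pr' (e \<noteq> d)"
  unfolding lin_ext_def
proof (intro pmod_sum pmod_smul)
  fix b assume "b \<in> keys v"
  then show "lookup v b \<in> polys S" "f b \<in> pmod B' S pr' (e \<noteq> d)"
    using assms(1) assms(2)[of b] by (auto simp: pmod_iff in_keys_iff)
qed

lemma lin_ext_fmod:
  assumes "v \<in> fmod B S" "\<And>b. b \<in> B \<Longrightarrow> f b \<in> fmod B' S"
  shows "lin_ext f v \<in> fmod B' S"
  using lin_ext_pmod[of v B S "\<lambda>_. False" False f B' "\<lambda>_. False" False] assms
  by (simp add: fmod_eq_pmod)

lemma base_change_pmod:
  assumes "v \<in> pmod B S pr e" "\<phi> 0 = 0" "\<And>r. r \<in> polys S \<Longrightarrow> \<phi> r \<in> polys S'"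
  shows "base_change id \<phi> v \<in> pmod B S' pr e"
  using assms by (auto simp: pmod_iff lookup_base_change_id) (metis assms(2))+

lemma graded_pmod:
  fixes C :: "('b \<Rightarrow>\<^sub>0 ('v, 'k::field_char_0) mpoly, 'r) cx"
  assumes "car C = fmod B S" "hp C = pmod B S pr" "\<And>r. act C r = smul (\<phi> r)"
    and "\<And>r. r \<in> Q \<Longrightarrow> \<phi> r \<in> polys S"
  shows "graded Q C"
proof
  show "u \<in> hp C False \<Longrightarrow> u \<in> hp C True \<Longrightarrow> u = 0" for u
    by (rule poly_mapping_eqI) (auto simp: assms pmod_iff)
  show "car C = {u + v |u v. u \<in> hp C False \<and> v \<in> hp C True}"
  proof (intro equalityI subsetI)
    fix v assume v: "v \<in> car C"
    define f where "f e = (\<Sum>b\<in>{b \<in> keys v. pr b = e}. single b (lookup v b))" for e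
    have "f e \<in> hp C e" for e
      unfolding f_def assms(2) using v by (intro pmod_sum pmod_single) (auto simp: assms(1) fmod_def)
    moreover have "v = f False + f True"
    proof -
      have "keys v = {b \<in> keys v. pr b = False} \<union> {b \<in> keys v. pr b = True}" by auto
      then have "(\<Sum>b\<in>keys v. single b (lookup v b)) = f False + f True"
        unfolding f_def by (subst (1) \<open>keys v = _\<close>, subst sum.union_disjoint) auto
      then show ?thesis by (simp add: sum_single_keys)
    qed
    ultimately show "v \<in> {u + v |u v. u \<in> hp C False \<and> v \<in> hp C True}" by blast
  qed (auto simp: assms intro: fmod_add pmod_fmod)
qed (auto simp: assms smul.scale_right_distrib intro: pmod_add pmod_minus pmod_smul)


subsection \<open>Exterior multiplication and contraction\<close>

lemma theta_sign_insert:
  "j \<notin> T \<Longrightarrow> theta_sign i (insert j T) = (if j < i then - theta_sign i T else theta_sign i T)"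
proof (cases "j < i")
  case True
  assume j: "j \<notin> T"
  have "{k \<in> insert j T. k < i} = insert j {k \<in> T. k < i}" using True by auto
  moreover have "j \<notin> {k \<in> T. k < i}" "finite {k \<in> T. k < i}" using j by auto
  ultimately show ?thesis using True unfolding theta_sign_def by (simp only: card_insert_disjoint) simp
next
  case False
  then have "{k \<in> insert j T. k < i} = {k \<in> T. k < i}" by auto
  then show ?thesis using False unfolding theta_sign_def by (simp only: if_False)
qed

lemma theta_sign_remove:
  assumes "j \<in> T"
  shows "theta_sign i (T - {j}) = (if j < i then - theta_sign i T else theta_sign i T)"
proof -
  have "theta_sign i T = (if j < i then - theta_sign i (T - {j}) else theta_sign i (T - {j}) :: 'a)"
    using theta_sign_insert[of j "T - {j}" i] assms by (simp add: insert_absorb)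
  then show ?thesis by simp
qed

lemma theta_sign_sq: "theta_sign i T * theta_sign i T = 1"
  by (simp add: theta_sign_def flip: power_add mult_2)

abbreviation "wed i \<equiv> lin_ext (wedge i)"
abbreviation "con i \<equiv> lin_ext (contract i)"

lemmas ext_simps = wedge_def contract_def theta_sign_insert theta_sign_remove theta_sign_sq

text \<open>The first of the Clifford relations. The squares and anticommutation rules of Koszul
  differentials are derived from these relations rather than on the exterior basis.\<close>

lemma wed_wed: "wed i (wed j v) + wed j (wed i v) = 0"
  by (rule additive_eqI[where v = v and g = "\<lambda>_. 0"])
     (auto simp: additive_def lin_ext_add lin_ext_smul ext_simps insert_commute single_uminus
        algebra_simps simp flip: single_add)

lemma con_con: "con i (con j v) + con j (con i v) = 0"
proof (rule additive_eqI[where v = v and g = "\<lambda>_. 0"])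
  fix T
  have "T - {i} - {j} = T - {j} - {i}" by auto
  then show "con i (con j (single T (lookup v T))) + con j (con i (single T (lookup v T))) = 0"
    by (auto simp: ext_simps lin_ext_smul single_uminus algebra_simps simp flip: single_add)
qed (auto simp: additive_def lin_ext_add)

lemma wed_con:
  assumes "i \<noteq> j"
  shows "wed i (con j v) + con j (wed i v) = 0"
proof (rule additive_eqI[where v = v and g = "\<lambda>_. 0"])
  fix T
  have "insert i (T - {j}) = insert i T - {j}" using assms by auto
  then show "wed i (con j (single T (lookup v T))) + con j (wed i (single T (lookup v T))) = 0"
    using assms by (auto simp: ext_simps lin_ext_smul single_uminus algebra_simps simp flip: single_add)
qed (auto simp: additive_def lin_ext_add)

lemma wed_con_same: "wed i (con i v) + con i (wed i v) = v"
  by (rule additive_eqI[where v = v and g = "\<lambda>v. v"])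
     (auto simp: additive_def lin_ext_add ext_simps lin_ext_smul insert_absorb mult.assoc)

lemma wed_wed_same [simp]: "wed i (wed i v) = 0"
  by (rule additive_eqI[where v = v and g = "\<lambda>_. 0"])
     (auto simp: additive_def lin_ext_add ext_simps lin_ext_smul)

lemma con_con_same [simp]: "con i (con i v) = 0"
  by (rule additive_eqI[where v = v and g = "\<lambda>_. 0"])
     (auto simp: additive_def lin_ext_add ext_simps lin_ext_smul)

text \<open>Multiplication and contraction have only signs as matrix entries, and additive maps
  commute with signs. Besides renamings this covers \<open>var_quot\<close>, which is not
  multiplicative.\<close>

lemma base_change_wed_con:
  assumes "additive \<phi>"
  shows "base_change id \<phi> (wed i v) = wed i (base_change id \<phi> v)"
    and "base_change id \<phi> (con i v) = con i (base_change id \<phi> v)"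
proof -
  note [simp] = additive.zero[OF assms] additive.minus[OF assms]
    additive.add[OF additive_base_change[OF assms]] additive.zero[OF additive_base_change[OF assms]]
  have "\<phi> (r * theta_sign i T) = \<phi> r * theta_sign i T" for r T
    by (simp add: theta_sign_def minus_one_power_iff)
  note [simp] = this
  show "base_change id \<phi> (wed i v) = wed i (base_change id \<phi> v)"
    by (rule additive_eqI[where v = v]) (auto simp: additive_def lin_ext_add wedge_def)
  show "base_change id \<phi> (con i v) = con i (base_change id \<phi> v)"
    by (rule additive_eqI[where v = v]) (auto simp: additive_def lin_ext_add contract_def)
qed


subsection \<open>The differential\<close>

text \<open>\<open>p\<close> goes with multiplications and \<open>q\<close> with contractions. The
  generators form an arbitrary set of numbers, so that the factors of a composite can occupy
  different ranges.\<close>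

definition kd :: "nat set \<Rightarrow> (nat \<Rightarrow> 'r) \<Rightarrow> (nat \<Rightarrow> 'r) \<Rightarrow> nat set \<Rightarrow> (nat set \<Rightarrow>\<^sub>0 'r::comm_ring_1)" where
  "kd I p q T = (\<Sum>i\<in>I. smul (p i) (wedge i T) + smul (q i) (contract i T))"

lemma lin_ext_kd:
  "lin_ext (kd I p q) v = (\<Sum>i\<in>I. smul (p i) (wed i v) + smul (q i) (con i v))"
  by (rule additive_eqI[where v = v])
     (auto simp: additive_def lin_ext_add kd_def smul.scale_right_distrib smul.scale_sum_right
        sum.distrib algebra_simps intro!: sum.cong)

lemma kd_anticommute:
  assumes "\<And>i. i \<in> I \<Longrightarrow> wed i (F v) = - F (wed i v)" "\<And>i. i \<in> I \<Longrightarrow> con i (F v) = - F (con i v)"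
    and "additive F" "\<And>r v. F (smul r v) = smul r (F v)"
  shows "lin_ext (kd I p q) (F v) = - F (lin_ext (kd I p q) v)"
  unfolding lin_ext_kd
  by (simp add: assms additive.sum[OF assms(3)] additive.add[OF assms(3)] sum_negf sum_subtractf sum.distrib)

lemma kd_wed:
  assumes "j \<notin> I"
  shows "lin_ext (kd I p q) (wed j v) = - wed j (lin_ext (kd I p q) v)"
proof (rule kd_anticommute)
  fix i assume "i \<in> I"
  then show "wed i (wed j v) = - wed j (wed i v)" "con i (wed j v) = - wed j (con i v)"
    using wed_wed[of i j v] wed_con[of j i v] assms
    by (metis eq_neg_iff_add_eq_0, metis eq_neg_iff_add_eq_0 add.commute)
qed (simp_all add: additive_lin_ext lin_ext_smul)

lemma kd_con:
  assumes "j \<notin> I"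
  shows "lin_ext (kd I p q) (con j v) = - con j (lin_ext (kd I p q) v)"
proof (rule kd_anticommute)
  fix i assume "i \<in> I"
  then show "wed i (con j v) = - con j (wed i v)" "con i (con j v) = - con j (con i v)"
    using con_con[of i j v] wed_con[of i j v] assms
    by (metis eq_neg_iff_add_eq_0, metis eq_neg_iff_add_eq_0 add.commute)
qed (simp_all add: additive_lin_ext lin_ext_smul)

lemma kd_remove:
  assumes "finite I" "i \<in> I"
  shows "lin_ext (kd I p q) v = lin_ext (kd (I - {i}) p q) v + (smul (p i) (wed i v) + smul (q i) (con i v))"
  unfolding lin_ext_kd by (subst sum.remove[OF assms]) (simp add: add.commute)

text \<open>Different generators anticommute, so cross terms cancel; each single generator
  contributes \<open>p i * q i\<close> by \<open>wed_con_same\<close>.\<close>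

lemma kd_sq:
  assumes "finite I"
  shows "lin_ext (kd I p q) (lin_ext (kd I p q) v) = smul (\<Sum>i\<in>I. p i * q i) v"
  using assms
proof (induction I arbitrary: v)
  case empty
  then show ?case by (simp add: lin_ext_kd)
next
  case (insert i I)
  let ?D = "lin_ext (kd I p q)"
  let ?a = "\<lambda>v. smul (p i) (wed i v) + smul (q i) (con i v)"
  have eq: "lin_ext (kd (insert i I) p q) v = ?D v + ?a v" for v
    using insert by (subst kd_remove[of _ i]) auto
  have "?D (?a v) = - ?a (?D v)"
    using insert by (simp add: lin_ext_add lin_ext_smul kd_wed kd_con)
  moreover have "?a (?a v) = smul (p i * q i) (wed i (con i v) + con i (wed i v))"
    by (simp add: lin_ext_add lin_ext_smul smul.scale_right_distrib mult.commute)
  then have "?a (?a v) = smul (p i * q i) v" by (simp only: wed_con_same)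
  moreover have "(?D v + ?a v) = x \<Longrightarrow> ?a x = ?a (?D v) + ?a (?a v)" for x
    by (auto simp: lin_ext_add smul.scale_right_distrib)
  ultimately have "?D (?D v + ?a v) + ?a (?D v + ?a v) = ?D (?D v) + smul (p i * q i) v"
    by (simp only: lin_ext_add[of "kd I p q" "?D v" "?a v"]) simp
  then show ?case
    using insert by (simp only: eq) (simp add: smul.scale_left_distrib add.commute)
qed

abbreviation "kpar o' \<equiv> \<lambda>T :: nat set. odd (card T) \<noteq> o'"

text \<open>\<open>V\<close> contains the internal variables too, while scalars involve only source
  and target variables and act through the naming \<open>nm\<close>. The flag \<open>o'\<close>
  shifts the parity.\<close>

definition kosz ::
    "(bvar \<Rightarrow> 'v) \<Rightarrow> bool \<Rightarrow> nat set \<Rightarrow> 'v set \<Rightarrow> (nat \<Rightarrow> ('v, 'k) mpoly) \<Rightarrow> (nat \<Rightarrow> ('v, 'k) mpoly)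
      \<Rightarrow> (nat set \<Rightarrow>\<^sub>0 ('v, 'k::field_char_0) mpoly, (bvar, 'k) mpoly) cx" where
  "kosz nm o' I V p q = \<lparr>car = fmod (Pow I) V,
     hp = pmod (Pow I) V (kpar o'),
     act = (\<lambda>r. smul (rename nm r)), dff = lin_ext (kd I p q)\<rparr>"

lemma graded_kosz:
  assumes "nm ` B \<subseteq> V"
  shows "graded (polys B) (kosz nm o' I V p q)"
  by (rule graded_pmod[where \<phi> = "rename nm"])
     (use assms in \<open>auto simp: kosz_def intro: rename_polys\<close>)

lemma wedge_pmod:
  assumes "finite I" "i \<in> I" "T \<subseteq> I"
  shows "wedge i T \<in> pmod (Pow I) V (kpar o') ((odd (card T) \<noteq> o') \<noteq> True)"
  using assms finite_subset[of T I]
  by (auto simp: wedge_def theta_sign_def intro!: pmod_single)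
     (auto simp: minus_one_power_iff)

lemma contract_pmod:
  assumes "finite I" "T \<subseteq> I"
  shows "contract i T \<in> pmod (Pow (I - {i})) V (kpar o') ((odd (card T) \<noteq> o') \<noteq> True)"
proof (cases "i \<in> T")
  case True
  have "card T > 0" using True assms finite_subset[of T I] by (auto simp: card_gt_0_iff)
  then have "odd (card (T - {i})) = (\<not> odd (card T))" using True by simp
  then show ?thesis
    using assms True
    by (auto simp: contract_def theta_sign_def minus_one_power_iff intro!: pmod_single)
qed (simp add: contract_def)

lemma pmod_mono: "v \<in> pmod B S pr e \<Longrightarrow> B \<subseteq> B' \<Longrightarrow> S \<subseteq> S' \<Longrightarrow> v \<in> pmod B' S' pr e"
  using polys_mono[of S S'] by (auto simp: pmod_def fmod_def)

lemma kd_pmod: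
  assumes "finite I" "T \<subseteq> I" "\<And>i. i \<in> I \<Longrightarrow> p i \<in> polys V" "\<And>i. i \<in> I \<Longrightarrow> q i \<in> polys V"
  shows "kd I p q T \<in> pmod (Pow I) V (kpar o') ((odd (card T) \<noteq> o') \<noteq> True)"
  unfolding kd_def
  using assms
  by (intro pmod_sum pmod_add pmod_smul wedge_pmod pmod_mono[OF contract_pmod]) auto

lemma cx_kosz:
  assumes "finite I" "nm ` B \<subseteq> V"
    and "\<And>i. i \<in> I \<Longrightarrow> p i \<in> polys V" "\<And>i. i \<in> I \<Longrightarrow> q i \<in> polys V"
  shows "cx (polys B) (kosz nm o' I V p q)"
  unfolding cx_def
proof
  have "lin_ext (kd I p q) v \<in> pmod (Pow I) V (kpar o') (e \<noteq> True)"
    if "v \<in> pmod (Pow I) V (kpar o') e" for v e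
    by (rule lin_ext_pmod[OF that]) (use kd_pmod[OF assms(1) _ assms(3,4)] in simp)
  then show "cx_map (polys B) (kosz nm o' I V p q) (kosz nm o' I V p q) True (dff (kosz nm o' I V p q))"
    unfolding cx_map_def kosz_def by (simp add: lin_ext_add lin_ext_smul)
qed (rule graded_kosz[OF assms(2)])

subsection \<open>Elimination of a variable\<close>

lemma kosz_simps [simp]:
  "car (kosz nm o' I V p q) = fmod (Pow I) V"
  "hp (kosz nm o' I V p q) = pmod (Pow I) V (kpar o')"
  "act (kosz nm o' I V p q) = (\<lambda>r. smul (rename nm r))"
  "dff (kosz nm o' I V p q) = lin_ext (kd I p q)"
  by (simp_all add: kosz_def)

lemma ksign_sq [simp]: "ksign b * ksign b = 1" "ksign b * (ksign b * r) = r"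
  by (simp_all add: ksign_def)

lemma base_change_id_smul:
  assumes "additive \<phi>" "\<And>s. \<phi> (r * s) = r' * \<psi> s" "\<psi> 0 = 0"
  shows "base_change id \<phi> (smul r v) = smul r' (base_change id \<psi> v)"
  by (rule poly_mapping_eqI) (simp add: lookup_base_change_id assms additive.zero[OF assms(1)])

lemma base_change_kd:
  "base_change id (rename \<sigma>) (lin_ext (kd I p q) v) =
     lin_ext (kd I (\<lambda>i. rename \<sigma> (p i)) (\<lambda>i. rename \<sigma> (q i))) (base_change id (rename \<sigma>) v)"
proof -
  note ad = additive_base_change[OF additive_rename]
  show ?thesis
    unfolding lin_ext_kd additive.sum[OF ad] additive.add[OF ad]
    by (simp add: base_change_id_smul[OF additive_rename, where \<psi> = "rename \<sigma>"] rename_mult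
        base_change_wed_con[OF additive_rename])
qed

text \<open>The two cases of the elimination are treated together.  The differential is
  \<open>D = E + P A + s x B\<close> with \<open>x = v - a\<close>, where \<open>(A, B)\<close> is a pair of multiplication and contraction
  by one exterior generator, in either order.  The maps \<open>J'\<close> and \<open>J\<close> identify the kernel of
  \<open>B\<close> with the Koszul module without this generator; the quotient by \<open>x\<close> is the smaller complex,
  and division by \<open>x\<close> followed by \<open>A\<close> contracts the kernel of the projection.\<close>

lemma elimination_core:
  fixes A B E J J' D :: "(nat set \<Rightarrow>\<^sub>0 ('v, 'k::field_char_0) mpoly) \<Rightarrow> (nat set \<Rightarrow>\<^sub>0 ('v, 'k) mpoly)"
    and v a :: 'v and b :: bool
  defines "x \<equiv> var v - var a" and "s \<equiv> ksign b"
    and "S \<equiv> base_change id (rename (id(v := a)))"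
    and "K \<equiv> base_change id (var_quot v a)"
  assumes va: "v \<noteq> a"
    and add: "additive A" "additive B" "additive J" "additive J'" "additive E"
    and lin: "\<And>r u. A (smul r u) = smul r (A u)" "\<And>r u. B (smul r u) = smul r (B u)"
      "\<And>r u. J (smul r u) = smul r (J u)" "\<And>r u. J' (smul r u) = smul r (J' u)"
      "\<And>r u. E (smul r u) = smul r (E u)"
    and SJ: "\<And>u. S (J' u) = J' (S u)"
    and K: "\<And>u. K (A u) = A (K u)" "\<And>u. K (B u) = B (K u)" "\<And>u. K (J u) = J (K u)"
      "\<And>u. K (J' u) = J' (K u)"
    and AA: "\<And>u. A (A u) = 0" and AB: "\<And>u. A (B u) + B (A u) = u"
    and EA: "\<And>u. E (A u) = - A (E u)" and EB: "\<And>u. E (B u) = - B (E u)"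
    and JJ: "\<And>u. J (J' u) = B (A u)" and JA: "\<And>u. J' (A u) = 0"
    and JE: "\<And>u. J' (E u) = smul (ksign c) (E (J' u))"
    and D: "\<And>u. D u = E u + smul P (A u) + smul (s * x) (B u)"
  shows "S (J' (smul s (A (K u)))) = 0"
    and "S (J' (D u)) = smul (ksign c) (S (E (J' u)))"
    and "S (J' u) = 0 \<Longrightarrow> D (smul s (A (K u))) + smul s (A (K (D u))) = u"
proof -
  have adK: "additive K" and adS: "additive S"
    unfolding K_def S_def by (intro additive_base_change additive_var_quot va additive_rename)+
  \<comment> \<open>\<open>K\<close> is left inverse to multiplication by \<open>x\<close>, whereas
    \<open>smul x (K u)\<close> is \<open>u\<close> minus its substitution: together, division with
    remainder.\<close>
  have smulK: "K (smul x u) = u" "K (smul (s * x) u) = smul s u" for u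
  proof -
    show 1: "K (smul x u) = u" for u unfolding K_def x_def
      by (rule poly_mapping_eqI)
         (simp add: lookup_base_change_id additive.zero[OF additive_var_quot[OF va]] var_quot_cancel[OF va])
    have "smul (s * x) u = smul x (smul s u)" by (simp add: mult.commute)
    then show "K (smul (s * x) u) = smul s u" by (simp only: 1)
  qed
  have smulS: "S (smul r u) = smul (rename (id(v := a)) r) (S u)" for r u
    unfolding S_def by (rule base_change_id_smul) (auto simp: additive_rename rename_mult)
  have xK: "smul x (K u) = u - S u" for u
    unfolding K_def S_def x_def
    by (rule poly_mapping_eqI)
       (simp add: lookup_base_change_id additive.zero[OF additive_var_quot[OF va]] var_quot[OF va] lookup_minus)
  have z: "A 0 = 0" "B 0 = 0" "J 0 = 0" "J' 0 = 0" "E 0 = 0" "K 0 = 0" "S 0 = 0"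
    using add adK adS by (auto simp: additive.zero)
  note ad = additive.add[OF add(1)] additive.add[OF add(2)] additive.add[OF add(3)]
    additive.add[OF add(4)] additive.add[OF add(5)] additive.add[OF adK] additive.add[OF adS]
  note mi = additive.minus[OF add(1)] additive.minus[OF add(2)] additive.minus[OF add(5)] additive.minus[OF adK]
  show "S (J' (smul s (A (K u)))) = 0" by (simp add: lin JA z)
  have "rename (id(v := a)) (s * x) = 0" by (simp add: s_def x_def rename_mult rename_diff)
  then show "S (J' (D u)) = smul (ksign c) (S (E (J' u)))"
    by (simp add: D ad lin JA JE z smulS)
  assume S0: "S (J' u) = 0"
  \<comment> \<open>\<open>B A\<close> is the projection onto the kernel of \<open>B\<close>, and
    \<open>J\<close> carries \<open>J' u\<close> to this projection of \<open>u\<close>. Since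
    \<open>S (J' u) = 0\<close> makes \<open>J' u\<close> divisible by \<open>x\<close>, so is
    \<open>B (A u)\<close>, with quotient \<open>w\<close>.\<close>
  define w where "w = K (B (A u))"
  have BAu: "B (A u) = smul x w"
  proof -
    have "J' u = smul x (K (J' u))" using xK[of "J' u"] S0 by simp
    then have "J (J' u) = smul x (J (K (J' u)))" by (metis lin(3))
    moreover have "J (K (J' u)) = w" by (simp add: w_def JJ flip: K(3))
    ultimately show ?thesis by (simp add: JJ)
  qed
  \<comment> \<open>\<open>A\<close> factors through the projection \<open>B A\<close>, which
    commutes with \<open>E\<close>; this replaces \<open>K u\<close> by \<open>w\<close> under
    \<open>A E\<close>.\<close>
  have A_proj: "A y = A (B (A y))" for y
    using AB[of "A y"] by (simp add: AA z)
  have E_BA: "B (A (E y)) = E (B (A y))" for y by (simp add: EA EB mi)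
  have Kw: "B (A (K u)) = w" by (simp add: w_def K)
  have 1: "D (smul s (A (K u))) = B (A u) - smul s (A (E w))"
  proof -
    have "D (smul s (A (K u))) = smul s (E (A (K u))) + smul x (B (A (K u)))"
      unfolding D s_def by (simp add: lin AA flip: mult.assoc) (simp add: mult.assoc mult.left_commute)
    also have "E (A (K u)) = - A (E w)" using A_proj[of "E (K u)"] by (simp add: EA E_BA Kw)
    finally show ?thesis by (simp add: Kw BAu)
  qed
  have 2: "A (K (D u)) = A (E w) + smul s (A (B u))"
  proof -
    have "A (K (D u)) = A (K (E u)) + K (A (smul P (A u))) + A (smul s (B u))"
      by (simp add: D ad smulK K)
    also have "A (K (E u)) = K (A (E u))" by (simp add: K)
    also have "A (E u) = smul x (A (E w))" using A_proj[of "E u"] by (simp add: E_BA BAu lin)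
    finally show ?thesis by (simp add: lin AA z smulK)
  qed
  show "D (smul s (A (K u))) + smul s (A (K (D u))) = u"
    unfolding 1 2 using AB[of u] by (simp add: smul.scale_right_distrib s_def add.commute)
qed

text \<open>\<open>c\<close> records that the linear form is the coefficient of multiplication. The
  quotient then consists of multiples of generator \<open>i\<close>; stripping off this odd
  generator flips the parity and anticommutes with the remaining differential, whence the factor
  \<open>ksign c\<close>. The sign \<open>ksign b\<close> of the linear form is absorbed by the
  homotopy.\<close>

lemma heq_eliminate:
  fixes J J' A B' :: "(nat set \<Rightarrow>\<^sub>0 ('v, 'k::field_char_0) mpoly) \<Rightarrow> (nat set \<Rightarrow>\<^sub>0 ('v, 'k) mpoly)"
    and v a :: 'v
  defines "sb \<equiv> (rename (id(v := a)) :: ('v, 'k) mpoly \<Rightarrow> ('v, 'k) mpoly)"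
  assumes fin: "finite I" "i \<in> I" and va: "v \<noteq> a" "v \<in> V" "a \<in> V"
    and nm: "nm ` B \<subseteq> V - {v}"
    and pq: "\<And>j. j \<in> I \<Longrightarrow> p j \<in> polys V" "\<And>j. j \<in> I \<Longrightarrow> q j \<in> polys V"
    and w: "w \<in> polys B" "(\<Sum>j\<in>I. p j * q j) = rename nm w"
    and cases: "A = wed i \<and> B' = con i \<and> P = p i \<and> Q = q i \<and> J = id \<and> J' = (\<lambda>u. con i (wed i u)) \<and> \<not> c
      \<or> A = con i \<and> B' = wed i \<and> P = q i \<and> Q = p i \<and> J = wed i \<and> J' = con i \<and> c"
    and Q: "Q = ksign b * (var v - var a)"
  shows "heq (polys B) (kosz nm o' I V p q)
    (kosz nm (o' \<noteq> c) (I - {i}) (V - {v}) (\<lambda>j. ksign c * sb (p j)) (\<lambda>j. ksign c * sb (q j)))"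
    (is "heq ?Q ?C ?D")
proof -
  let ?S = "base_change id sb" and ?K = "base_change id (var_quot v a)"
  let ?E = "lin_ext (kd (I - {i}) p q)"
  let ?E' = "lin_ext (kd (I - {i}) (\<lambda>j. sb (p j)) (\<lambda>j. sb (q j)))"
  note adq = additive_var_quot[OF va(1)]
  have sb0: "sb 0 = 0" and q0: "var_quot v a 0 = 0" by (simp_all add: sb_def additive.zero[OF adq])
  have sbV: "sb r \<in> polys (V - {v})" if "r \<in> polys V" for r
    unfolding sb_def using that by (rule rename_polys) (use va in auto)
  have sbid: "sb r = r" if "r \<in> polys (V - {v})" for r
    unfolding sb_def using that by (rule rename_idI) auto
  have nmV: "rename nm r \<in> polys (V - {v})" if "r \<in> polys B" for r
    using that nm by (rule rename_polys)
  \<comment> \<open>This makes \<open>J\<close> a section of the projection in both cases.\<close>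
  have w_c: "con i (wed i u) = u" if "u \<in> fmod (Pow (I - {i})) V'" for u :: "nat set \<Rightarrow>\<^sub>0 ('v, 'k) mpoly" and V'
  proof (rule additive_eqI[where v = u and g = "\<lambda>u. u"])
    fix T assume "T \<in> keys u"
    then have "i \<notin> T" using that by (auto simp: fmod_def)
    then show "con i (wed i (single T (lookup u T))) = single T (lookup u T)"
      by (simp add: ext_simps lin_ext_smul mult.assoc)
  qed (simp_all add: additive_def lin_ext_add)
  have adsb: "additive sb" unfolding sb_def by (rule additive_rename)
  note bcs = base_change_wed_con[OF adsb]
  note bcq = base_change_wed_con[OF adq]
  have core: "?S (J' (smul (ksign b) (A (?K u)))) = 0"
      "?S (J' (lin_ext (kd I p q) u)) = smul (ksign c) (?S (?E (J' u)))"
      "?S (J' u) = 0 \<Longrightarrow> lin_ext (kd I p q) (smul (ksign b) (A (?K u))) +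
         smul (ksign b) (A (?K (lin_ext (kd I p q) u))) = u" for u
  proof -
    note * = elimination_core[where A = A and B = B' and E = ?E and J = J and J' = J' and v = v and a = a
        and b = b and c = c and P = P and D = "lin_ext (kd I p q)", folded sb_def]
    have D: "lin_ext (kd I p q) u = ?E u + smul P (A u) + smul (ksign b * (var v - var a)) (B' u)" for u
      using cases kd_remove[OF fin, of p q u] by (auto simp flip: Q)
    have wc: "wed i (con i u) + con i (wed i u) = u" "con i (wed i u) + wed i (con i u) = u"
      for u :: "nat set \<Rightarrow>\<^sub>0 ('v, 'k) mpoly"
      using wed_con_same[of i u] by (simp_all add: add.commute)
    have kwc: "?E (wed i u) = - wed i (?E u)" "?E (con i u) = - con i (?E u)" for u
      by (simp_all add: kd_wed kd_con)
    have side: "additive A" "additive B'" "additive J" "additive J'" "additive ?E"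
      "\<And>r u. A (smul r u) = smul r (A u)" "\<And>r u. B' (smul r u) = smul r (B' u)"
      "\<And>r u. J (smul r u) = smul r (J u)" "\<And>r u. J' (smul r u) = smul r (J' u)"
      "\<And>r u. ?E (smul r u) = smul r (?E u)"
      "\<And>u. ?S (J' u) = J' (?S u)"
      "\<And>u. ?K (A u) = A (?K u)" "\<And>u. ?K (B' u) = B' (?K u)" "\<And>u. ?K (J u) = J (?K u)"
      "\<And>u. ?K (J' u) = J' (?K u)"
      "\<And>u. A (A u) = 0" "\<And>u. A (B' u) + B' (A u) = u"
      "\<And>u. ?E (A u) = - A (?E u)" "\<And>u. ?E (B' u) = - B' (?E u)"
      "\<And>u. J (J' u) = B' (A u)" "\<And>u. J' (A u) = 0"
      "\<And>u. J' (?E u) = smul (ksign c) (?E (J' u))"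
      using cases
      by (auto simp: additive_lin_ext lin_ext_smul additive_def lin_ext_add bcs bcq wc kwc lin_ext_minus ksign_def)
    show "?S (J' (smul (ksign b) (A (?K u)))) = 0"
      "?S (J' (lin_ext (kd I p q) u)) = smul (ksign c) (?S (?E (J' u)))"
      "?S (J' u) = 0 \<Longrightarrow> lin_ext (kd I p q) (smul (ksign b) (A (?K u))) +
         smul (ksign b) (A (?K (lin_ext (kd I p q) u))) = u"
      using *[OF va(1) side D] by blast+
  qed
  have E': "?S (?E u) = ?E' (?S u)" for u
    unfolding sb_def by (rule base_change_kd)
  have E'': "lin_ext (kd (I - {i}) (\<lambda>j. ksign c * sb (p j)) (\<lambda>j. ksign c * sb (q j))) u = smul (ksign c) (?E' u)" for u
    unfolding lin_ext_kd by (simp add: smul.scale_sum_right smul.scale_right_distrib)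
  have gC: "graded ?Q ?C" by (rule graded_kosz) (use nm in auto)
  have J'_pmod: "J' u \<in> pmod (Pow (I - {i})) V (kpar (o' \<noteq> c)) e"
    if "u \<in> pmod (Pow I) V (kpar o') e" for u e
  proof -
    have w1: "wed i u \<in> pmod (Pow I) V (kpar o') (e \<noteq> True)"
      by (rule lin_ext_pmod[OF that]) (use wedge_pmod[OF fin] in simp)
    have c1: "con i u \<in> pmod (Pow (I - {i})) V (kpar o') (e \<noteq> True)"
      if "u \<in> pmod (Pow I) V (kpar o') e" for u e
      by (rule lin_ext_pmod[OF that]) (use contract_pmod[OF fin(1)] in simp)
    show ?thesis using cases c1[OF w1] c1[OF that] by (auto simp: pmod_iff)
  qed
  have J_pmod: "J u \<in> pmod (Pow I) V (kpar o') e"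
    if "u \<in> pmod (Pow (I - {i})) (V - {v}) (kpar (o' \<noteq> c)) e" for u e
  proof -
    have u: "u \<in> pmod (Pow I) V (kpar (o' \<noteq> c)) e"
      by (rule pmod_mono[OF that]) auto
    have "wed i u \<in> pmod (Pow I) V (kpar (o' \<noteq> c)) (e \<noteq> True)"
      by (rule lin_ext_pmod[OF u]) (use wedge_pmod[OF fin, where o' = "o' \<noteq> c"] in blast)
    then show ?thesis using cases u by (auto simp: pmod_iff)
  qed
  have A_pmod: "A u \<in> pmod (Pow I) V (kpar o') (e \<noteq> True)"
    if "u \<in> pmod (Pow I) V (kpar o') e" for u e
  proof -
    have "wed i u \<in> pmod (Pow I) V (kpar o') (e \<noteq> True)"
      by (rule lin_ext_pmod[OF that]) (use wedge_pmod[OF fin] in simp)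
    moreover have "con i u \<in> pmod (Pow I) V (kpar o') (e \<noteq> True)"
      by (rule lin_ext_pmod[OF that], rule pmod_mono[OF contract_pmod[OF fin(1)]]) auto
    ultimately show ?thesis using cases by auto
  qed
  have linA: "A (u + u') = A u + A u'" "A (smul r u) = smul r (A u)"
    and linJ: "J (u + u') = J u + J u'" "J (smul r u) = smul r (J u)"
    and linJ': "J' (u + u') = J' u + J' u'" "J' (smul r u) = smul r (J' u)" for u u' r
    using cases by (auto simp: lin_ext_add lin_ext_smul)
  note adS = additive_base_change[OF adsb]
  note adK = additive_base_change[OF adq]
  show ?thesis
  proof (rule heq_retractI[where w = w and pr = "\<lambda>u. ?S (J' u)" and \<sigma> = J
        and h = "\<lambda>u. smul (ksign b) (A (?K u))"])
    show "cx ?Q ?C" by (rule cx_kosz) (use fin nm pq in auto)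
    show "cx ?Q ?D" by (rule cx_kosz) (use fin nm pq sbV in \<open>auto intro!: polys_mult\<close>)
    show "chain_map ?Q ?C ?D (\<lambda>u. ?S (J' u))"
      unfolding chain_map_def
    proof (intro conjI ballI)
      show "cx_map ?Q ?C ?D False (\<lambda>u. ?S (J' u))"
        unfolding cx_map_def
      proof (intro conjI ballI allI)
        fix r u assume "r \<in> ?Q"
        then have "sb (rename nm r) = rename nm r" by (intro sbid nmV)
        then show "?S (J' (act ?C r u)) = act ?D r (?S (J' u))"
          using base_change_id_smul[of sb "rename nm r" "rename nm r" sb]
          by (simp add: linJ' sb_def rename_mult additive_rename)
      next
        fix e u assume "u \<in> hp ?C e"
        then show "?S (J' u) \<in> hp ?D (e \<noteq> False)"
          using base_change_pmod[where \<phi> = sb and S' = "V - {v}", OF J'_pmod] sb0 sbV by simp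
      qed (simp add: linJ' additive.add[OF adS])
    qed (simp add: core(2) E' E'')
    show "cx_map ?Q ?D ?C False J"
      unfolding cx_map_def using J_pmod by (auto simp: linJ)
    show "?S (J' (J u)) = u" if "u \<in> car ?D" for u
    proof -
      have "J' (J u) = u" using cases w_c[of u "V - {v}"] that by auto
      moreover have "?S u = u"
        using that by (intro poly_mapping_eqI) (simp add: lookup_base_change_id sb0 sbid fmod_def)
      ultimately show ?thesis by simp
    qed
    show "cx_map ?Q ?C ?C True (\<lambda>u. smul (ksign b) (A (?K u)))"
      unfolding cx_map_def
    proof (intro conjI ballI allI)
      fix r and u :: "nat set \<Rightarrow>\<^sub>0 ('v, 'k) mpoly" assume "r \<in> ?Q"
      then have "sb (rename nm r) = rename nm r" by (intro sbid nmV)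
      then have "?K (smul (rename nm r) u) = smul (rename nm r) (?K u)"
        by (intro base_change_id_smul adq) (simp_all add: q0 var_quot_mult[OF va(1)] sb_def)
      then show "smul (ksign b) (A (?K (act ?C r u))) = act ?C r (smul (ksign b) (A (?K u)))"
        by (simp add: linA mult.commute)
    next
      fix e u assume "u \<in> hp ?C e"
      then have "?K u \<in> pmod (Pow I) V (kpar o') e"
        by (intro base_change_pmod[where S = V] q0 var_quot_polys[OF va(1) _ va(2,3)]) simp_all
      from A_pmod[OF this] show "smul (ksign b) (A (?K u)) \<in> hp ?C (e \<noteq> True)"
        by (simp add: pmod_smul)
    qed (simp add: linA additive.add[OF adK] smul.scale_right_distrib)
  qed (use w core in \<open>auto simp: kd_sq[OF fin(1)]\<close>)
qed

section \<open>Flattening matrix factorisations to Koszul complexes\<close>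

text \<open>The inverse of the flattening map is constructed monomial by monomial and is additive by
  construction, so equalities are tested on single monomials.\<close>

lemma fmod_additive_eqI:
  fixes f g :: "('b \<Rightarrow>\<^sub>0 ('v, 'k::field_char_0) mpoly) \<Rightarrow> 'c::ab_group_add"
  assumes "v \<in> fmod B S" "additive f" "additive g"
    and "\<And>b m c. b \<in> B \<Longrightarrow> m \<in> mons S \<Longrightarrow> f (single b (single m c)) = g (single b (single m c))"
  shows "f v = g v"
proof (rule additive_eqI[OF assms(2,3)])
  fix b assume b: "b \<in> keys v"
  show "f (single b (lookup v b)) = g (single b (lookup v b))"
  proof (rule additive_eqI[where v = "lookup v b" and f = "\<lambda>p. f (single b p)" and g = "\<lambda>p. g (single b p)"])
    fix m assume "m \<in> keys (lookup v b)"
    then show "f (single b (single m (lookup (lookup v b) m))) = g (single b (single m (lookup (lookup v b) m)))"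
      using b assms(1) by (intro assms(4)) (auto simp: fmod_def polys_iff)
  qed (use assms(2,3) in \<open>auto simp: additive_def single_add\<close>)
qed

lemma fmod_closed:
  fixes f :: "('b \<Rightarrow>\<^sub>0 ('v, 'k::field_char_0) mpoly) \<Rightarrow> 'c::ab_group_add"
  assumes "v \<in> fmod B S" "additive f" "0 \<in> M" "\<And>x y. x \<in> M \<Longrightarrow> y \<in> M \<Longrightarrow> x + y \<in> M"
    and "\<And>b m c. b \<in> B \<Longrightarrow> m \<in> mons S \<Longrightarrow> f (single b (single m c)) \<in> M"
  shows "f v \<in> M"
proof -
  have sum: "(\<And>i. i \<in> I \<Longrightarrow> h i \<in> M) \<Longrightarrow> (\<Sum>i\<in>I. h i) \<in> M" for h :: "'i \<Rightarrow> 'c" and I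
    by (induction I rule: infinite_finite_induct) (auto intro: assms)
  have eq: "v = (\<Sum>b\<in>keys v. \<Sum>m\<in>keys (lookup v b). single b (single m (lookup (lookup v b) m)))"
    by (simp add: sum_single_keys flip: additive.sum[OF additive_single])
  have "f v = (\<Sum>b\<in>keys v. \<Sum>m\<in>keys (lookup v b). f (single b (single m (lookup (lookup v b) m))))"
    by (subst eq) (simp only: additive.sum[OF assms(2)])
  also have "\<dots> \<in> M"
    using assms(1) by (intro sum assms(5)) (auto simp: fmod_def polys_iff)
  finally show ?thesis .
qed

text \<open>The factor of a monomial in the variables \<open>A\<close>. For disjoint sets of
  internal and external variables it undoes the multiplication of their monomials.\<close>

definition restrict_mon :: "'v set \<Rightarrow> 'v mon \<Rightarrow> 'v mon" where
  "restrict_mon A m = (\<Sum>v\<in>keys m. single v (if v \<in> A then lookup m v else 0))"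

lemma lookup_restrict_mon: "lookup (restrict_mon A m) v = (if v \<in> A then lookup m v else 0)"
proof -
  have "lookup (restrict_mon A m) v = (\<Sum>w\<in>keys m. if w = v then (if v \<in> A then lookup m v else 0) else 0)"
    unfolding restrict_mon_def lookup_sum by (rule sum.cong) (auto simp: lookup_single when_def)
  also have "\<dots> = (if v \<in> A then lookup m v else 0)" by (auto simp: sum.delta in_keys_iff)
  finally show ?thesis .
qed

lemma restrict_mon_mons [simp]: "restrict_mon A m \<in> mons A"
  by (auto simp: mons_def in_keys_iff lookup_restrict_mon split: if_splits)

lemma restrict_mon_add: "restrict_mon A (m + m') = restrict_mon A m + restrict_mon A m'"
  by (rule poly_mapping_eqI) (simp add: lookup_restrict_mon lookup_add)

lemma restrict_mon_id: "m \<in> mons A \<Longrightarrow> restrict_mon A m = m"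
  by (rule poly_mapping_eqI) (auto simp: lookup_restrict_mon mons_def in_keys_iff)

lemma restrict_mon_disjoint: "m \<in> mons B \<Longrightarrow> A \<inter> B = {} \<Longrightarrow> restrict_mon A m = 0"
  by (rule poly_mapping_eqI) (auto simp: lookup_restrict_mon mons_def in_keys_iff)

lemma restrict_mon_Un:
  assumes "m \<in> mons (A \<union> B)" "A \<inter> B = {}"
  shows "restrict_mon A m + restrict_mon B m = m"
proof (rule poly_mapping_eqI)
  fix v
  have "v \<notin> A \<Longrightarrow> v \<notin> B \<Longrightarrow> lookup m v = 0" "v \<in> A \<Longrightarrow> v \<notin> B"
    using assms by (auto simp: mons_def in_keys_iff)
  then show "lookup (restrict_mon A m + restrict_mon B m) v = lookup m v"
    by (auto simp: lookup_restrict_mon lookup_add)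
qed

lemma rename_mon_inv:
  assumes "inj_on nm S"
  shows "m \<in> mons S \<Longrightarrow> rename_mon (inv_into S nm) (rename_mon nm m) = m"
    and "m' \<in> mons (nm ` S) \<Longrightarrow> rename_mon nm (rename_mon (inv_into S nm) m') = m'"
proof -
  assume "m \<in> mons S"
  then have "rename_mon (inv_into S nm \<circ> nm) m = rename_mon id m"
    using assms by (intro rename_mon_cong) (auto simp: mons_def)
  then show "rename_mon (inv_into S nm) (rename_mon nm m) = m" by (simp add: rename_mon_comp)
next
  assume "m' \<in> mons (nm ` S)"
  then have "rename_mon (nm \<circ> inv_into S nm) m' = rename_mon id m'"
    by (intro rename_mon_cong) (auto simp: mons_def f_inv_into_f)
  then show "rename_mon nm (rename_mon (inv_into S nm) m') = m'" by (simp add: rename_mon_comp)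
qed


subsection \<open>The flattening map\<close>

text \<open>Moves internal monomials from the basis into the coefficients, so that only the exterior
  part \<open>T b\<close> remains as a basis. The signs \<open>sg\<close> are there for dual
  factors, whose dual basis matches the exterior one only up to sign.\<close>

definition flat ::
    "(bvar \<Rightarrow> 'v) \<Rightarrow> ('b \<Rightarrow> 'v mon) \<Rightarrow> ('b \<Rightarrow> bool) \<Rightarrow> ('b \<Rightarrow> nat set)
      \<Rightarrow> ('b \<Rightarrow>\<^sub>0 (bvar, 'k::field_char_0) mpoly) \<Rightarrow> (nat set \<Rightarrow>\<^sub>0 ('v, 'k) mpoly)" where
  "flat nm m sg T v = (\<Sum>b\<in>keys v. single (T b) (rename nm (lookup v b) * single (m b) (ksign (sg b))))"

lemma additive_flat: "additive (flat nm m sg T)"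
  unfolding flat_def
  by (rule additiveI_sum_keys) (auto simp: additive_def rename_add single_add distrib_right)

lemmas flat_add = additive.add[OF additive_flat]
  and flat_zero [simp] = additive.zero[OF additive_flat]
  and flat_sum = additive.sum[OF additive_flat]
  and flat_minus = additive.minus[OF additive_flat]

lemma flat_single [simp]:
  "flat nm m sg T (single b r) = single (T b) (rename nm r * single (m b) (ksign (sg b)))"
  unfolding flat_def by (subst sum_keys_single) auto

lemma flat_smul: "flat nm m sg T (smul r v) = smul (rename nm r) (flat nm m sg T v)"
  by (rule additive_eqI[where v = v])
     (auto simp: additive_def flat_add smul.scale_right_distrib rename_mult mult.assoc)

lemma flat_comp_lin_ext:
  assumes "keys v \<subseteq> B" "\<And>b. b \<in> B \<Longrightarrow> flat nm m sg T (f b) = lin_ext F (single (T b) (single (m b) (ksign (sg b))))"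
  shows "flat nm m sg T (lin_ext f v) = lin_ext F (flat nm m sg T v)"
proof (rule additive_eqI[where v = v])
  fix b assume "b \<in> keys v"
  then show "flat nm m sg T (lin_ext f (single b (lookup v b))) = lin_ext F (flat nm m sg T (single b (lookup v b)))"
    using assms by (auto simp: flat_smul subset_iff)
qed (auto simp: additive_def flat_add lin_ext_add)

lemma flat_pmod:
  assumes "v \<in> pmod B S pr e" "\<And>b. b \<in> B \<Longrightarrow> m b \<in> mons V \<and> T b \<subseteq> I \<and> pr' (T b) = pr b"
  shows "flat nm m sg T v \<in> pmod (Pow I) (V \<union> nm ` S) pr' e"
  unfolding flat_def
proof (intro pmod_sum pmod_single polys_mult)
  fix b assume "b \<in> keys v"
  then have b: "b \<in> B" "pr b = e" "lookup v b \<in> polys S" using assms(1) by (auto simp: pmod_def fmod_def)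
  then show "T b \<in> Pow I" "pr' (T b) = e" using assms(2) by auto
  show "rename nm (lookup v b) \<in> polys (V \<union> nm ` S)" using b(3) by (rule rename_polys) auto
  show "single (m b) (ksign (sg b)) \<in> polys (V \<union> nm ` S)"
    using assms(2)[OF b(1)] mons_mono[of V "V \<union> nm ` S"] by (intro polys_single) auto
qed

text \<open>A monomial in the internal and the named external variables splits uniquely: the
  internal factor and the exterior part determine the basis element, the external factor its
  coefficient.\<close>

lemma bij_betw_flat:
  assumes bij: "bij_betw (\<lambda>b. (m b, T b)) B (mons V \<times> Pow I)"
    and inj: "inj_on nm S" and disj: "V \<inter> nm ` S = {}"
  shows "bij_betw (flat nm m sg T :: _ \<Rightarrow> nat set \<Rightarrow>\<^sub>0 ('v, 'k::field_char_0) mpoly)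
    (fmod B S) (fmod (Pow I) (V \<union> nm ` S))"
proof -
  define \<beta> where "\<beta> = inv_into B (\<lambda>b. (m b, T b))"
  have mT: "m b \<in> mons V" "T b \<subseteq> I" if "b \<in> B" for b
    using bij_betwE[OF bij] that by auto
  have \<beta>: "\<beta> (m b, T b) = b" if "b \<in> B" for b
    unfolding \<beta>_def using bij_betw_inv_into_left[OF bij that] by simp
  have \<beta>': "\<beta> (M, T') \<in> B" "m (\<beta> (M, T')) = M" "T (\<beta> (M, T')) = T'" if "M \<in> mons V" "T' \<subseteq> I" for M T'
    using bij_betwE[OF bij_betw_inv_into[OF bij]] bij_betw_inv_into_right[OF bij, of "(M, T')"] that
    by (auto simp: \<beta>_def)
  \<comment> \<open>The inverse on one monomial; the sign is multiplied in a second time and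
    cancels.\<close>
  define G :: "nat set \<Rightarrow> 'v mon \<Rightarrow> 'k \<Rightarrow> ('a \<Rightarrow>\<^sub>0 (bvar, 'k) mpoly)"
    where "G T' M c = single (\<beta> (restrict_mon V M, T'))
      (single (rename_mon (inv_into S nm) (restrict_mon (nm ` S) M)) (ksign (sg (\<beta> (restrict_mon V M, T'))) * c))" for T' M c
  define F where "F T' p = (\<Sum>M\<in>keys p. G T' M (lookup p M))" for T' p
  define u where "u g = (\<Sum>T'\<in>keys g. F T' (lookup g T'))" for g
  have adG: "additive (G T' M)" for T' M
    unfolding G_def by (simp add: additive_def distrib_left single_add)
  have adF: "additive (F T')" for T' unfolding F_def by (rule additiveI_sum_keys) (rule adG)
  have adu: "additive u" unfolding u_def by (rule additiveI_sum_keys) (rule adF)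
  have u_single: "u (single T' (single M c)) = G T' M c" for T' M c
    unfolding u_def F_def
    by (subst sum_keys_single, simp, subst sum_keys_single) (simp_all add: additive.zero[OF adG])
  show ?thesis
  proof (rule bij_betw_byWitness[where f' = u])
    show "\<forall>v\<in>fmod B S. u (flat nm m sg T v) = v"
    proof
      fix v :: "'a \<Rightarrow>\<^sub>0 (bvar, 'k) mpoly" assume v: "v \<in> fmod B S"
      have "u (flat nm m sg T (single b (single \<mu> c))) = single b (single \<mu> c)"
        if b: "b \<in> B" and \<mu>: "\<mu> \<in> mons S" for b \<mu> and c :: 'k
      proof -
        have r\<mu>: "rename_mon nm \<mu> \<in> mons (nm ` S)" by (rule rename_mon_mons[OF \<mu>]) simp
        have 1: "restrict_mon V (rename_mon nm \<mu> + m b) = m b"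
          using mT[OF b] disj r\<mu> by (simp add: restrict_mon_add restrict_mon_id restrict_mon_disjoint)
        have 2: "restrict_mon (nm ` S) (rename_mon nm \<mu> + m b) = rename_mon nm \<mu>"
          using mT[OF b] disj r\<mu> by (simp add: restrict_mon_add restrict_mon_id restrict_mon_disjoint Int_commute)
        show ?thesis
          by (simp add: mult_single u_single G_def 1 2 \<beta>[OF b] rename_mon_inv(1)[OF inj \<mu>] mult.commute mult.left_commute)
      qed
      then show "u (flat nm m sg T v) = v"
        using fmod_additive_eqI[OF v additive_comp[OF adu additive_flat[of nm m sg T]] additive_id] by blast
    qed
    have gen: "flat nm m sg T (G T' M c) = single T' (single M c)" "G T' M c \<in> fmod B S"
      if T': "T' \<in> Pow I" and M: "M \<in> mons (V \<union> nm ` S)" for T' M c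
    proof -
      have b: "\<beta> (restrict_mon V M, T') \<in> B" "m (\<beta> (restrict_mon V M, T')) = restrict_mon V M"
        "T (\<beta> (restrict_mon V M, T')) = T'" using \<beta>' T' by auto
      show "flat nm m sg T (G T' M c) = single T' (single M c)"
        unfolding G_def using b
        by (simp add: mult_single rename_mon_inv(2)[OF inj] restrict_mon_Un[OF M disj] add.commute mult.commute mult.left_commute)
      show "G T' M c \<in> fmod B S"
        unfolding G_def
        by (intro fmod_single polys_single b rename_mon_mons[OF restrict_mon_mons]) (auto simp: inv_into_into)
    qed
    show "\<forall>g\<in>fmod (Pow I) (V \<union> nm ` S). flat nm m sg T (u g) = g"
    proof
      fix g :: "nat set \<Rightarrow>\<^sub>0 ('v, 'k) mpoly" assume g: "g \<in> fmod (Pow I) (V \<union> nm ` S)"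
      show "flat nm m sg T (u g) = g"
        using fmod_additive_eqI[OF g additive_comp[OF additive_flat[of nm m sg T] adu] additive_id]
        by (simp only: u_single gen)
    qed
    show "flat nm m sg T ` fmod B S \<subseteq> fmod (Pow I) (V \<union> nm ` S)"
      using flat_pmod[of _ B S "\<lambda>_. False" False m V T I "\<lambda>_. False" nm sg] mT
      by (auto simp: fmod_eq_pmod)
    show "u ` fmod (Pow I) (V \<union> nm ` S) \<subseteq> fmod B S"
    proof
      fix x assume "x \<in> u ` fmod (Pow I) (V \<union> nm ` S)"
      then obtain g where g: "g \<in> fmod (Pow I) (V \<union> nm ` S)" "x = u g" by auto
      have "u g \<in> fmod B S"
        by (rule fmod_closed[OF g(1) adu]) (simp_all add: u_single gen fmod_add)
      then show "x \<in> fmod B S" using g by simp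
    qed
  qed
qed


subsection \<open>Realizations\<close>

definition bvars :: "('b, 'k::field_char_0) mor1 \<Rightarrow> bvar set" where
  "bvars X = Src ` {..<fst (src X)} \<union> Tgt ` {..<fst (tgt X)}"

lemma base_ring_eq: "base_ring X = polys (bvars X)"
  by (simp add: base_ring_def bvars_def)

lemma elems_eq: "elems X = fmod (basis X) (bvars X)"
  by (simp add: elems_def fmod_def base_ring_eq)

lemma homog_eq: "homog X = pmod (basis X) (bvars X) (par X)"
  by (simp add: homog_def pmod_def elems_eq fun_eq_iff)

text \<open>The part that does not depend on how the basis is matched. The potential is recorded as
  a sum, which by \<open>kd_sq\<close> is the square of the differential; it adds up under products
  and telescopes under composition.\<close>

definition curved ::
    "(bvar \<Rightarrow> 'v) \<Rightarrow> nat set \<Rightarrow> 'v set \<Rightarrow> (nat \<Rightarrow> ('v, 'k) mpoly) \<Rightarrow> (nat \<Rightarrow> ('v, 'k) mpoly)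
      \<Rightarrow> ('b, 'k::field_char_0) mor1 \<Rightarrow> bool" where
  "curved nm I V p q X \<longleftrightarrow>
     (\<forall>i\<in>I. p i \<in> polys (V \<union> nm ` bvars X) \<and> q i \<in> polys (V \<union> nm ` bvars X)) \<and>
     (\<Sum>i\<in>I. p i * q i) = rename (nm \<circ> Tgt) (snd (tgt X)) - rename (nm \<circ> Src) (snd (src X))"

text \<open>The basis element \<open>b\<close> corresponds to \<open>\<plusminus>y\<^sup>m \<theta>\<^sub>T\<close>; the internal variables are those in \<open>V\<close>, and
  \<open>nm\<close> names the source and target variables.\<close>

definition realizes_by ::
    "(bvar \<Rightarrow> 'v) \<Rightarrow> bool \<Rightarrow> nat set \<Rightarrow> 'v set \<Rightarrow> (nat \<Rightarrow> ('v, 'k) mpoly) \<Rightarrow> (nat \<Rightarrow> ('v, 'k) mpoly)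
      \<Rightarrow> ('b, 'k::field_char_0) mor1 \<Rightarrow> ('b \<Rightarrow> 'v mon) \<Rightarrow> ('b \<Rightarrow> bool) \<Rightarrow> ('b \<Rightarrow> nat set) \<Rightarrow> bool" where
  "realizes_by nm o' I V p q X m sg T \<longleftrightarrow>
     bij_betw (\<lambda>b. (m b, T b)) (basis X) (mons V \<times> Pow I) \<and>
     (\<forall>b\<in>basis X. par X b = (odd (card (T b)) \<noteq> o') \<and> dcol X b \<in> elems X \<and>
        flat nm m sg T (dcol X b) = smul (single (m b) (ksign (sg b))) (kd I p q (T b)))"

definition realizes ::
    "(bvar \<Rightarrow> 'v) \<Rightarrow> bool \<Rightarrow> nat set \<Rightarrow> 'v set \<Rightarrow> (nat \<Rightarrow> ('v, 'k) mpoly) \<Rightarrow> (nat \<Rightarrow> ('v, 'k) mpoly)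
      \<Rightarrow> ('b, 'k::field_char_0) mor1 \<Rightarrow> bool" where
  "realizes nm o' I V p q X \<longleftrightarrow> curved nm I V p q X \<and> (\<exists>m sg T. realizes_by nm o' I V p q X m sg T)"

lemma graded_cx_of: "graded (base_ring X) (cx_of X)"
  by (rule graded_pmod[where \<phi> = "\<lambda>r. r"]) (simp_all add: cx_of_def elems_eq homog_eq base_ring_eq)

lemma realizes_by_dif:
  assumes "realizes_by nm o' I V p q X m sg T" "v \<in> elems X"
  shows "dif X v \<in> elems X" "flat nm m sg T (dif X v) = lin_ext (kd I p q) (flat nm m sg T v)"
  using assms lin_ext_fmod[of v "basis X" "bvars X" "dcol X" "basis X"]
  by (auto simp: realizes_by_def dif_def elems_eq fmod_def intro!: flat_comp_lin_ext[where B = "basis X"])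

text \<open>The flattening map is the equivalence, and even an isomorphism: injectivity and
  disjointness of the names exclude that two source, target or internal variables are
  merged.\<close>

lemma realizes_heq:
  assumes X: "realizes nm o' I V p q X" and fin: "finite I"
    and inj: "inj_on nm (bvars X)" and disj: "V \<inter> nm ` bvars X = {}"
  shows "cx (base_ring X) (cx_of X)"
    and "cx (base_ring X) (kosz nm o' I (V \<union> nm ` bvars X) p q)"
    and "heq (base_ring X) (cx_of X) (kosz nm o' I (V \<union> nm ` bvars X) p q)"
proof -
  obtain m sg T where r: "realizes_by nm o' I V p q X m sg T" using X by (auto simp: realizes_def)
  then have bij: "bij_betw (\<lambda>b. (m b, T b)) (basis X) (mons V \<times> Pow I)"
    and par: "\<And>b. b \<in> basis X \<Longrightarrow> par X b = (odd (card (T b)) \<noteq> o')"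
    by (auto simp: realizes_by_def)
  let ?K = "kosz nm o' I (V \<union> nm ` bvars X) p q"
  show K: "cx (base_ring X) ?K"
    unfolding base_ring_eq by (rule cx_kosz) (use fin X in \<open>auto simp: realizes_def curved_def\<close>)
  have f: "cx_map (base_ring X) (cx_of X) ?K False (flat nm m sg T)"
    unfolding cx_map_def
  proof (intro conjI ballI allI)
    fix e v assume "v \<in> hp (cx_of X) e"
    then show "flat nm m sg T v \<in> hp ?K (e \<noteq> False)"
      using flat_pmod[of v "basis X" "bvars X" "par X" e m V T I "kpar o'" nm sg]
        bij_betwE[OF bij] par
      by (auto simp: cx_of_def homog_eq)
  qed (simp_all add: flat_add cx_of_def flat_smul)
  have bijf: "bij_betw (flat nm m sg T) (car (cx_of X)) (car ?K)"
    using bij_betw_flat[OF bij inj disj] by (simp add: cx_of_def elems_eq)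
  show "cx (base_ring X) (cx_of X)" "heq (base_ring X) (cx_of X) ?K"
    using realizes_by_dif[OF r] by (intro cx_isoI[OF graded_cx_of K f bijf]; simp add: cx_of_def)+
qed

text \<open>Both sides of the factorisation equation agree after flattening, by \<open>kd_sq\<close>
  and the sum in \<open>curved\<close>, and flattening is injective.\<close>

lemma realizes_is_mf:
  assumes X: "realizes nm o' I V p q X" and fin: "finite I"
    and inj: "inj_on nm (bvars X)" and disj: "V \<inter> nm ` bvars X = {}"
    and st: "src X = A" "tgt X = B"
    and AB: "snd A \<in> polys {..<fst A}" "snd B \<in> polys {..<fst B}"
  shows "is_mf A B X"
  unfolding is_mf_def
proof (intro conjI ballI st)
  obtain m sg T where r: "realizes_by nm o' I V p q X m sg T" using X by (auto simp: realizes_def)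
  then have bij: "bij_betw (\<lambda>b. (m b, T b)) (basis X) (mons V \<times> Pow I)"
    by (simp add: realizes_by_def)
  note dif = realizes_by_dif[OF r]
  show "dif X \<in> hom X X True"
    using cxD(2)[OF realizes_heq(1)[OF X fin inj disj]] by (simp add: hom_iff_cx_map cx_of_def)
  fix v assume v: "v \<in> elems X"
  let ?w = "rename Tgt (snd B) - rename Src (snd A)"
  have "rename nm ?w = (\<Sum>i\<in>I. p i * q i)"
    using X st by (simp add: realizes_def curved_def rename_diff rename_comp)
  then have eq: "flat nm m sg T (dif X (dif X v)) = flat nm m sg T (smul ?w v)"
    using v by (simp add: dif kd_sq[OF fin] flat_smul)
  have "?w \<in> polys (bvars X)"
    by (intro polys_diff rename_polys[OF AB(1)] rename_polys[OF AB(2)]) (auto simp: bvars_def st)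
  then have "smul ?w v \<in> elems X" using v by (simp add: elems_eq fmod_smul)
  moreover have "inj_on (flat nm m sg T) (elems X)"
    using bij_betw_flat[OF bij inj disj, of sg, where 'k = 'b] by (simp add: bij_betw_def elems_eq)
  ultimately show "dif X (dif X v) = smul ?w v"
    using eq v dif(1) by (auto dest: inj_onD)
qed


subsection \<open>Shift and change of basis\<close>

lemma base_change_fmod:
  assumes "v \<in> fmod B S" "\<beta> ` B \<subseteq> B'" "\<And>r. r \<in> polys S \<Longrightarrow> \<phi> r \<in> polys S'"
  shows "base_change \<beta> \<phi> v \<in> fmod B' S'"
  unfolding base_change_def
  using assms by (intro fmod_sum fmod_single) (auto simp: fmod_def)

lemma base_change_smul: "base_change \<beta> id (smul r v) = smul r (base_change \<beta> id v)"
  by (rule additive_eqI[where v = v])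
     (auto simp: additive_def additive.add[OF additive_base_change] smul.scale_right_distrib)

lemma kd_mult: "kd I (\<lambda>i. r * p i) (\<lambda>i. r * q i) T = smul r (kd I p q T)"
  by (simp add: kd_def smul.scale_sum_right smul.scale_right_distrib)

lemma kd_cong: "(\<And>i. i \<in> I \<Longrightarrow> p i = p' i \<and> q i = q' i) \<Longrightarrow> kd I p q T = kd I p' q' T"
  by (simp add: kd_def)

lemma realizes_shift:
  assumes "realizes nm o' I V p q X"
  shows "realizes nm (\<not> o') I V (\<lambda>i. - p i) (\<lambda>i. - q i) (shift X)"
proof -
  obtain m sg T where r: "realizes_by nm o' I V p q X m sg T" and c: "curved nm I V p q X"
    using assms by (auto simp: realizes_def)
  have kd: "kd I (\<lambda>i. - p i) (\<lambda>i. - q i) T = - kd I p q T" for T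
    using kd_mult[of I "-1" p q T] by simp
  have b: "bvars (shift X) = bvars X" by (simp add: bvars_def shift_def)
  have "realizes_by nm (\<not> o') I V (\<lambda>i. - p i) (\<lambda>i. - q i) (shift X) m sg T"
    using r unfolding realizes_by_def elems_eq b by (auto simp: shift_def kd flat_minus fmod_minus)
  moreover have "curved nm I V (\<lambda>i. - p i) (\<lambda>i. - q i) (shift X)"
    using c unfolding curved_def b by (simp add: shift_def)
  ultimately show ?thesis unfolding realizes_def by blast
qed

lemma realizes_shift_pow:
  fixes p :: "nat \<Rightarrow> ('v, 'k::field_char_0) mpoly"
  assumes "realizes nm False I V p q X"
  shows "realizes nm (odd k) I V (\<lambda>i. ksign (odd k) * p i) (\<lambda>i. ksign (odd k) * q i) (shift_pow k X)"
proof (induction k)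
  case 0
  then show ?case using assms by (simp add: shift_pow_def ksign_def)
next
  case (Suc k)
  have "- (ksign (odd k) * r) = ksign (odd (Suc k)) * r" for r :: "('v, 'k) mpoly"
    by (simp add: ksign_def)
  with realizes_shift[OF Suc] show ?case by (simp add: shift_pow_def)
qed

lemma shift_pow_src_tgt [simp]: "src (shift_pow k X) = src X" "tgt (shift_pow k X) = tgt X"
  "basis (shift_pow k X) = basis X"
  by (induction k) (simp_all add: shift_pow_def shift_def)

lemma shift_pow_double: "shift_pow (k + k) X = X"
proof -
  have "shift (shift X) = X" by (simp add: shift_def)
  then have "(shift ^^ (2 * k)) X = X"
    by (induction k) (simp_all add: numeral_2_eq_2)
  then show ?thesis by (simp add: shift_pow_def mult_2)
qed

text \<open>Invariance under renaming the basis; it serves to move a finite basis into the natural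
  numbers and to add a zero summand.\<close>

lemma realizes_transport:
  assumes "realizes nm o' I V p q X" "src X' = src X" "tgt X' = tgt X"
    and g: "bij_betw g (basis X) (basis X')"
    and X': "\<And>b. b \<in> basis X \<Longrightarrow> par X' (g b) = par X b \<and> dcol X' (g b) = base_change g id (dcol X b)"
  shows "realizes nm o' I V p q X'"
proof -
  obtain m sg T where r: "realizes_by nm o' I V p q X m sg T" and c: "curved nm I V p q X"
    using assms by (auto simp: realizes_def)
  define h where "h = inv_into (basis X) g"
  have hg: "h (g b) = b" if "b \<in> basis X" for b
    unfolding h_def using g that by (auto simp: bij_betw_def)
  have h: "bij_betw h (basis X') (basis X)" unfolding h_def by (rule bij_betw_inv_into[OF g])
  have b: "bvars X' = bvars X" using assms by (simp add: bvars_def)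
  have fl: "flat nm (m \<circ> h) (sg \<circ> h) (T \<circ> h) (base_change g id v) = flat nm m sg T v"
    if "keys v \<subseteq> basis X" for v
    by (rule additive_eqI[where v = v])
       (use that in \<open>auto simp: additive_def flat_add additive.add[OF additive_base_change] hg subset_iff\<close>)
  have "realizes_by nm o' I V p q X' (m \<circ> h) (sg \<circ> h) (T \<circ> h)"
    unfolding realizes_by_def
  proof (intro conjI ballI)
    show "bij_betw (\<lambda>b. ((m \<circ> h) b, (T \<circ> h) b)) (basis X') (mons V \<times> Pow I)"
      using bij_betw_trans[OF h] r by (auto simp: realizes_by_def comp_def[abs_def] o_def)
    fix b' assume "b' \<in> basis X'"
    then obtain b where b': "b' = g b" "b \<in> basis X" using g by (auto simp: bij_betw_def)
    have d: "dcol X b \<in> fmod (basis X) (bvars X)" using r b' by (auto simp: realizes_by_def elems_eq)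
    show "par X' b' = (odd (card ((T \<circ> h) b')) \<noteq> o')"
      using b' r X' by (auto simp: realizes_by_def hg)
    show "dcol X' b' \<in> elems X'"
      using b' X' g base_change_fmod[OF d, of g "basis X'" id "bvars X"] by (auto simp: elems_eq b bij_betw_def)
    show "flat nm (m \<circ> h) (sg \<circ> h) (T \<circ> h) (dcol X' b') =
        smul (single ((m \<circ> h) b') (ksign ((sg \<circ> h) b'))) (kd I p q ((T \<circ> h) b'))"
      using b' X' r d fl[of "dcol X b"] by (auto simp: realizes_by_def hg fmod_def)
  qed
  moreover have "curved nm I V p q X'" using c assms b by (simp add: curved_def)
  ultimately show ?thesis unfolding realizes_def by blast
qed


subsection \<open>Units and relabelling\<close>

lemma rename_theta_sign [simp]: "rename nm (theta_sign i T) = theta_sign i T"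
  by (simp add: theta_sign_def minus_one_power_iff rename_minus)

lemma theta_sign_shift: "theta_sign (lo + i) ((+) lo ` T) = theta_sign i T"
proof -
  have "{j \<in> (+) lo ` T. j < lo + i} = (+) lo ` {j \<in> T. j < i}" by auto
  then show ?thesis by (simp add: theta_sign_def card_image)
qed

lemma sum_shift_nat: "(\<Sum>\<theta>\<in>{lo..<lo + n}. F \<theta>) = (\<Sum>i<n. F (lo + i))" for lo n :: nat
  by (rule sum.reindex_bij_witness[of _ "\<lambda>i. lo + i" "\<lambda>\<theta>. \<theta> - lo"]) auto

lemma mons_empty [simp]: "mons {} = {0}"
  by (auto simp: mons_def)

text \<open>Adding \<open>lo\<close> preserves the order of the generators, so no sign changes. The
  coefficients are prescribed on one block only, so that a single pair \<open>p\<close>,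
  \<open>q\<close> can serve all factors of a composite.\<close>

lemma realizes_unit:
  fixes p :: "nat \<Rightarrow> ('v, 'k::field_char_0) mpoly"
  assumes hi: "hi = lo + fst A" and W: "snd A \<in> polys {..<fst A}"
    and pq: "\<And>i. i < fst A \<Longrightarrow> p (lo + i) = rename nm (diff_quot i (snd A))"
      "\<And>i. i < fst A \<Longrightarrow> q (lo + i) = var (nm (Tgt i)) - var (nm (Src i))"
  shows "realizes nm False {lo..<hi} {} p q (unit1 A)"
proof -
  let ?n = "fst A" and ?X = "unit1 A"
  let ?f = "flat nm (\<lambda>_. 0) (\<lambda>_. False) (\<lambda>T. (+) lo ` T)"
  have bv: "bvars ?X = Src ` {..<?n} \<union> Tgt ` {..<?n}" by (simp add: bvars_def unit1_def)
  have d: "dcol ?X = kd {..<?n} (\<lambda>i. diff_quot i (snd A)) (\<lambda>i. var (Tgt i) - var (Src i))"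
    by (simp add: unit1_def kd_def fun_eq_iff)
  have el: "dcol ?X T \<in> elems ?X" if "T \<subseteq> {..<?n}" for T
    unfolding d elems_eq bv
    by (rule pmod_fmod, simp add: unit1_def, rule kd_pmod[OF _ that])
       (auto simp: diff_quot(2)[OF W] intro!: polys_diff polys_var)
  have w: "?f (wedge i T) = wedge (lo + i) ((+) lo ` T)" for i T
    by (auto simp: wedge_def theta_sign_shift ksign_def)
  have c: "?f (contract i T) = contract (lo + i) ((+) lo ` T)" for i T
  proof -
    have "(+) lo ` (T - {i}) = (+) lo ` T - {lo + i}" by auto
    then show ?thesis by (auto simp: contract_def theta_sign_shift ksign_def)
  qed
  have fl: "?f (dcol ?X T) = kd {lo..<lo + ?n} p q ((+) lo ` T)" for T
    unfolding d kd_def sum_shift_nat flat_sum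
    by (rule sum.cong) (auto simp: flat_add flat_smul w c pq rename_diff)
  have bij: "bij_betw (\<lambda>T. (0 :: 'v mon, (+) lo ` T)) (Pow {..<?n}) (mons {} \<times> Pow {lo..<lo + ?n})"
  proof (rule bij_betwI')
    fix y assume "y \<in> mons {} \<times> Pow {lo..<lo + ?n}"
    then obtain S where S: "y = (0, S)" "S \<subseteq> {lo..<lo + ?n}" by (cases y) auto
    have "(+) lo ` ((\<lambda>j. j - lo) ` S) = S"
      using S by (force simp: image_iff)
    then show "\<exists>x\<in>Pow {..<?n}. y = (0, (+) lo ` x)"
      using S by (intro bexI[of _ "(\<lambda>j. j - lo) ` S"]) (auto dest!: subsetD)
  qed (auto simp: inj_image_eq_iff)
  have "realizes_by nm False {lo..<lo + ?n} {} p q ?X (\<lambda>_. 0) (\<lambda>_. False) (\<lambda>T. (+) lo ` T)"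
    unfolding realizes_by_def
    using bij el fl by (auto simp: unit1_def card_image ksign_def)
  moreover have "curved nm {lo..<lo + ?n} {} p q ?X"
    unfolding curved_def
  proof (intro conjI ballI)
    fix \<theta> assume "\<theta> \<in> {lo..<lo + ?n}"
    then obtain i where i: "\<theta> = lo + i" "i < ?n" by (metis atLeastLessThan_iff le_add_diff_inverse nat_add_left_cancel_less)
    show "p \<theta> \<in> polys ({} \<union> nm ` bvars ?X)"
      unfolding i pq(1)[OF i(2)] bv by (rule rename_polys[OF diff_quot(2)[OF W i(2)]]) auto
    show "q \<theta> \<in> polys ({} \<union> nm ` bvars ?X)"
      unfolding i pq(2)[OF i(2)] bv using i by (intro polys_diff polys_var) auto
  next
    have "(\<Sum>\<theta>\<in>{lo..<lo + ?n}. p \<theta> * q \<theta>) =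
        rename nm (\<Sum>i<?n. diff_quot i (snd A) * (var (Tgt i) - var (Src i)))"
      unfolding sum_shift_nat rename_sum by (rule sum.cong) (auto simp: pq rename_mult rename_diff)
    also have "\<dots> = rename (nm \<circ> Tgt) (snd A) - rename (nm \<circ> Src) (snd A)"
      unfolding sum_diff_quot[OF W] by (simp add: rename_diff rename_comp)
    finally show "(\<Sum>\<theta>\<in>{lo..<lo + ?n}. p \<theta> * q \<theta>) =
        rename (nm \<circ> Tgt) (snd (tgt ?X)) - rename (nm \<circ> Src) (snd (src ?X))"
      by (simp add: unit1_def)
  qed
  ultimately show ?thesis unfolding realizes_def hi by blast
qed

lemma flat_rename: "flat nm m sg T (base_change id (rename \<sigma>) v) = flat (nm \<circ> \<sigma>) m sg T v"
  by (rule additive_eqI[where v = v])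
     (auto simp: additive_def flat_add additive.add[OF additive_base_change[OF additive_rename]] rename_comp o_def)

lemma realizes_relabel:
  assumes "realizes (nm \<circ> \<sigma>) o' I V p q X"
    and \<sigma>: "\<sigma> ` bvars X \<subseteq> Src ` {..<fst A} \<union> Tgt ` {..<fst B}"
    and curv: "rename (nm \<circ> Tgt) (snd B) - rename (nm \<circ> Src) (snd A) =
      rename (nm \<circ> \<sigma> \<circ> Tgt) (snd (tgt X)) - rename (nm \<circ> \<sigma> \<circ> Src) (snd (src X))"
  shows "realizes nm o' I V p q (relabel A B \<sigma> X)"
proof -
  let ?Y = "relabel A B \<sigma> X"
  obtain m sg T where r: "realizes_by (nm \<circ> \<sigma>) o' I V p q X m sg T" and c: "curved (nm \<circ> \<sigma>) I V p q X"
    using assms by (auto simp: realizes_def)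
  have b: "\<sigma> ` bvars X \<subseteq> bvars ?Y" using \<sigma> by (simp add: bvars_def relabel_def)
  have el: "base_change id (rename \<sigma>) v \<in> fmod (basis X) (bvars ?Y)" if "v \<in> fmod (basis X) (bvars X)" for v
    by (rule base_change_fmod[OF that]) (use rename_polys[OF _ b] in auto)
  have "realizes_by nm o' I V p q ?Y m sg T"
    using r el unfolding realizes_by_def elems_eq
    by (auto simp: relabel_def flat_rename)
  moreover have "curved nm I V p q ?Y"
  proof -
    have "V \<union> (nm \<circ> \<sigma>) ` bvars X \<subseteq> V \<union> nm ` bvars ?Y" using b by auto
    from polys_mono[OF this] show ?thesis
      using c curv unfolding curved_def by (auto simp: relabel_def)
  qed
  ultimately show ?thesis unfolding realizes_def by blast
qed


subsection \<open>Duals\<close>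

text \<open>The parity of \<open>k (k - 1) / 2\<close>, which is the sign of reversing a product of
  \<open>k\<close> exterior generators.\<close>

fun eta :: "nat \<Rightarrow> bool" where
  "eta 0 = False"
| "eta (Suc k) = (eta k \<noteq> odd k)"

lemma lookup_wedge: "lookup (wedge i T) S = (if i \<notin> T \<and> S = insert i T then theta_sign i T else 0)"
  by (auto simp: wedge_def lookup_single when_def)

lemma lookup_contract: "lookup (contract i T) S = (if i \<in> T \<and> S = T - {i} then theta_sign i T else 0)"
  by (auto simp: contract_def lookup_single when_def)

text \<open>The sign of \<open>i\<close> counts elements strictly below \<open>i\<close>, hence is
  the same with and without \<open>i\<close> in the set.\<close>

lemma lookup_wedge_transpose: "lookup (wedge i S) T = lookup (contract i T) S"
  by (auto simp: lookup_wedge lookup_contract theta_sign_remove insert_absorb theta_sign_insert)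

lemma lookup_flat:
  assumes "inj_on T B" "keys v \<subseteq> B" "b \<in> B"
  shows "lookup (flat nm m sg T v) (T b) = rename nm (lookup v b) * single (m b) (ksign (sg b))"
proof -
  have "lookup (flat nm m sg T v) (T b) =
      (\<Sum>c\<in>keys v. if c = b then rename nm (lookup v c) * single (m c) (ksign (sg c)) else 0)"
    unfolding flat_def lookup_sum
    by (rule sum.cong) (use assms in \<open>auto simp: lookup_single when_def dest: inj_onD\<close>)
  also have "\<dots> = rename nm (lookup v b) * single (m b) (ksign (sg b))" by (auto simp: sum.delta in_keys_iff)
  finally show ?thesis .
qed

lemma single_ksign [simp]: "single 0 (ksign e) = ksign e"
  by (simp add: ksign_def single_uminus)

lemma ksign_mult: "ksign a * ksign b = ksign (a \<noteq> b)"
  by (simp add: ksign_def)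

text \<open>Transposing exchanges multiplication and contraction.  The signs \<open>eta\<close> absorb the factor
  \<open>(-1)\<^sup>|\<^sup>b\<^sup>|\<^sup>+\<^sup>1\<close> in the differential of the dual, up to one global sign on one of the two parts.\<close>

lemma realizes_vee:
  fixes p :: "nat \<Rightarrow> ('v, 'k::field_char_0) mpoly"
  assumes "realizes (nm \<circ> swap_bvar) False I {} p q X" and fin: "finite I"
  shows "realizes nm False I {} (\<lambda>i. - q i) p (vee X)"
proof -
  let ?Y = "vee X"
  obtain m sg T where r: "realizes_by (nm \<circ> swap_bvar) False I {} p q X m sg T"
    and c: "curved (nm \<circ> swap_bvar) I {} p q X"
    using assms by (auto simp: realizes_def)
  have bij: "bij_betw (\<lambda>b. (m b, T b)) (basis X) ({0} \<times> Pow I)"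
    using r by (simp add: realizes_by_def)
  have m0: "m b = 0" if "b \<in> basis X" for b using bij_betwE[OF bij] that by auto
  have bijT: "bij_betw T (basis X) (Pow I)"
  proof -
    have "bij_betw snd ({0 :: 'v mon} \<times> Pow I) (Pow I)" by (auto simp: bij_betw_def inj_on_def)
    from bij_betw_trans[OF bij this] show ?thesis by (simp add: comp_def[abs_def] o_def)
  qed
  have fb: "finite (basis X)" using bij_betw_finite[OF bijT] fin by simp
  have b: "bvars ?Y = swap_bvar ` bvars X" "(nm \<circ> swap_bvar) ` bvars X = nm ` bvars ?Y"
    by (auto simp: bvars_def vee_def image_Un image_image)
  have sw: "swap_bvar \<circ> Tgt = Src" "swap_bvar \<circ> Src = Tgt" by auto
  have L: "rename (nm \<circ> swap_bvar) (lookup (dcol X b') b) =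
      ksign (sg b) * ksign (sg b') * lookup (kd I p q (T b')) (T b)"
    if "b \<in> basis X" "b' \<in> basis X" for b b'
  proof -
    have "lookup (flat (nm \<circ> swap_bvar) m sg T (dcol X b')) (T b) =
        rename (nm \<circ> swap_bvar) (lookup (dcol X b') b) * ksign (sg b)"
      using that r m0 by (subst lookup_flat[of T "basis X"]) (use bijT in \<open>auto simp: realizes_by_def elems_eq fmod_def bij_betw_def\<close>)
    moreover have "lookup (flat (nm \<circ> swap_bvar) m sg T (dcol X b')) (T b) =
        ksign (sg b') * lookup (kd I p q (T b')) (T b)"
      using that r m0 by (simp add: realizes_by_def)
    ultimately have "ksign (sg b) * (rename (nm \<circ> swap_bvar) (lookup (dcol X b') b) * ksign (sg b)) =
        ksign (sg b) * (ksign (sg b') * lookup (kd I p q (T b')) (T b))" by simp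
    then show ?thesis by (simp add: mult.commute mult.left_commute mult.assoc)
  qed
  define sg' where "sg' b = (sg b \<noteq> eta (card (T b)))" for b
  \<comment> \<open>Entries are nonzero only between neighbouring cardinalities. When an index is
    removed, the change of \<open>eta\<close> cancels the sign of the dual differential; when one is
    added, a factor -1 is left, which moves into \<open>- q i\<close>.\<close>
  have key: "ksign (even (card S)) * ksign (eta (card S')) * lookup (kd I p q S') S =
      ksign (eta (card S)) * lookup (kd I (\<lambda>i. - q i) p S) S'" if "finite S" "finite S'" for S S'
  proof -
    have "ksign (even (card S)) * ksign (eta (card S')) *
        (p i * lookup (wedge i S') S + q i * lookup (contract i S') S) =
        ksign (eta (card S)) * (- q i * lookup (wedge i S) S' + p i * lookup (contract i S) S')" for i
    proof -
      have 1: "ksign (even (card S)) * ksign (eta (card S')) * lookup (contract i S) S' =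
          (ksign (eta (card S)) * lookup (contract i S) S' :: ('v, 'k) mpoly)"
      proof (cases "i \<in> S \<and> S' = S - {i}")
        case True
        then have "card S = Suc (card S')" using that by (metis card_Suc_Diff1)
        then show ?thesis by (simp add: ksign_mult) (simp add: ksign_def)
      qed (simp only: lookup_contract if_False mult_zero_right)
      have 2: "ksign (even (card S)) * ksign (eta (card S')) * lookup (wedge i S) S' =
          (- ksign (eta (card S)) * lookup (wedge i S) S' :: ('v, 'k) mpoly)"
      proof (cases "i \<notin> S \<and> S' = insert i S")
        case True
        then have "card S' = Suc (card S)" using that by simp
        then show ?thesis by (simp add: ksign_def)
      qed (auto simp: lookup_wedge)
      show ?thesis
        unfolding lookup_wedge_transpose[of i S' S] lookup_wedge_transpose[of i S S', symmetric]
        using arg_cong[OF 1, of "\<lambda>x. p i * x"] arg_cong[OF 2, of "\<lambda>x. q i * x"]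
        by (simp add: algebra_simps)
    qed
    then show ?thesis unfolding kd_def lookup_sum sum_distrib_left by (simp add: lookup_add lookup_minus)
  qed
  have kd_keys: "lookup (kd I p' q' S) S' = 0" if "S \<subseteq> I" "\<not> S' \<subseteq> I" for S S' and p' q' :: "nat \<Rightarrow> ('v, 'k) mpoly"
    using kd_pmod[OF fin that(1), of p' UNIV q' False] that(2) by (auto simp: pmod_iff)
  have fl: "flat nm m sg' T (dcol ?Y b) = smul (single (m b) (ksign (sg' b))) (kd I (\<lambda>i. - q i) p (T b))"
    if bb: "b \<in> basis X" for b
  proof -
    have Tb: "T b \<subseteq> I" using bij_betwE[OF bijT] bb by auto
    have pb: "par X b = odd (card (T b))" using r bb by (simp add: realizes_by_def)
    have "flat nm m sg' T (dcol ?Y b) = (\<Sum>b'\<in>basis X. single (T b')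
        (ksign (\<not> par X b) * rename (nm \<circ> swap_bvar) (lookup (dcol X b') b) * ksign (sg' b')))"
      by (simp add: vee_def flat_sum rename_mult rename_comp m0 cong: sum.cong)
    also have "\<dots> = (\<Sum>b'\<in>basis X. single (T b') (ksign (sg b) *
        (ksign (even (card (T b))) * ksign (eta (card (T b'))) * lookup (kd I p q (T b')) (T b))))"
    proof (rule sum.cong[OF refl])
      fix b' assume b': "b' \<in> basis X"
      have "ksign (sg' b') = (ksign (sg b') * ksign (eta (card (T b'))) :: ('v, 'k) mpoly)"
        by (simp add: sg'_def ksign_mult)
      then show "single (T b') (ksign (\<not> par X b) * rename (nm \<circ> swap_bvar) (lookup (dcol X b') b) * ksign (sg' b')) =
          single (T b') (ksign (sg b) *
            (ksign (even (card (T b))) * ksign (eta (card (T b'))) * lookup (kd I p q (T b')) (T b)))"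
        by (simp add: L[OF bb b'] pb mult.commute mult.left_commute mult.assoc)
    qed
    also have "\<dots> = (\<Sum>S\<in>Pow I. single S (ksign (sg b) *
        (ksign (even (card (T b))) * ksign (eta (card S)) * lookup (kd I p q S) (T b))))"
      by (rule sum.reindex_bij_betw[OF bijT])
    also have "\<dots> = (\<Sum>S\<in>Pow I. single S (ksign (sg b) *
        (ksign (eta (card (T b))) * lookup (kd I (\<lambda>i. - q i) p (T b)) S)))"
      using Tb fin by (intro sum.cong refl) (auto simp: key finite_subset)
    also have "\<dots> = (\<Sum>S\<in>Pow I. single S (lookup (smul (ksign (sg' b)) (kd I (\<lambda>i. - q i) p (T b))) S))"
      by (simp add: sg'_def ksign_mult flip: mult.assoc)
    also have "\<dots> = smul (ksign (sg' b)) (kd I (\<lambda>i. - q i) p (T b))"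
    proof (rule sum_single_superset)
      show "keys (smul (ksign (sg' b)) (kd I (\<lambda>i. - q i) p (T b))) \<subseteq> Pow I"
        using keys_smul kd_keys[OF Tb] by (fastforce simp: in_keys_iff)
    qed (use fin in simp)
    finally show ?thesis by (simp add: m0[OF bb])
  qed
  have el: "dcol ?Y b \<in> elems ?Y" if "b \<in> basis X" for b
  proof -
    have "rename swap_bvar (lookup (dcol X b') b) \<in> polys (bvars ?Y)" if "b' \<in> basis X" for b'
      unfolding b using r that by (intro rename_polys[of _ "bvars X"]) (auto simp: realizes_by_def elems_eq fmod_def)
    then show ?thesis
      unfolding elems_eq by (auto simp: vee_def intro!: fmod_sum fmod_single polys_mult)
  qed
  have "realizes_by nm False I {} (\<lambda>i. - q i) p ?Y m sg' T"
    using r fl el unfolding realizes_by_def by (auto simp: vee_def)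
  moreover have "curved nm I {} (\<lambda>i. - q i) p ?Y"
    using c unfolding curved_def b(2)
    by (simp add: vee_def sum_negf mult.commute comp_assoc sw o_assoc[symmetric])
  ultimately show ?thesis unfolding realizes_def by blast
qed

subsection \<open>Products\<close>

text \<open>Monomials in disjoint sets of variables and subsets of disjoint sets are recovered from
  their product and union by restriction.\<close>

lemma bij_betw_mons_Un:
  assumes f: "bij_betw (\<lambda>b. (m b, T b)) B (mons V \<times> Pow I)"
    and f': "bij_betw (\<lambda>b. (m' b, T' b)) B' (mons V' \<times> Pow I')"
    and disj: "V \<inter> V' = {}" "I \<inter> I' = {}"
  shows "bij_betw (\<lambda>(b, b'). (m b + m' b', T b \<union> T' b')) (B \<times> B') (mons (V \<union> V') \<times> Pow (I \<union> I'))"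
proof (rule bij_betwI')
  have fE: "m b \<in> mons V" "T b \<subseteq> I" if "b \<in> B" for b using bij_betwE[OF f] that by auto
  have fE': "m' b \<in> mons V'" "T' b \<subseteq> I'" if "b \<in> B'" for b using bij_betwE[OF f'] that by auto
  have m1: "restrict_mon V (m b + m' b') = m b" "restrict_mon V' (m b + m' b') = m' b'"
    if "b \<in> B" "b' \<in> B'" for b b'
    using fE(1)[OF that(1)] fE'(1)[OF that(2)] disj(1)
    by (simp_all add: restrict_mon_add restrict_mon_id restrict_mon_disjoint Int_commute)
  have T1: "(T b \<union> T' b') \<inter> I = T b" "(T b \<union> T' b') \<inter> I' = T' b'" if "b \<in> B" "b' \<in> B'" for b b'
    using fE(2)[OF that(1)] fE'(2)[OF that(2)] disj(2) by auto
  fix x y assume "x \<in> B \<times> B'" "y \<in> B \<times> B'"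
  then obtain b b' c c' where xy: "x = (b, b')" "y = (c, c')" "b \<in> B" "b' \<in> B'" "c \<in> B" "c' \<in> B'" by auto
  have "b = c \<and> b' = c'" if eq: "m b + m' b' = m c + m' c'" "T b \<union> T' b' = T c \<union> T' c'"
  proof
    have "m b = m c" "m' b' = m' c'" using m1 xy eq by metis+
    moreover have "T b = T c" "T' b' = T' c'" using T1 xy eq by metis+
    ultimately show "b = c" "b' = c'"
      using f f' xy unfolding bij_betw_def inj_on_def by blast+
  qed
  then show "((case x of (b, b') \<Rightarrow> (m b + m' b', T b \<union> T' b')) = (case y of (b, b') \<Rightarrow> (m b + m' b', T b \<union> T' b'))) = (x = y)"
    using xy by auto
next
  fix x assume "x \<in> B \<times> B'"
  then show "(case x of (b, b') \<Rightarrow> (m b + m' b', T b \<union> T' b')) \<in> mons (V \<union> V') \<times> Pow (I \<union> I')"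
    using bij_betwE[OF f] bij_betwE[OF f'] mons_mono[of V "V \<union> V'"] mons_mono[of V' "V \<union> V'"]
    by fastforce
next
  fix y assume "y \<in> mons (V \<union> V') \<times> Pow (I \<union> I')"
  then obtain M S where y: "y = (M, S)" "M \<in> mons (V \<union> V')" "S \<subseteq> I \<union> I'" by (cases y) auto
  obtain b where b: "b \<in> B" "m b = restrict_mon V M" "T b = S \<inter> I"
  proof -
    have "(restrict_mon V M, S \<inter> I) \<in> (\<lambda>b. (m b, T b)) ` B" using f by (simp add: bij_betw_def)
    then show ?thesis using that by auto
  qed
  obtain b' where b': "b' \<in> B'" "m' b' = restrict_mon V' M" "T' b' = S \<inter> I'"
  proof -
    have "(restrict_mon V' M, S \<inter> I') \<in> (\<lambda>b. (m' b, T' b)) ` B'" using f' by (simp add: bij_betw_def)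
    then show ?thesis using that by auto
  qed
  show "\<exists>x\<in>B \<times> B'. y = (case x of (b, b') \<Rightarrow> (m b + m' b', T b \<union> T' b'))"
    using b b' y restrict_mon_Un[OF y(2) disj(1)] by (intro bexI[of _ "(b, b')"]) auto
qed

lemma ksign_split: "ksign (a \<noteq> b) = ksign a * ksign b" "ksign (a = (\<not> b)) = ksign a * ksign b"
  by (simp_all add: ksign_def)

lemma mult_single_left: "single k a * (single l b * r) = single (k + l) (a * b) * r"
  by (simp add: mult_single flip: mult.assoc)

abbreviation "join_right S \<equiv> base_change (\<lambda>T. T \<union> S) id"
abbreviation "join_left S \<equiv> base_change (\<lambda>T. S \<union> T) id"

lemma additive_base_change_id: "additive (base_change \<beta> id)"
  by (rule additive_base_change) (simp add: additive_def)

lemmas base_change_id_add = additive.add[OF additive_base_change_id]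
    additive.add[OF additive_base_change_id, unfolded id_def]
  and base_change_id_sum = additive.sum[OF additive_base_change_id]
  and base_change_id_zero [simp] = additive.zero[OF additive_base_change_id]

text \<open>\<open>S\<close> lies above \<open>I\<close> and \<open>theta_sign\<close> counts
  smaller indices only, so joining on the right changes no sign.\<close>

lemma join_right_kd:
  assumes "\<And>i j. i \<in> I \<Longrightarrow> j \<in> S \<Longrightarrow> i < j"
  shows "join_right S (kd I p q T) = (\<Sum>i\<in>I. smul (p i) (wedge i (T \<union> S)) + smul (q i) (contract i (T \<union> S)))"
  unfolding kd_def base_change_id_sum
proof (rule sum.cong[OF refl])
  fix i assume i: "i \<in> I"
  have S: "i \<notin> S" "{j \<in> T \<union> S. j < i} = {j \<in> T. j < i}" using assms[OF i] by fastforce+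
  then have "insert i T \<union> S = insert i (T \<union> S)" "T - {i} \<union> S = T \<union> S - {i}" by auto
  moreover have "theta_sign i (T \<union> S) = (theta_sign i T :: 'a)" unfolding theta_sign_def S ..
  ultimately have "join_right S (wedge i T) = (wedge i (T \<union> S) :: nat set \<Rightarrow>\<^sub>0 'a)"
    "join_right S (contract i T) = (contract i (T \<union> S) :: nat set \<Rightarrow>\<^sub>0 'a)"
    using S(1) by (auto simp: wedge_def contract_def)
  then show "join_right S (smul (p i) (wedge i T) + smul (q i) (contract i T)) =
      smul (p i) (wedge i (T \<union> S)) + smul (q i) (contract i (T \<union> S))"
    by (simp add: base_change_id_add base_change_smul)
qed

text \<open>Each index of \<open>S\<close> lies below \<open>I\<close> and is counted once by
  \<open>theta_sign\<close>: the Koszul sign of moving an odd operator past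
  \<open>S\<close>.\<close>

lemma join_left_kd:
  assumes "\<And>i j. i \<in> I \<Longrightarrow> j \<in> S \<Longrightarrow> j < i" "finite S" "S \<inter> T = {}"
  shows "smul (ksign (odd (card S))) (join_left S (kd I p q T)) =
    (\<Sum>i\<in>I. smul (p i) (wedge i (S \<union> T)) + smul (q i) (contract i (S \<union> T)))"
  unfolding kd_def base_change_id_sum smul.scale_sum_right
proof (rule sum.cong[OF refl])
  fix i assume i: "i \<in> I"
  have S: "i \<notin> S" "{j \<in> S \<union> T. j < i} = S \<union> {j \<in> T. j < i}" using assms(1)[OF i] by fastforce+
  have "card (S \<union> {j \<in> T. j < i}) = card S + card {j \<in> T. j < i}"
    using assms by (intro card_Un_disjoint) auto
  then have th: "theta_sign i (S \<union> T) = (ksign (odd (card S)) * theta_sign i T :: 'a)"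
    unfolding theta_sign_def S by (simp add: power_add ksign_def)
  have "S \<union> insert i T = insert i (S \<union> T)" "S \<union> (T - {i}) = S \<union> T - {i}" using S by auto
  then have "smul (ksign (odd (card S))) (join_left S (wedge i T)) = (wedge i (S \<union> T) :: nat set \<Rightarrow>\<^sub>0 'a)"
    "smul (ksign (odd (card S))) (join_left S (contract i T)) = (contract i (S \<union> T) :: nat set \<Rightarrow>\<^sub>0 'a)"
    using S(1) by (auto simp: wedge_def contract_def th)
  then show "smul (ksign (odd (card S))) (join_left S (smul (p i) (wedge i T) + smul (q i) (contract i T))) =
      smul (p i) (wedge i (S \<union> T)) + smul (q i) (contract i (S \<union> T))"
    by (simp add: base_change_id_add base_change_smul smul.scale_right_distrib smul.scale_left_commute
        del: smul.scale_scale)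
qed

text \<open>If the generators of the left factor precede those of the right one, a tensor product of
  Koszul differentials, with its Koszul sign, is again of Koszul form without further corrections.
  This is why factors are numbered from left to right.\<close>

lemma kd_union:
  assumes "finite I" "finite I'" "\<And>i j. i \<in> I \<Longrightarrow> j \<in> I' \<Longrightarrow> i < j" "T \<subseteq> I" "T' \<subseteq> I'"
  shows "join_right T' (kd I p q T) + smul (ksign (odd (card T))) (join_left T (kd I' p q T')) =
    kd (I \<union> I') p q (T \<union> T')"
proof -
  have d: "I \<inter> I' = {}" using assms(3) by force
  have "join_right T' (kd I p q T) = (\<Sum>i\<in>I. smul (p i) (wedge i (T \<union> T')) + smul (q i) (contract i (T \<union> T')))"
    by (rule join_right_kd) (use assms in auto)
  moreover have "smul (ksign (odd (card T))) (join_left T (kd I' p q T')) =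
      (\<Sum>i\<in>I'. smul (p i) (wedge i (T \<union> T')) + smul (q i) (contract i (T \<union> T')))"
    by (rule join_left_kd) (use assms d finite_subset in auto)
  ultimately show ?thesis
    unfolding kd_def by (simp add: sum.union_disjoint[OF assms(1,2) d])
qed

lemma curved_Un:
  fixes I I' :: "nat set"
  assumes "(\<Sum>i\<in>I. p i * q i) = x" "(\<Sum>i\<in>I'. p i * q i) = (y :: 'a::comm_ring_1)"
    and "finite I" "finite I'" "\<And>i j. i \<in> I \<Longrightarrow> j \<in> I' \<Longrightarrow> i < j"
  shows "(\<Sum>i\<in>I \<union> I'. p i * q i) = x + y"
proof -
  have "i \<notin> I'" if "i \<in> I" for i using assms(5)[OF that, of i] by auto
  then have "I \<inter> I' = {}" by auto
  then show ?thesis using assms(1,2) by (simp add: sum.union_disjoint[OF assms(3,4)])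
qed

lemma realizes_box:
  assumes X: "realizes nm False I V p q X"
    and Y: "realizes (nm \<circ> shift_bvar (fst (src X)) (fst (tgt X))) False I' V' p q Y"
    and fin: "finite I" "finite I'" and less: "\<And>i j. i \<in> I \<Longrightarrow> j \<in> I' \<Longrightarrow> i < j"
    and disj: "V \<inter> V' = {}"
  shows "realizes nm False (I \<union> I') (V \<union> V') p q (X \<box> Y)"
proof -
  let ?sh = "shift_bvar (fst (src X)) (fst (tgt X))"
  let ?Z = "X \<box> Y"
  obtain m sg T where r: "realizes_by nm False I V p q X m sg T" and c: "curved nm I V p q X"
    using X by (auto simp: realizes_def)
  obtain m' sg' T' where r': "realizes_by (nm \<circ> ?sh) False I' V' p q Y m' sg' T'"
    and c': "curved (nm \<circ> ?sh) I' V' p q Y"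
    using Y by (auto simp: realizes_def)
  have bij: "bij_betw (\<lambda>b. (m b, T b)) (basis X) (mons V \<times> Pow I)"
    and bij': "bij_betw (\<lambda>b. (m' b, T' b)) (basis Y) (mons V' \<times> Pow I')"
    using r r' by (auto simp: realizes_by_def)
  have dI: "I \<inter> I' = {}" using less by force
  define M where "M = (\<lambda>(b, c). m b + m' c)"
  define E where "E = (\<lambda>(b, c). sg b \<noteq> sg' c)"
  define S where "S = (\<lambda>(b, c). T b \<union> T' c)"
  have bijZ: "bij_betw (\<lambda>b. (M b, S b)) (basis ?Z) (mons (V \<union> V') \<times> Pow (I \<union> I'))"
    using bij_betw_mons_Un[OF bij bij' disj dI]
    by (simp add: box_def M_def S_def case_prod_unfold)
  have bv: "bvars X \<subseteq> bvars ?Z" "?sh ` bvars Y \<subseteq> bvars ?Z"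
    by (auto simp: bvars_def box_def box_obj_def)
  have TX: "T b \<subseteq> I" "finite (T b)" if "b \<in> basis X" for b
    using bij_betwE[OF bij] that finite_subset[OF _ fin(1)] by auto
  have TY: "T' b \<subseteq> I'" "finite (T' b)" if "b \<in> basis Y" for b
    using bij_betwE[OF bij'] that finite_subset[OF _ fin(2)] by auto
  have fl1: "flat nm M E S (base_change (\<lambda>b'. (b', c)) id v) =
      smul (single (m' c) (ksign (sg' c))) (join_right (T' c) (flat nm m sg T v))" for v c
    by (rule additive_eqI[where v = v])
       (auto simp: additive_def flat_add base_change_id_add smul.scale_right_distrib M_def E_def S_def
          mult_single mult_single_left ksign_split mult_ac add.commute)
  have fl2: "flat nm M E S (base_change (\<lambda>c'. (b, c')) (rename ?sh) u) =
      smul (single (m b) (ksign (sg b))) (join_left (T b) (flat (nm \<circ> ?sh) m' sg' T' u))" for u b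
    by (rule additive_eqI[where v = u])
       (auto simp: additive_def flat_add base_change_id_add additive.add[OF additive_base_change[OF additive_rename]]
          smul.scale_right_distrib M_def E_def S_def rename_comp o_def
          mult_single mult_single_left ksign_split mult_ac add.commute)
  have "realizes_by nm False (I \<union> I') (V \<union> V') p q ?Z M E S"
    unfolding realizes_by_def
  proof (intro conjI ballI bijZ)
    fix z assume "z \<in> basis ?Z"
    then obtain b b' where z: "z = (b, b')" "b \<in> basis X" "b' \<in> basis Y" by (auto simp: box_def)
    have d: "par X b = odd (card (T b))" "dcol X b \<in> fmod (basis X) (bvars X)"
      "flat nm m sg T (dcol X b) = smul (single (m b) (ksign (sg b))) (kd I p q (T b))"
      using r z by (auto simp: realizes_by_def elems_eq)
    have d': "par Y b' = odd (card (T' b'))" "dcol Y b' \<in> fmod (basis Y) (bvars Y)"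
      "flat (nm \<circ> ?sh) m' sg' T' (dcol Y b') = smul (single (m' b') (ksign (sg' b'))) (kd I' p q (T' b'))"
      using r' z by (auto simp: realizes_by_def elems_eq)
    have "card (T b \<union> T' b') = card (T b) + card (T' b')"
      using TX[OF z(2)] TY[OF z(3)] dI by (intro card_Un_disjoint) auto
    then show "par ?Z z = (odd (card (S z)) \<noteq> False)"
      using z d d' by (simp add: box_def S_def)
    show "dcol ?Z z \<in> elems ?Z"
    proof -
      have "base_change (\<lambda>c. (c, b')) id (dcol X b) \<in> fmod (basis ?Z) (bvars ?Z)"
        by (rule base_change_fmod[OF d(2)]) (use z polys_mono[OF bv(1)] in \<open>auto simp: box_def\<close>)
      moreover have "base_change (\<lambda>c. (b, c)) (rename ?sh) (dcol Y b') \<in> fmod (basis ?Z) (bvars ?Z)"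
        by (rule base_change_fmod[OF d'(2)]) (use z rename_polys[OF _ bv(2)] in \<open>auto simp: box_def\<close>)
      ultimately show ?thesis
        unfolding elems_eq using z
        by (auto simp: box_def intro!: fmod_add fmod_smul)
    qed
    have "flat nm M E S (dcol ?Z z) =
        smul (single (m' b') (ksign (sg' b')) * single (m b) (ksign (sg b)))
          (join_right (T' b') (kd I p q (T b)) + smul (ksign (odd (card (T b)))) (join_left (T b) (kd I' p q (T' b'))))"
      using z by (simp add: box_def flat_add flat_smul fl1 fl2 d d' base_change_smul
          smul.scale_right_distrib mult_ac)
    also have "\<dots> = smul (single (M z) (ksign (E z))) (kd (I \<union> I') p q (S z))"
      using TX[OF z(2)] TY[OF z(3)] fin less
      by (subst kd_union) (auto simp: z M_def E_def S_def mult_single ksign_mult add.commute intro!: arg_cong2[where f = smul] arg_cong2[where f = single] arg_cong[where f = ksign])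
    finally show "flat nm M E S (dcol ?Z z) = smul (single (M z) (ksign (E z))) (kd (I \<union> I') p q (S z))" .
  qed
  moreover have "curved nm (I \<union> I') (V \<union> V') p q ?Z"
  proof -
    have sub: "V \<union> nm ` bvars X \<subseteq> V \<union> V' \<union> nm ` bvars ?Z"
      "V' \<union> (nm \<circ> ?sh) ` bvars Y \<subseteq> V \<union> V' \<union> nm ` bvars ?Z"
      using bv by auto
    have sh: "nm \<circ> Tgt \<circ> (\<lambda>i. fst (tgt X) + i) = nm \<circ> ?sh \<circ> Tgt" "nm \<circ> Src \<circ> (\<lambda>i. fst (src X) + i) = nm \<circ> ?sh \<circ> Src"
      by auto
    have "(\<Sum>i\<in>I \<union> I'. p i * q i) =
        (rename (nm \<circ> Tgt) (snd (tgt X)) - rename (nm \<circ> Src) (snd (src X))) +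
        (rename (nm \<circ> ?sh \<circ> Tgt) (snd (tgt Y)) - rename (nm \<circ> ?sh \<circ> Src) (snd (src Y)))"
      by (rule curved_Un) (use c c' fin less in \<open>auto simp: curved_def\<close>)
    then show ?thesis
      using c c' polys_mono[OF sub(1)] polys_mono[OF sub(2)] unfolding curved_def
      by (auto simp: box_def box_obj_def rename_add rename_comp sh)
  qed
  ultimately show ?thesis unfolding realizes_def by blast
qed


subsection \<open>Horizontal composites\<close>

lemma y_part_single [simp]:
  "y_part (single (XV i) k) = 0" "y_part (single (YV i) k) = single i k" "y_part (single (ZV i) k) = 0"
  by (cases "k = 0"; simp add: y_part_def)+

lemma xz_part_single [simp]:
  "xz_part (single (XV i) k) = single (Src i) k" "xz_part (single (YV i) k) = 0"
  "xz_part (single (ZV i) k) = single (Tgt i) k"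
  by (cases "k = 0"; simp add: xz_part_def)+

lemma y_part_zero [simp]: "y_part 0 = 0" and xz_part_zero [simp]: "xz_part 0 = 0"
  by (simp_all add: y_part_def xz_part_def)

lemma y_part_add: "y_part (m + m') = y_part m + y_part m'"
  unfolding y_part_def by (rule sum_keys_add) (auto simp: single_add split: tvar.splits)

lemma xz_part_add: "xz_part (m + m') = xz_part m + xz_part m'"
  unfolding xz_part_def by (rule sum_keys_add) (auto simp: single_add split: tvar.splits)

lemma additive_y_coeffs: "additive y_coeffs"
  unfolding y_coeffs_def by (rule additiveI_sum_keys) (auto simp: additive_def single_add)

lemma y_coeffs_single [simp]: "y_coeffs (single M c) = single (y_part M) (single (xz_part M) c)"
  unfolding y_coeffs_def by (subst sum_keys_single) auto

text \<open>Renaming the two parts separately and multiplying is the combined renaming; thus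
  flattening undoes the extraction of coefficients by \<open>y_coeffs\<close>.\<close>

lemma rename_mon_tvar:
  "rename_mon (case_bvar \<alpha> \<gamma>) (xz_part M) + rename_mon \<tau> (y_part M) = rename_mon (case_tvar \<alpha> \<tau> \<gamma>) M"
proof (induction M rule: poly_mapping_add_induct)
  case (single v k)
  then show ?case by (cases v) auto
next
  case (add u v)
  then show ?case
    by (simp add: y_part_add xz_part_add rename_mon_add) (metis (no_types) add.assoc add.commute)
qed simp

lemma mons_tvar:
  assumes "M \<in> mons (xy_var ` (Src ` A \<union> Tgt ` K) \<union> yz_var ` (Src ` K \<union> Tgt ` C))"
  shows "y_part M \<in> mons K" "xz_part M \<in> mons (Src ` A \<union> Tgt ` C)"
proof -
  have keys: "v \<in> XV ` A \<union> YV ` K \<union> ZV ` C" if "v \<in> keys M" for v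
    using assms that by (auto simp: mons_def image_Un image_image)
  have sum: "(\<And>i. i \<in> I \<Longrightarrow> f i \<in> mons D) \<Longrightarrow> (\<Sum>i\<in>I. f i) \<in> mons D" for f :: "tvar \<Rightarrow> 'x mon" and I D
    by (induction I rule: infinite_finite_induct) auto
  show "y_part M \<in> mons K" unfolding y_part_def
    by (rule sum) (use keys in \<open>force split: tvar.splits\<close>)
  show "xz_part M \<in> mons (Src ` A \<union> Tgt ` C)" unfolding xz_part_def
    by (rule sum) (use keys in \<open>force split: tvar.splits\<close>)
qed

lemma additive_tens:
  fixes v :: "'c \<Rightarrow>\<^sub>0 (bvar, 'k::field_char_0) mpoly" and u :: "'b \<Rightarrow>\<^sub>0 (bvar, 'k) mpoly"
  shows "additive (\<lambda>v :: 'c \<Rightarrow>\<^sub>0 (bvar, 'k) mpoly. tens v u)"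
    and "additive (\<lambda>u :: 'b \<Rightarrow>\<^sub>0 (bvar, 'k) mpoly. tens v u)"
proof -
  have ad: "additive (\<lambda>P :: (tvar, 'k) mpoly. base_change (\<lambda>\<mu>. (c, \<mu>, b)) id (y_coeffs P))"
    for c :: 'c and b :: 'b
    by (rule additive_comp[OF additive_base_change_id additive_y_coeffs])
  note ad = ad ad[unfolded id_def]
  show "additive (\<lambda>v :: 'c \<Rightarrow>\<^sub>0 (bvar, 'k) mpoly. tens v u)"
    unfolding tens_def
    by (rule additiveI_sum_keys, rule additive_sum)
       (simp add: additive_def rename_add distrib_right additive.add[OF ad(1)] additive.add[OF ad(2)])
  have "additive (\<lambda>u :: 'b \<Rightarrow>\<^sub>0 (bvar, 'k) mpoly. \<Sum>b\<in>keys u. base_change (\<lambda>\<mu>. (c, \<mu>, b)) id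
      (y_coeffs (rename yz_var (lookup v c) * rename xy_var (lookup u b))))" for c
    by (rule additiveI_sum_keys) (simp add: additive_def rename_add distrib_left additive.add[OF ad(1)] additive.add[OF ad(2)])
  then show "additive (\<lambda>u :: 'b \<Rightarrow>\<^sub>0 (bvar, 'k) mpoly. tens v u)"
    unfolding tens_def by (intro additive_sum)
qed

lemma tens_single:
  "tens (single c r) (single b s) = base_change (\<lambda>\<mu>. (c, \<mu>, b)) id (y_coeffs (rename yz_var r * rename xy_var s))"
  unfolding tens_def by (auto simp: additive.zero[OF additive_y_coeffs])

lemma y_coeffs_fmod:
  assumes "P \<in> polys (xy_var ` (Src ` A \<union> Tgt ` K) \<union> yz_var ` (Src ` K \<union> Tgt ` C))"
  shows "y_coeffs P \<in> fmod (mons K) (Src ` A \<union> Tgt ` C)"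
  unfolding y_coeffs_def
  using assms by (intro fmod_sum fmod_single polys_single mons_tvar) (auto simp: polys_iff)

lemma tens_elems:
  assumes "v \<in> elems Y" "u \<in> elems X" "fst (src Y) = fst (tgt X)"
  shows "tens v u \<in> elems (Y \<odot> X)"
proof -
  let ?A = "{..<fst (src X)}" and ?K = "{..<fst (tgt X)}" and ?C = "{..<fst (tgt Y)}"
  let ?S = "xy_var ` (Src ` ?A \<union> Tgt ` ?K) \<union> yz_var ` (Src ` ?K \<union> Tgt ` ?C)"
  have bv: "bvars X = Src ` ?A \<union> Tgt ` ?K" "bvars Y = Src ` ?K \<union> Tgt ` ?C" "bvars (Y \<odot> X) = Src ` ?A \<union> Tgt ` ?C"
    using assms(3) by (auto simp: bvars_def comp_def)
  show ?thesis
    unfolding elems_eq tens_def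
  proof (intro fmod_sum)
    fix c b assume cb: "c \<in> keys v" "b \<in> keys u"
    have "rename yz_var (lookup v c) \<in> polys ?S"
      by (rule rename_polys[of _ "bvars Y"]) (use assms in \<open>auto simp: elems_eq fmod_def bv\<close>)
    moreover have "rename xy_var (lookup u b) \<in> polys ?S"
      by (rule rename_polys[of _ "bvars X"]) (use assms in \<open>auto simp: elems_eq fmod_def bv\<close>)
    ultimately have "y_coeffs (rename yz_var (lookup v c) * rename xy_var (lookup u b)) \<in> fmod (mons ?K) (bvars (Y \<odot> X))"
      unfolding bv by (intro y_coeffs_fmod polys_mult)
    then show "base_change (\<lambda>\<mu>. (c, \<mu>, b)) id
        (y_coeffs (rename yz_var (lookup v c) * rename xy_var (lookup u b))) \<in> fmod (basis (Y \<odot> X)) (bvars (Y \<odot> X))"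
      by (rule base_change_fmod) (use assms cb in \<open>auto simp: elems_eq fmod_def comp_def mons_def\<close>)
  qed
qed

lemma bij_betw_rename_mon:
  assumes "inj_on \<tau> K"
  shows "bij_betw (rename_mon \<tau>) (mons K) (mons (\<tau> ` K))"
  by (rule bij_betw_byWitness[where f' = "rename_mon (inv_into K \<tau>)"])
     (use rename_mon_inv[OF assms] in \<open>auto intro!: rename_mon_mons simp: inv_into_into\<close>)

text \<open>The middle variables carry the same names \<open>\<tau>\<close> on both sides and become
  internal, as \<open>comp\<close> puts their monomials into the basis. In the sum of the two
  curvatures the potential of the middle object cancels.\<close>

lemma realizes_comp:
  assumes Y: "realizes (case_bvar \<tau> \<gamma>) False I V p q Y"
    and X: "realizes (case_bvar \<alpha> \<tau>) False I' V' p q X"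
    and st: "src Y = tgt X"
    and fin: "finite I" "finite I'" and less: "\<And>i j. i \<in> I \<Longrightarrow> j \<in> I' \<Longrightarrow> i < j"
    and inj: "inj_on \<tau> {..<fst (tgt X)}"
    and disj: "V \<inter> V' = {}" "\<tau> ` {..<fst (tgt X)} \<inter> (V \<union> V') = {}"
  shows "realizes (case_bvar \<alpha> \<gamma>) False (I \<union> I') (V \<union> (\<tau> ` {..<fst (tgt X)} \<union> V')) p q (Y \<odot> X)"
proof -
  let ?Z = "Y \<odot> X" and ?K = "{..<fst (tgt X)}"
  let ?nmY = "case_bvar \<tau> \<gamma>" and ?nmX = "case_bvar \<alpha> \<tau>" and ?nm = "case_bvar \<alpha> \<gamma>" and ?nm3 = "case_tvar \<alpha> \<tau> \<gamma>"
  let ?V = "V \<union> (\<tau> ` ?K \<union> V')"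
  obtain m sg T where r: "realizes_by ?nmY False I V p q Y m sg T" and c: "curved ?nmY I V p q Y"
    using Y by (auto simp: realizes_def)
  obtain m' sg' T' where r': "realizes_by ?nmX False I' V' p q X m' sg' T'"
    and c': "curved ?nmX I' V' p q X"
    using X by (auto simp: realizes_def)
  have bij: "bij_betw (\<lambda>b. (m b, T b)) (basis Y) (mons V \<times> Pow I)"
    and bij': "bij_betw (\<lambda>b. (m' b, T' b)) (basis X) (mons V' \<times> Pow I')"
    using r r' by (auto simp: realizes_by_def)
  have dI: "I \<inter> I' = {}" using less by force
  define M where "M = (\<lambda>(c, \<mu>, b). m c + (rename_mon \<tau> \<mu> + m' b))"
  define E where "E = (\<lambda>(c, \<mu> :: nat mon, b). sg c \<noteq> sg' b)"
  define S where "S = (\<lambda>(c, \<mu> :: nat mon, b). T c \<union> T' b)"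
  have bijZ: "bij_betw (\<lambda>b. (M b, S b)) (basis ?Z) (mons ?V \<times> Pow (I \<union> I'))"
  proof -
    \<comment> \<open>Monomials in the middle variables count as a third factor without exterior
      generators.\<close>
    have 1: "bij_betw (\<lambda>\<mu>. (rename_mon \<tau> \<mu>, {} :: nat set)) (mons ?K) (mons (\<tau> ` ?K) \<times> Pow {})"
      using bij_betw_rename_mon[OF inj] by (auto simp: bij_betw_def inj_on_def)
    have 2: "bij_betw (\<lambda>(\<mu>, b). (rename_mon \<tau> \<mu> + m' b, {} \<union> T' b)) (mons ?K \<times> basis X) (mons (\<tau> ` ?K \<union> V') \<times> Pow ({} \<union> I'))"
      by (rule bij_betw_mons_Un[OF 1 bij']) (use disj in auto)
    then have 3: "bij_betw (\<lambda>b. (rename_mon \<tau> (fst b) + m' (snd b), T' (snd b))) (mons ?K \<times> basis X) (mons (\<tau> ` ?K \<union> V') \<times> Pow I')"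
      by (simp add: case_prod_unfold)
    have "bij_betw (\<lambda>(c, b). (m c + (rename_mon \<tau> (fst b) + m' (snd b)), T c \<union> T' (snd b)))
        (basis Y \<times> (mons ?K \<times> basis X)) (mons ?V \<times> Pow (I \<union> I'))"
      by (rule bij_betw_mons_Un[OF bij 3]) (use disj dI in auto)
    moreover have "basis ?Z = basis Y \<times> (mons ?K \<times> basis X)" by (auto simp: comp_def mons_def)
    ultimately show ?thesis by (simp add: M_def S_def case_prod_unfold)
  qed
  have TY: "T b \<subseteq> I" "finite (T b)" if "b \<in> basis Y" for b
    using bij_betwE[OF bij] that finite_subset[OF _ fin(1)] by auto
  have TX: "T' b \<subseteq> I'" "finite (T' b)" if "b \<in> basis X" for b
    using bij_betwE[OF bij'] that finite_subset[OF _ fin(2)] by auto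
  have bv: "\<tau> ` ?K \<union> \<gamma> ` {..<fst (tgt Y)} = ?nmY ` bvars Y" "\<alpha> ` {..<fst (src X)} \<union> \<tau> ` ?K = ?nmX ` bvars X"
    "\<alpha> ` {..<fst (src X)} \<union> \<gamma> ` {..<fst (tgt Y)} = ?nm ` bvars ?Z"
    using st by (auto simp: bvars_def comp_def image_Un image_image)
  have flP: "flat ?nm M E S (base_change (\<lambda>\<mu>. (c, \<mu>, b)) id (y_coeffs P)) =
      single (T c \<union> T' b) (rename ?nm3 P * single (m c + m' b) (ksign (sg c \<noteq> sg' b)))" for c b P
  proof (rule additive_eqI[where v = P])
    fix N
    have "rename_mon ?nm (xz_part N) + (m c + (rename_mon \<tau> (y_part N) + m' b)) =
        (rename_mon ?nm (xz_part N) + rename_mon \<tau> (y_part N)) + (m c + m' b)"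
      by (simp add: add_ac)
    then show "flat ?nm M E S (base_change (\<lambda>\<mu>. (c, \<mu>, b)) id (y_coeffs (single N (lookup P N)))) =
        single (T c \<union> T' b) (rename ?nm3 (single N (lookup P N)) * single (m c + m' b) (ksign (sg c \<noteq> sg' b)))"
      by (simp add: M_def E_def S_def mult_single rename_mon_tvar)
  qed (auto simp: additive_def flat_add base_change_id_add additive.add[OF additive_y_coeffs]
        rename_add distrib_right single_add)
  have nm3: "?nm3 \<circ> yz_var = ?nmY" "?nm3 \<circ> xy_var = ?nmX"
    by (auto simp: fun_eq_iff split: bvar.splits)
  have fl1: "flat ?nm M E S (tens v (single b s)) =
      smul (rename ?nmX s * single (m' b) (ksign (sg' b))) (join_right (T' b) (flat ?nmY m sg T v))" for v b s
    by (rule additive_eqI[where v = v])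
       (auto simp: additive_def flat_add base_change_id_add additive.add[OF additive_tens(1)] tens_single flP
          rename_mult rename_comp nm3 smul.scale_right_distrib mult_single mult_single_left ksign_split mult_ac add.commute)
  have fl2: "flat ?nm M E S (tens (single c s) u) =
      smul (rename ?nmY s * single (m c) (ksign (sg c))) (join_left (T c) (flat ?nmX m' sg' T' u))" for u c s
    by (rule additive_eqI[where v = u])
       (auto simp: additive_def flat_add base_change_id_add additive.add[OF additive_tens(2)] tens_single flP
          rename_mult rename_comp nm3 smul.scale_right_distrib mult_single mult_single_left ksign_split mult_ac add.commute)
  have "realizes_by ?nm False (I \<union> I') ?V p q ?Z M E S"
    unfolding realizes_by_def
  proof (intro conjI ballI bijZ)
    fix z assume "z \<in> basis ?Z"
    then obtain b \<mu> b' where z: "z = (b, \<mu>, b')" "b \<in> basis Y" "b' \<in> basis X" "\<mu> \<in> mons ?K"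
      by (auto simp: comp_def mons_def)
    have d: "par Y b = odd (card (T b))" "dcol Y b \<in> elems Y"
      "flat ?nmY m sg T (dcol Y b) = smul (single (m b) (ksign (sg b))) (kd I p q (T b))"
      using r z by (auto simp: realizes_by_def)
    have d': "par X b' = odd (card (T' b'))" "dcol X b' \<in> elems X"
      "flat ?nmX m' sg' T' (dcol X b') = smul (single (m' b') (ksign (sg' b'))) (kd I' p q (T' b'))"
      using r' z by (auto simp: realizes_by_def)
    let ?y = "single (rename_mon Tgt \<mu>) 1 :: (bvar, 'b) mpoly"
    have dz: "dcol ?Z z = tens (dcol Y b) (single b' ?y) + smul (ksign (par Y b)) (tens (bas b) (smul ?y (dcol X b')))"
      using z by (simp add: comp_def Let_def)
    have "card (T b \<union> T' b') = card (T b) + card (T' b')"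
      using TY[OF z(2)] TX[OF z(3)] dI by (intro card_Un_disjoint) auto
    then show "par ?Z z = (odd (card (S z)) \<noteq> False)"
      using z d d' by (simp add: comp_def S_def)
    have y: "?y \<in> polys (bvars X)"
      by (intro polys_single rename_mon_mons[OF z(4)]) (auto simp: bvars_def)
    show "dcol ?Z z \<in> elems ?Z"
    proof -
      have "tens (dcol Y b) (single b' ?y) \<in> elems ?Z"
        by (rule tens_elems[OF d(2)]) (use y z st in \<open>auto simp: elems_eq intro: fmod_single\<close>)
      moreover have "tens (bas b) (smul ?y (dcol X b')) \<in> elems ?Z"
        by (rule tens_elems) (use y z st d'(2) in \<open>auto simp: elems_eq intro: fmod_single fmod_smul\<close>)
      ultimately show ?thesis
        unfolding elems_eq dz by (intro fmod_add fmod_smul) auto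
    qed
    have y\<tau>: "rename_mon ?nmX (rename_mon Tgt \<mu>) = rename_mon \<tau> \<mu>"
    proof -
      have "?nmX \<circ> Tgt = \<tau>" by auto
      then show ?thesis by (simp add: rename_mon_comp)
    qed
    let ?r = "single (rename_mon \<tau> \<mu>) 1 * (single (m' b') (ksign (sg' b')) * single (m b) (ksign (sg b)))"
    have "flat ?nm M E S (dcol ?Z z) =
        smul ?r (join_right (T' b') (kd I p q (T b)) + smul (ksign (odd (card (T b)))) (join_left (T b) (kd I' p q (T' b'))))"
      unfolding dz by (simp add: flat_add flat_smul fl1 fl2 d d' y\<tau> base_change_smul
          smul.scale_right_distrib mult_ac)
    also have "\<dots> = smul ?r (kd (I \<union> I') p q (S z))"
      using TY[OF z(2)] TX[OF z(3)] fin less by (subst kd_union) (auto simp: z S_def)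
    also have "?r = single (M z) (ksign (E z))"
      by (simp add: z M_def E_def mult_single ksign_mult add_ac) (simp add: ksign_def)
    finally show "flat ?nm M E S (dcol ?Z z) = smul (single (M z) (ksign (E z))) (kd (I \<union> I') p q (S z))" .
  qed
  moreover have "curved ?nm (I \<union> I') ?V p q ?Z"
  proof -
    have sub: "V \<union> ?nmY ` bvars Y \<subseteq> ?V \<union> ?nm ` bvars ?Z" "V' \<union> ?nmX ` bvars X \<subseteq> ?V \<union> ?nm ` bvars ?Z"
      unfolding bv[symmetric] by auto
    have o: "case_bvar f g \<circ> Src = f" "case_bvar f g \<circ> Tgt = g" for f g :: "nat \<Rightarrow> 'a" by auto
    have "(\<Sum>i\<in>I \<union> I'. p i * q i) =
        (rename \<gamma> (snd (tgt Y)) - rename \<tau> (snd (src Y))) + (rename \<tau> (snd (tgt X)) - rename \<alpha> (snd (src X)))"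
      by (rule curved_Un) (use c c' fin less in \<open>auto simp: curved_def o\<close>)
    then show ?thesis
      using c c' st polys_mono[OF sub(1)] polys_mono[OF sub(2)] unfolding curved_def
      by (auto simp: comp_def o)
  qed
  ultimately show ?thesis unfolding realizes_def by blast
qed

section \<open>Iterated elimination\<close>

lemma kosz_cong:
  assumes "\<And>i. i \<in> I \<Longrightarrow> p i = p' i \<and> q i = q' i"
  shows "kosz nm o' I V p q = kosz nm o' I V p' q'"
proof -
  have "kd I p q = kd I p' q'" using kd_cong[of I p p' q q'] assms by auto
  then show ?thesis by (simp add: kosz_def)
qed

lemma heq_refl:
  assumes "cx Q C"
  shows "heq Q C C"
  unfolding heq_def
  by (rule exI[of _ "\<lambda>v. v"], rule exI[of _ "\<lambda>v. v"])
     (use assms in \<open>auto simp: chain_map_def cx_map_id intro!: null_homotopic_zero\<close>)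

text \<open>The parity of the shift accumulated before step \<open>k\<close>.\<close>

fun flips :: "(nat \<Rightarrow> bool) \<Rightarrow> nat \<Rightarrow> bool" where
  "flips c 0 = False"
| "flips c (Suc k) = (flips c k \<noteq> c k)"

text \<open>\<open>\<phi> k\<close> is the total substitution after \<open>k\<close> steps; it stays
  simple because the replacing variables are never eliminated themselves. A coefficient has to be
  linear only after the earlier substitutions. The last two conjuncts strengthen the induction: they
  feed transitivity and the curvature hypothesis of the next step.\<close>

lemma heq_eliminate_all:
  fixes p q :: "nat \<Rightarrow> ('v, 'k::field_char_0) mpoly" and vv :: "nat \<Rightarrow> 'v" and th :: "nat \<Rightarrow> nat" and rt :: "'v \<Rightarrow> 'v"
    and c :: "nat \<Rightarrow> bool" and I :: "nat set" and V :: "'v set" and nm :: "bvar \<Rightarrow> 'v"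
  defines "\<phi> \<equiv> \<lambda>k x. if x \<in> vv ` {..<k} then rt x else x"
  defines "P \<equiv> \<lambda>k j. ksign (flips c k) * rename (\<phi> k) (p j)"
    and "Q \<equiv> \<lambda>k j. ksign (flips c k) * rename (\<phi> k) (q j)"
  defines "K \<equiv> \<lambda>k. kosz nm (flips c k) (I - th ` {..<k}) (V - vv ` {..<k}) (P k) (Q k)"
  assumes fin: "finite I"
    and th: "inj_on th {..<N}" "th ` {..<N} \<subseteq> I"
    and vv: "inj_on vv {..<N}" "vv ` {..<N} \<subseteq> V"
    and rt: "\<And>k. k < N \<Longrightarrow> rt (vv k) \<in> V - vv ` {..<N}"
    and nm: "nm ` B \<subseteq> V - vv ` {..<N}"
    and pq: "\<And>j. j \<in> I \<Longrightarrow> p j \<in> polys V" "\<And>j. j \<in> I \<Longrightarrow> q j \<in> polys V"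
    and w: "w \<in> polys B" "(\<Sum>j\<in>I. p j * q j) = rename nm w"
    and lin: "\<And>k. k < N \<Longrightarrow> \<exists>b. rename (\<phi> k) ((if c k then p else q) (th k)) = ksign b * (var (vv k) - var (rt (vv k)))"
    and k: "k \<le> N"
  shows "heq (polys B) (K 0) (K k) \<and> cx (polys B) (K k) \<and>
    (\<Sum>j\<in>I - th ` {..<k}. P k j * Q k j) = rename nm w"
proof -
  have mem: "rename (\<phi> k) r \<in> polys (V - vv ` {..<k})" if "k \<le> N" "r \<in> polys V" for k r
  proof (rule rename_polys[OF that(2)], rule image_subsetI)
    fix x assume x: "x \<in> V"
    have sub: "vv ` {..<k} \<subseteq> vv ` {..<N}" using that(1) by auto
    show "\<phi> k x \<in> V - vv ` {..<k}"
    proof (cases "x \<in> vv ` {..<k}")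
      case True
      then obtain j where "x = vv j" "j < k" by auto
      then show ?thesis using True rt[of j] that(1) sub by (auto simp: \<phi>_def)
    qed (use x in \<open>auto simp: \<phi>_def\<close>)
  qed
  have cxK: "cx (polys B) (K k)" if "k \<le> N" for k
  proof -
    have "nm ` B \<subseteq> V - vv ` {..<k}" using nm that by fastforce
    then show ?thesis
      unfolding K_def P_def Q_def using fin that by (intro cx_kosz polys_mult mem polys_ksign pq) auto
  qed
  show ?thesis
    using k
  proof (induction k)
    case 0
    have "\<phi> 0 = id" by (auto simp: \<phi>_def)
    then show ?case using heq_refl[OF cxK[of 0]] cxK[of 0] w by (simp add: P_def Q_def ksign_def)
  next
    case (Suc k)
    then have k: "k < N" "k \<le> N" by auto
    let ?f = "ksign (flips c k) :: ('v, 'k) mpoly"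
    let ?I = "I - th ` {..<k}" and ?V = "V - vv ` {..<k}"
    let ?v = "vv k" and ?a = "rt (vv k)"
    have IH: "heq (polys B) (K 0) (K k)" "(\<Sum>j\<in>?I. P k j * Q k j) = rename nm w"
      using Suc by auto
    obtain b where b: "rename (\<phi> k) ((if c k then p else q) (th k)) = ksign b * (var ?v - var ?a)"
      using lin[OF k(1)] by auto
    have v_new: "?v \<notin> vv ` {..<k}" using inj_onD[OF vv(1), of k] k by fastforce
    have th_new: "th k \<notin> th ` {..<k}" using inj_onD[OF th(1), of k] k by fastforce
    have va: "?v \<noteq> ?a" "?v \<in> ?V" "?a \<in> ?V"
      using rt[OF k(1)] vv(2) k v_new by auto
    have th_in: "th k \<in> ?I" using th(2) k th_new by auto
    \<comment> \<open>Earlier substitutions never produce \<open>?v\<close>, since their values are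
      not among the variables to be eliminated.\<close>
    have \<phi>: "rename (id(?v := ?a)) (rename (\<phi> k) r) = rename (\<phi> (Suc k)) r" for r
    proof -
      have rt_new: "rt x \<noteq> vv k" if x: "x \<in> vv ` {..<k}" for x
      proof -
        obtain j where "x = vv j" "j < k" using x by auto
        then have "rt x \<notin> vv ` {..<N}" using rt[of j] k by auto
        then show ?thesis using k by auto
      qed
      have "id(?v := ?a) \<circ> \<phi> k = \<phi> (Suc k)"
        using v_new rt_new by (auto simp: \<phi>_def fun_eq_iff less_Suc_eq image_iff)
      then show ?thesis by (simp add: rename_comp)
    qed
    have I': "I - th ` {..<Suc k} = ?I - {th k}" and V': "V - vv ` {..<Suc k} = ?V - {?v}"
      by (auto simp: lessThan_Suc)
    have nm': "nm ` B \<subseteq> ?V - {?v}"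
      using nm k by (auto simp: subset_iff)
    have lin': "(if c k then P k (th k) else Q k (th k)) = ksign (flips c k \<noteq> b) * (var ?v - var ?a)"
      using b by (auto simp: P_def Q_def ksign_split mult.assoc split: if_splits)
    have sgn: "ksign (c k) * rename (id(?v := ?a)) (?f * rename (\<phi> k) r) = ksign (flips c (Suc k)) * rename (\<phi> (Suc k)) r" for r
      by (simp add: rename_mult \<phi> ksign_split mult_ac)
    have KS: "K (Suc k) = kosz nm (flips c k \<noteq> c k) (?I - {th k}) (?V - {?v})
        (\<lambda>j. ksign (c k) * rename (id(?v := ?a)) (P k j)) (\<lambda>j. ksign (c k) * rename (id(?v := ?a)) (Q k j))"
      by (simp only: K_def P_def Q_def I' V' sgn flips.simps(2))
    have "heq (polys B) (K k) (K (Suc k))"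
    proof (cases "c k")
      case True
      show ?thesis
        using heq_eliminate[of ?I "th k" ?v ?a ?V nm B "P k" "Q k" w "con (th k)" "wed (th k)" "Q k (th k)" "P k (th k)"
            "wed (th k)" "con (th k)" "c k" "flips c k \<noteq> b" "flips c k"] fin th_in va nm' k w(1) IH(2) True lin'
        by (simp add: KS, simp add: K_def P_def Q_def mem pq polys_mult)
    next
      case False
      show ?thesis
        using heq_eliminate[of ?I "th k" ?v ?a ?V nm B "P k" "Q k" w "wed (th k)" "con (th k)" "P k (th k)" "Q k (th k)"
            "id" "\<lambda>u. con (th k) (wed (th k) u)" "c k" "flips c k \<noteq> b" "flips c k"] fin th_in va nm' k w(1) IH(2) False lin'
        by (simp add: KS, simp add: K_def P_def Q_def mem pq polys_mult)
    qed
    then have "heq (polys B) (K 0) (K (Suc k))"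
      using heq_trans[OF IH(1)] cxK[of 0] cxK[OF k(2)] cxK[OF Suc.prems] by simp
    \<comment> \<open>The removed summand contains the linear form and vanishes under the
      substitution, which fixes the scalar on the right.\<close>
    moreover have "(\<Sum>j\<in>?I - {th k}. P (Suc k) j * Q (Suc k) j) = rename nm w"
    proof -
      let ?sb = "rename (id(?v := ?a)) :: ('v, 'k) mpoly \<Rightarrow> _"
      have "(\<Sum>j\<in>?I - {th k}. P (Suc k) j * Q (Suc k) j) = (\<Sum>j\<in>?I - {th k}. ?sb (P k j * Q k j))"
        unfolding P_def Q_def sgn[symmetric] by (rule sum.cong) (simp_all add: rename_mult mult.assoc mult.left_commute)
      also have "\<dots> = (\<Sum>j\<in>?I. ?sb (P k j * Q k j))"
      proof -
        have "?sb (ksign (flips c k \<noteq> b) * (var ?v - var ?a)) = 0" by (simp add: rename_mult rename_diff)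
        then have "?sb (P k (th k) * Q k (th k)) = 0"
          using lin' by (cases "c k") (simp_all only: rename_mult if_True if_False mult_zero_left mult_zero_right)
        then show ?thesis using fin th_in by (subst sum.remove[OF _ th_in, where g = "\<lambda>j. ?sb (P k j * Q k j)"]) auto
      qed
      also have "\<dots> = ?sb (rename nm w)" unfolding IH(2)[symmetric] by (simp add: rename_sum)
      also have "\<dots> = rename nm w"
        using rename_polys[OF w(1) nm'] by (rule rename_idI) auto
      finally show ?thesis .
    qed
    ultimately show ?case using cxK[OF Suc.prems] by (simp only: I')
  qed
qed


section \<open>Recognizing 1-morphisms\<close>

lemma realizes_iso_hmf:
  assumes X: "realizes nm o' I V p q X" and Y: "realizes nm o'' I' V' p' q' Y"
    and st: "src Y = src X" "tgt Y = tgt X"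
    and fin: "finite I" "finite I'" and inj: "inj_on nm (bvars X)"
    and disj: "V \<inter> nm ` bvars X = {}" "V' \<inter> nm ` bvars X = {}"
    and heq: "heq (base_ring X) (kosz nm o' I (V \<union> nm ` bvars X) p q) (kosz nm o'' I' (V' \<union> nm ` bvars X) p' q')"
  shows "iso_hmf X Y"
proof -
  have b: "bvars Y = bvars X" "base_ring Y = base_ring X" by (simp_all add: bvars_def base_ring_def st)
  note hX = realizes_heq[OF X fin(1) inj disj(1)]
  note hY = realizes_heq[OF Y fin(2), unfolded b, OF inj disj(2)]
  have "heq (base_ring X) (cx_of X) (cx_of Y)"
    using heq_trans[OF heq_trans[OF hX(3) heq hX(1,2) hY(2)] heq_sym[OF hY(3)] hX(1) hY(2,1)] .
  then show ?thesis by (rule iso_hmfI) (simp add: b)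
qed

text \<open>The complement in the summand condition, for 1-morphisms that are themselves homotopy
  equivalent to finite-rank ones.\<close>

definition zero_mf :: "'k::field_char_0 obj \<Rightarrow> 'k obj \<Rightarrow> ('b, 'k) mor1" where
  "zero_mf A B = \<lparr>src = A, tgt = B, basis = {}, par = (\<lambda>_. False), dcol = (\<lambda>_. 0)\<rparr>"

lemma zero_mf_is_mf:
  fixes A B :: "'k::field_char_0 obj"
  shows "is_mf A B (zero_mf A B :: ('b, 'k) mor1)"
proof -
  let ?Z = "zero_mf A B :: ('b, 'k) mor1"
  have st: "src ?Z = A" "tgt ?Z = B" by (simp_all add: zero_mf_def)
  have el: "elems ?Z = {0}" by (auto simp: elems_def zero_mf_def base_ring_def)
  have "homog ?Z e = {0}" for e by (auto simp: homog_def el)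
  then show ?thesis by (simp add: is_mf_def hom_def dif_def st el)
qed

text \<open>\<open>lg_mor\<close> takes the basis of its finite-rank witness in the natural
  numbers.\<close>

definition nat_mf :: "('b \<Rightarrow> nat) \<Rightarrow> ('b, 'k::field_char_0) mor1 \<Rightarrow> (nat, 'k) mor1" where
  "nat_mf g X = \<lparr>src = src X, tgt = tgt X, basis = g ` basis X,
     par = (\<lambda>c. par X (inv_into (basis X) g c)),
     dcol = (\<lambda>c. base_change g id (dcol X (inv_into (basis X) g c)))\<rparr>"

text \<open>\<open>X\<close> plus zero is equivalent to the finite-rank \<open>Y\<close> through
  their Koszul complexes, so elimination down to finite rank also proves membership in the Hom
  category.\<close>

lemma realizes_lg_mor:
  assumes X: "realizes nm o' I V p q X" and Y: "realizes nm o'' I' V' p' q' Y"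
    and X_st: "src X = A" "tgt X = B" and Y_st: "src Y = A" "tgt Y = B"
    and AB: "snd A \<in> polys {..<fst A}" "snd B \<in> polys {..<fst B}"
    and fin: "finite I" "finite I'" and inj: "inj_on nm (bvars X)"
    and disj: "V \<inter> nm ` bvars X = {}" "V' \<inter> nm ` bvars X = {}"
    and heq: "heq (base_ring X) (kosz nm o' I (V \<union> nm ` bvars X) p q) (kosz nm o'' I' (V' \<union> nm ` bvars X) p' q')"
    and Y_fin: "finite (basis Y)" "inj_on (g :: _ \<Rightarrow> nat) (basis Y)"
  shows "lg_mor A B X"
proof -
  let ?Y = "nat_mf g Y" and ?D = "dsum X (zero_mf A B :: (nat, 'b) mor1)"
  have bv: "bvars Y = bvars X" "bvars ?Y = bvars X" "bvars ?D = bvars X"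
    by (simp_all add: bvars_def X_st Y_st nat_mf_def dsum_def)
  have st: "src ?Y = A" "tgt ?Y = B" "src ?D = A" "tgt ?D = B"
    by (simp_all add: X_st Y_st nat_mf_def dsum_def)
  have rY: "realizes nm o'' I' V' p' q' ?Y"
    by (rule realizes_transport[OF Y, where g = g])
       (use Y_fin(2) in \<open>auto simp: nat_mf_def bij_betw_def\<close>)
  have rD: "realizes nm o' I V p q ?D"
    by (rule realizes_transport[OF X, where g = Inl])
       (auto simp: dsum_def zero_mf_def bij_betw_def)
  have "is_mf A B X" by (rule realizes_is_mf[OF X fin(1) inj disj(1) X_st AB])
  moreover have "is_mf A B ?Y"
    by (rule realizes_is_mf[OF rY fin(2), unfolded bv, OF inj disj(2) _ _ AB]) (simp_all add: nat_mf_def Y_st)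
  moreover have "iso_hmf ?D ?Y"
    by (rule realizes_iso_hmf[OF rD rY, unfolded bv, OF _ _ fin inj disj])
       (use heq in \<open>simp_all add: base_ring_eq bv st\<close>)
  moreover have "finite (basis ?Y)" using Y_fin(1) by (simp add: nat_mf_def)
  ultimately show ?thesis unfolding lg_mor_def using zero_mf_is_mf by blast
qed

section \<open>The Serre automorphism\<close>

lemma box_obj_unit [simp]: "A \<box>\<^sub>o unit_obj = A"
  by (simp add: box_obj_def unit_obj_def)

lemma box_obj_assoc: "(A \<box>\<^sub>o B) \<box>\<^sub>o C = A \<box>\<^sub>o (B \<box>\<^sub>o C)"
  by (simp add: box_obj_def rename_add rename_comp o_def add.assoc)

lemma box_obj_polys:
  assumes "snd A \<in> polys {..<fst A}" "snd B \<in> polys {..<fst B}"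
  shows "snd (A \<box>\<^sub>o B) \<in> polys {..<fst (A \<box>\<^sub>o B)}"
proof -
  have "snd A \<in> polys {..<fst A + fst B}" using assms(1) polys_mono[of "{..<fst A}" "{..<fst A + fst B}"] by auto
  moreover have "rename (\<lambda>i. fst A + i) (snd B) \<in> polys {..<fst A + fst B}"
    by (rule rename_polys[OF assms(2)]) auto
  ultimately show ?thesis by (simp add: box_obj_def polys_add)
qed

lemma bvars_unit1 [simp]: "bvars (unit1 A) = Src ` {..<fst A} \<union> Tgt ` {..<fst A}"
  by (simp add: bvars_def unit1_def)

lemma src_tgt_unit1 [simp]: "src (unit1 A) = A" "tgt (unit1 A) = A"
  by (simp_all add: unit1_def)

lemma realizes_relabel_id:
  assumes "realizes nm o' I V p q (unit1 A)"
  shows "realizes nm o' I V p q (relabel A A id (unit1 A))"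
  by (rule realizes_relabel) (use assms in auto)

lemma realizes_ev:
  assumes "realizes (nm \<circ> ev_var (fst A)) o' I V p q (unit1 A)"
  shows "realizes nm o' I V p q (ev A)"
  unfolding ev_def
proof (rule realizes_relabel[OF assms])
  have "nm \<circ> ev_var (fst A) \<circ> Tgt = nm \<circ> Src \<circ> (\<lambda>i. fst A + i)" "nm \<circ> ev_var (fst A) \<circ> Src = nm \<circ> Src"
    by auto
  then show "rename (nm \<circ> Tgt) (snd (unit_obj :: 'b obj)) - rename (nm \<circ> Src) (snd (A \<box>\<^sub>o dual_obj A)) =
      rename (nm \<circ> ev_var (fst A) \<circ> Tgt) (snd (tgt (unit1 A))) - rename (nm \<circ> ev_var (fst A) \<circ> Src) (snd (src (unit1 A)))"
    by (simp add: unit_obj_def box_obj_def dual_obj_def rename_add rename_diff rename_minus rename_comp)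
qed (auto simp: box_obj_def dual_obj_def)

text \<open>\<open>braid_var\<close> exchanges the two blocks of target variables, and the potential
  is a sum of two copies of \<open>W\<close>, hence symmetric.\<close>

lemma realizes_braiding:
  assumes "realizes (nm \<circ> braid_var (fst A) (fst A)) o' I V p q (unit1 (A \<box>\<^sub>o A))" and W: "snd A \<in> polys {..<fst A}"
  shows "realizes nm o' I V p q (braiding A A)"
  unfolding braiding_def
proof (rule realizes_relabel[OF assms(1)])
  let ?n = "fst A" and ?b = "braid_var (fst A) (fst A)"
  have "rename (nm \<circ> ?b \<circ> Tgt) (snd A) = rename (nm \<circ> Tgt \<circ> (\<lambda>i. ?n + i)) (snd A)"
    "rename (nm \<circ> ?b \<circ> Tgt \<circ> (\<lambda>i. ?n + i)) (snd A) = rename (nm \<circ> Tgt) (snd A)"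
    by (rule rename_cong[OF W]; simp)+
  moreover have "nm \<circ> ?b \<circ> Src = nm \<circ> Src" by auto
  ultimately show "rename (nm \<circ> Tgt) (snd (A \<box>\<^sub>o A)) - rename (nm \<circ> Src) (snd (A \<box>\<^sub>o A)) =
      rename (nm \<circ> ?b \<circ> Tgt) (snd (tgt (unit1 (A \<box>\<^sub>o A)))) - rename (nm \<circ> ?b \<circ> Src) (snd (src (unit1 (A \<box>\<^sub>o A))))"
    by (simp add: box_obj_def rename_add rename_comp add.commute)
qed (auto simp: box_obj_def)

text \<open>For each \<open>i < n\<close> the copies of the variable \<open>x\<^sub>i\<close> in the five factors of the composite form a
  chain \<open>(0, i), ..., (9, i)\<close>, from the source to the target, in which neighbours are identified by
  one exterior generator.  In the source and the target of the braiding, the three copies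
  of \<open>x\<^sub>i\<close> are met by the chain in the following positions.\<close>

definition chain2 :: "nat \<Rightarrow> nat \<Rightarrow> nat \<times> nat" where
  "chain2 n j = (if j < n then (2, j) else if j < 2 * n then (6, j - n) else (5, j - 2 * n))"

definition chain3 :: "nat \<Rightarrow> nat \<Rightarrow> nat \<times> nat" where
  "chain3 n j = (if j < n then (7, j) else if j < 2 * n then (3, j - n) else (4, j - 2 * n))"

text \<open>The generators of the factors are numbered from left to right.\<close>

definition serre_p :: "nat \<Rightarrow> (nat, 'k::field_char_0) mpoly \<Rightarrow> nat \<Rightarrow> (nat \<times> nat, 'k) mpoly" where
  "serre_p n W \<theta> = (
     if \<theta> < n then rename (case_bvar (Pair 8) (Pair 9)) (diff_quot \<theta> W)
     else if \<theta> < 2 * n then rename (case_bvar (chain3 n) (Pair 8)) (diff_quot (\<theta> - n) W)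
     else if \<theta> < 3 * n then
       rename (case_bvar (chain3 n) (Pair 8) \<circ> shift_bvar n n \<circ> ev_var n) (diff_quot (\<theta> - 2 * n) W)
     else if \<theta> < 5 * n then
       rename (case_bvar (chain2 n) (chain3 n) \<circ> braid_var n n) (diff_quot (\<theta> - 3 * n) (snd ((n, W) \<box>\<^sub>o (n, W))))
     else if \<theta> < 6 * n then
       rename (case_bvar (chain2 n) (chain3 n) \<circ> shift_bvar (n + n) (n + n)) (diff_quot (\<theta> - 5 * n) (- W))
     else if \<theta> < 7 * n then rename (case_bvar (Pair 1) (chain2 n)) (diff_quot (\<theta> - 6 * n) W)
     else if \<theta> < 8 * n then - (var (5, \<theta> - 7 * n) - var (6, \<theta> - 7 * n))
     else rename (case_bvar (Pair 0) (Pair 1)) (diff_quot (\<theta> - 8 * n) W))"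

definition serre_q :: "nat \<Rightarrow> (nat, 'k::field_char_0) mpoly \<Rightarrow> nat \<Rightarrow> (nat \<times> nat, 'k) mpoly" where
  "serre_q n W \<theta> = (
     if \<theta> < n then var (9, \<theta>) - var (8, \<theta>)
     else if \<theta> < 2 * n then var (8, \<theta> - n) - var (7, \<theta> - n)
     else if \<theta> < 3 * n then var (4, \<theta> - 2 * n) - var (3, \<theta> - 2 * n)
     else if \<theta> < 4 * n then var (3, \<theta> - 3 * n) - var (2, \<theta> - 3 * n)
     else if \<theta> < 5 * n then var (7, \<theta> - 4 * n) - var (6, \<theta> - 4 * n)
     else if \<theta> < 6 * n then var (4, \<theta> - 5 * n) - var (5, \<theta> - 5 * n)
     else if \<theta> < 7 * n then var (2, \<theta> - 6 * n) - var (1, \<theta> - 6 * n)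
     else if \<theta> < 8 * n then
       rename (case_bvar (Pair 1) (chain2 n) \<circ> shift_bvar n n \<circ> swap_bvar \<circ> ev_var n) (diff_quot (\<theta> - 7 * n) W)
     else var (1, \<theta> - 8 * n) - var (0, \<theta> - 8 * n))"

context
  fixes n :: nat and W :: "(nat, 'k::field_char_0) mpoly"
  assumes W: "W \<in> polys {..<n}"
begin

abbreviation "serre_part nm I V X \<equiv> realizes nm False I V (serre_p n W) (serre_q n W) X"

lemma realizes_runit:
  "serre_part (case_bvar (Pair 8) (Pair 9)) {0..<n} {} (runit (n, W))"
  unfolding runit_def box_obj_unit
  by (rule realizes_relabel_id, rule realizes_unit[where lo = 0])
     (simp_all add: W serre_p_def serre_q_def)

lemma realizes_unit_ev:
  "serre_part (case_bvar (chain3 n) (Pair 8)) {n..<3 * n} {}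
     (unit1 (n, W) \<box> ev (n, W))"
proof -
  have "serre_part (case_bvar (chain3 n) (Pair 8)) ({n..<n + n} \<union> {2 * n..<2 * n + n}) ({} \<union> {}) (unit1 (n, W) \<box> ev (n, W))"
  proof (rule realizes_box)
    show "serre_part (case_bvar (chain3 n) (Pair 8)) {n..<n + n} {} (unit1 (n, W))"
      by (rule realizes_unit[where lo = n])
         (simp_all add: W serre_p_def serre_q_def chain3_def)
    show "serre_part (case_bvar (chain3 n) (Pair 8) \<circ> shift_bvar (fst (src (unit1 (n, W)))) (fst (tgt (unit1 (n, W)))))
        {2 * n..<2 * n + n} {}  (ev (n, W))"
      by (rule realizes_ev, rule realizes_unit[where lo = "2 * n"])
         (simp_all add: W serre_p_def serre_q_def chain3_def)
  qed auto
  moreover have "{n..<n + n} \<union> {2 * n..<2 * n + n} = {n..<3 * n}" by auto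
  ultimately show ?thesis by simp
qed

lemma realizes_braiding_unit:
  "serre_part (case_bvar (chain2 n) (chain3 n)) {3 * n..<6 * n} {}
     (braiding (n, W) (n, W) \<box> unit1 (dual_obj (n, W)))"
proof -
  have "serre_part (case_bvar (chain2 n) (chain3 n)) ({3 * n..<3 * n + (n + n)} \<union> {5 * n..<5 * n + n}) ({} \<union> {}) (braiding (n, W) (n, W) \<box> unit1 (dual_obj (n, W)))"
  proof (rule realizes_box)
    have a: "3 * n + i - 4 * n = i - n" for i by simp
    have "fst ((n, W) \<box>\<^sub>o (n, W)) = n + n" by (simp add: box_obj_def)
    then show "serre_part (case_bvar (chain2 n) (chain3 n)) {3 * n..<3 * n + (n + n)} {}
        (braiding (n, W) (n, W))"
      using box_obj_polys[of "(n, W)" "(n, W)"] a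
      by (intro realizes_braiding realizes_unit[where lo = "3 * n"])
         (auto simp: W serre_p_def serre_q_def chain2_def chain3_def)
    show "serre_part (case_bvar (chain2 n) (chain3 n) \<circ>
          shift_bvar (fst (src (braiding (n, W) (n, W)))) (fst (tgt (braiding (n, W) (n, W)))))
        {5 * n..<5 * n + n} {} (unit1 (dual_obj (n, W)))"
      by (rule realizes_unit[where lo = "5 * n"])
         (simp_all add: W serre_p_def serre_q_def chain2_def chain3_def braiding_def relabel_def box_obj_def dual_obj_def)
  qed auto
  moreover have "{3 * n..<3 * n + (n + n)} \<union> {5 * n..<5 * n + n} = {3 * n..<6 * n}" by auto
  ultimately show ?thesis by simp
qed

text \<open>The source of \<open>ev\<close> has \<open>2 * n\<close> variables, so the shift built
  into the adjoint is even and trivial. The shift by \<open>n\<close> in the end comes from the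
  exchange of multiplication and contraction in \<open>vee\<close>.\<close>

lemma right_adj_ev: "right_adj (ev (n, W)) = vee (ev (n, W))"
  by (simp add: right_adj_def ev_def relabel_def box_obj_def dual_obj_def shift_pow_double)

lemma realizes_unit_coev:
  "serre_part (case_bvar (Pair 1) (chain2 n)) {6 * n..<8 * n} {}
     (unit1 (n, W) \<box> right_adj (ev (n, W)))"
proof -
  let ?nm = "case_bvar (Pair 1) (chain2 n)"
  have "serre_part ?nm ({6 * n..<6 * n + n} \<union> {7 * n..<7 * n + n}) ({} \<union> {}) (unit1 (n, W) \<box> right_adj (ev (n, W)))"
  proof (rule realizes_box)
    show "serre_part ?nm {6 * n..<6 * n + n} {} (unit1 (n, W))"
      by (rule realizes_unit[where lo = "6 * n"])
         (simp_all add: W serre_p_def serre_q_def chain2_def)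
    \<comment> \<open>\<open>realizes_vee\<close> exchanges the two families with one sign, so they
      are supplied here in exchanged form.\<close>
    have "realizes (?nm \<circ> shift_bvar n n \<circ> swap_bvar) False {7 * n..<7 * n + n} {} (serre_q n W)
        (\<lambda>\<theta>. - serre_p n W \<theta>) (ev (n, W))"
      by (rule realizes_ev, rule realizes_unit[where lo = "7 * n"])
         (simp_all add: W serre_p_def serre_q_def chain2_def)
    from realizes_vee[OF this]
    show "serre_part (?nm \<circ> shift_bvar (fst (src (unit1 (n, W)))) (fst (tgt (unit1 (n, W)))))
        {7 * n..<7 * n + n} {}  (right_adj (ev (n, W)))"
      by (simp add: right_adj_ev)
  qed auto
  moreover have "{6 * n..<6 * n + n} \<union> {7 * n..<7 * n + n} = {6 * n..<8 * n}" by auto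
  ultimately show ?thesis by simp
qed

lemma realizes_runit_inv:
  "serre_part (case_bvar (Pair 0) (Pair 1)) {8 * n..<9 * n} {} (runit_inv (n, W))"
proof -
  have "serre_part (case_bvar (Pair 0) (Pair 1)) {8 * n..<8 * n + n} {} (runit_inv (n, W))"
    unfolding runit_inv_def box_obj_unit
    by (rule realizes_relabel_id, rule realizes_unit[where lo = "8 * n"])
       (simp_all add: W serre_p_def serre_q_def)
  then show ?thesis by simp
qed

abbreviation "end_var \<equiv> case_bvar (Pair 0) (Pair 9) :: bvar \<Rightarrow> nat \<times> nat"

text \<open>The internal levels are 1 and 8 next to the unitors, 2, 5, 6 at the source of the
  braiding and 3, 4, 7 at its target. From left to right the factors contribute 1, 2, 3, 2 and 1
  blocks of \<open>n\<close> generators.\<close>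

lemma realizes_serre:
  "serre_part end_var {..<9 * n} ({1..8} \<times> {..<n}) (serre (n, W))"
proof -
  let ?A = "(n, W)"
  have ev: "src (ev ?A) = ?A \<box>\<^sub>o dual_obj ?A" "tgt (ev ?A) = unit_obj"
    by (simp_all add: ev_def relabel_def)
  have obj: "tgt (unit1 ?A \<box> right_adj (ev ?A)) = ?A \<box>\<^sub>o (?A \<box>\<^sub>o dual_obj ?A)"
    "src (unit1 ?A \<box> right_adj (ev ?A)) = ?A"
    "src (braiding ?A ?A \<box> unit1 (dual_obj ?A)) = ?A \<box>\<^sub>o (?A \<box>\<^sub>o dual_obj ?A)"
    "tgt (braiding ?A ?A \<box> unit1 (dual_obj ?A)) = ?A \<box>\<^sub>o (?A \<box>\<^sub>o dual_obj ?A)"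
    "src (unit1 ?A \<box> ev ?A) = ?A \<box>\<^sub>o (?A \<box>\<^sub>o dual_obj ?A)" "tgt (unit1 ?A \<box> ev ?A) = ?A"
    "src (runit ?A) = ?A" "tgt (runit_inv ?A) = ?A"
    by (simp_all add: right_adj_ev vee_def box_def ev braiding_def relabel_def runit_def runit_inv_def
        box_obj_assoc)
  have tg: "tgt (Y \<odot> X) = tgt Y" for X :: "('x, 'k) mor1" and Y :: "('y, 'k) mor1" by (simp add: comp_def)
  have f3: "fst (?A \<box>\<^sub>o (?A \<box>\<^sub>o dual_obj ?A)) = 3 * n" by (simp add: box_obj_def dual_obj_def)
  have blocks: "f ` {..<3 * n} = f ` {..<n} \<union> (\<lambda>i. f (n + i)) ` {..<n} \<union> (\<lambda>i. f (2 * n + i)) ` {..<n}"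
    for f :: "nat \<Rightarrow> nat \<times> nat"
  proof -
    have "{..<3 * n} = {..<n} \<union> (+) n ` {..<n} \<union> (+) (2 * n) ` {..<n}"
      unfolding lessThan_atLeast0 image_add_atLeastLessThan by auto
    then show ?thesis by (simp only: image_Un image_image)
  qed
  have im2: "chain2 n ` {..<3 * n} = {2, 5, 6} \<times> {..<n}" and im3: "chain3 n ` {..<3 * n} = {3, 4, 7} \<times> {..<n}"
    unfolding blocks by (auto simp: chain2_def chain3_def)
  have inj: "inj_on (chain2 n) {..<3 * n}" "inj_on (chain3 n) {..<3 * n}"
    by (auto simp: inj_on_def chain2_def chain3_def split: if_splits)
  have imP: "Pair k ` {..<n} = {k} \<times> {..<n}" for k :: nat by auto
  have ft: "fst (tgt (runit_inv ?A)) = n" "fst (tgt (unit1 ?A \<box> right_adj (ev ?A))) = 3 * n"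
    "fst (tgt (braiding ?A ?A \<box> unit1 (dual_obj ?A))) = 3 * n" "fst (tgt (unit1 ?A \<box> ev ?A)) = n"
    by (simp_all only: obj f3 fst_conv)
  let ?X4 = "(unit1 ?A \<box> right_adj (ev ?A)) \<odot> runit_inv ?A"
  let ?X3 = "(braiding ?A ?A \<box> unit1 (dual_obj ?A)) \<odot> ?X4"
  let ?X2 = "(unit1 ?A \<box> ev ?A) \<odot> ?X3"
  have "serre_part (case_bvar (Pair 0) (chain2 n)) ({6 * n..<8 * n} \<union> {8 * n..<9 * n})
      ({} \<union> (Pair 1 ` {..<fst (tgt (runit_inv ?A))} \<union> {}))  ?X4"
    by (rule realizes_comp[OF realizes_unit_coev realizes_runit_inv]) (auto simp: obj inj_on_def)
  moreover have "{6 * n..<8 * n} \<union> {8 * n..<9 * n} = {6 * n..<9 * n}" by auto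
  ultimately have c4: "serre_part (case_bvar (Pair 0) (chain2 n)) {6 * n..<9 * n}
      ({1} \<times> {..<n})  ?X4"
    by (simp only: ft imP Un_empty_left Un_empty_right)
  have "serre_part (case_bvar (Pair 0) (chain3 n)) ({3 * n..<6 * n} \<union> {6 * n..<9 * n})
      ({} \<union> (chain2 n ` {..<fst (tgt ?X4)} \<union> {1} \<times> {..<n}))  ?X3"
    by (rule realizes_comp[OF realizes_braiding_unit c4], unfold tg ft im2) (use inj in \<open>auto simp: obj\<close>)
  moreover have "{3 * n..<6 * n} \<union> {6 * n..<9 * n} = {3 * n..<9 * n}"
    "{} \<union> ({2, 5, 6} \<times> {..<n} \<union> {1} \<times> {..<n}) = {1, 2, 5, 6 :: nat} \<times> {..<n}" by auto
  ultimately have c3: "serre_part (case_bvar (Pair 0) (chain3 n)) {3 * n..<9 * n}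
      ({1, 2, 5, 6} \<times> {..<n})  ?X3"
    by (simp only: tg ft im2)
  have "serre_part (case_bvar (Pair 0) (Pair 8)) ({n..<3 * n} \<union> {3 * n..<9 * n})
      ({} \<union> (chain3 n ` {..<fst (tgt ?X3)} \<union> {1, 2, 5, 6} \<times> {..<n}))  ?X2"
    by (rule realizes_comp[OF realizes_unit_ev c3], unfold tg ft im3) (use inj in \<open>auto simp: obj\<close>)
  moreover have "{n..<3 * n} \<union> {3 * n..<9 * n} = {n..<9 * n}"
    "{} \<union> ({3, 4, 7} \<times> {..<n} \<union> {1, 2, 5, 6} \<times> {..<n}) = {1..7 :: nat} \<times> {..<n}" by auto
  ultimately have c2: "serre_part (case_bvar (Pair 0) (Pair 8)) {n..<9 * n}
      ({1..7} \<times> {..<n})  ?X2"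
    by (simp only: tg ft im3)
  have "serre_part end_var ({0..<n} \<union> {n..<9 * n})
      ({} \<union> (Pair 8 ` {..<fst (tgt ?X2)} \<union> {1..7} \<times> {..<n})) (runit ?A \<odot> ?X2)"
    by (rule realizes_comp[OF realizes_runit c2], unfold tg ft) (auto simp: obj inj_on_def)
  moreover have "{0..<n} \<union> {n..<9 * n} = {..<9 * n}"
    "{} \<union> ({8} \<times> {..<n} \<union> {1..7} \<times> {..<n}) = {1..8 :: nat} \<times> {..<n}" by auto
  ultimately show ?thesis by (simp only: serre_def tg ft imP)
qed

end

text \<open>The position, among the blocks of \<open>n\<close> exterior generators, of those which identify the
  variables \<open>(s, i)\<close> and \<open>(s + 1, i)\<close>.\<close>

definition chain_pos :: "nat \<Rightarrow> nat" where
  "chain_pos s = [8, 6, 3, 2, 5, 7, 4, 1] ! s"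

section \<open>Elimination along the chain of variables\<close>

lemma less_8_cases:
  assumes "(s::nat) < 8"
  obtains "s = 0" | "s = 1" | "s = 2" | "s = 3" | "s = 4" | "s = 5" | "s = 6" | "s = 7"
  using assms by linarith

lemma chain_pos_simps [simp]:
  "chain_pos 0 = 8" "chain_pos 1 = 6" "chain_pos (Suc 0) = 6" "chain_pos 2 = 3" "chain_pos 3 = 2"
  "chain_pos 4 = 5" "chain_pos 5 = 7" "chain_pos 6 = 4" "chain_pos 7 = 1"
  by (simp_all add: chain_pos_def)

lemma chain_pos_range: "s < 8 \<Longrightarrow> chain_pos s \<in> {1..8}"
  by (erule less_8_cases) auto

lemma chain_pos_inj: "s < 8 \<Longrightarrow> t < 8 \<Longrightarrow> chain_pos s = chain_pos t \<Longrightarrow> s = t"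
  by (erule less_8_cases; erule less_8_cases; simp)

text \<open>The strand runs through the inverse unitor, the identity, the braiding,
  \<open>ev\<close>, the dual identity, the adjoint of \<open>ev\<close>, the braiding again and the
  other identity. The dual identity (\<open>s = 4\<close>) is traversed backwards, which gives the
  sign. At the adjoint (\<open>s = 5\<close>) dualisation has made the linear form the coefficient
  of multiplication.\<close>

lemma serre_chain:
  assumes "s < 8" "i < n"
  shows "(if s = 5 then serre_p n W else serre_q n W) (chain_pos s * n + i) =
    ksign (s = 4) * (var (Suc s, i) - var (s, i))"
  using assms(1)
  by (cases rule: less_8_cases) (use assms(2) in \<open>simp_all add: serre_p_def serre_q_def ksign_def numeral_2_eq_2[symmetric]\<close>)

text \<open>Flips occur exactly for \<open>5 * n \<le> k < 6 * n\<close>. Truncated subtraction and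
  \<open>min\<close> count those already passed, so after \<open>8 * n\<close> steps there are
  \<open>n\<close> of them: the shift in the theorem.\<close>

lemma flips_block: "k \<le> 8 * n \<Longrightarrow> flips (\<lambda>k. k div n = 5) k = odd (min (k - 5 * n) n)"
proof (induction k)
  case (Suc k)
  have div: "k div n = 5 \<longleftrightarrow> 5 * n \<le> k \<and> k < 6 * n"
  proof
    have "n > 0" using Suc.prems by (cases n) auto
    assume "k div n = 5"
    then show "5 * n \<le> k \<and> k < 6 * n"
      using div_mult_mod_eq[of k n] mod_less_divisor[OF \<open>n > 0\<close>, of k] by simp
  qed (auto intro: div_nat_eqI)
  have min: "min (Suc k - 5 * n) n = min (k - 5 * n) n + of_bool (5 * n \<le> k \<and> k < 6 * n)"
    by (cases "5 * n \<le> k"; cases "k < 6 * n"; simp add: min_def; linarith)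
  have "flips (\<lambda>k. k div n = 5) k = odd (min (k - 5 * n) n)" using Suc by simp
  then show ?case unfolding min by (auto simp: div)
qed simp

lemma block_index:
  assumes "k < m * n"
  obtains s i where "s < m" "i < n" "k = s * n + i" "k div n = s" "k mod n = (i::nat)"
proof -
  have "n > 0" using assms by (cases n) auto
  then show ?thesis
    using assms that[of "k div n" "k mod n"] by (simp add: div_less_iff_less_mult)
qed

lemma block_less: "s < m \<Longrightarrow> i < n \<Longrightarrow> s * n + i < m * (n::nat)"
proof -
  assume "s < m" "i < n"
  then have "s * n + i < Suc s * n" by simp
  also have "\<dots> \<le> m * n" using \<open>s < m\<close> by (intro mult_le_mono1) simp
  finally show ?thesis .
qed

text \<open>Step \<open>s * n + i\<close> eliminates the variable \<open>(s + 1, i)\<close> with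
  generator \<open>chain_pos s * n + i\<close>. The generators of the leftmost unitor survive; they
  involve levels 8 and 9 only, and replacing level 8 by level 0 gives the unit. The accumulated sign
  is that of the \<open>n\<close>-fold shift.\<close>

lemma heq_serre_kosz:
  fixes W :: "(nat, 'k::field_char_0) mpoly"
  assumes W: "W \<in> polys {..<n}"
  shows "heq (base_ring (serre (n, W)))
    (kosz end_var False {..<9 * n} ({1..8} \<times> {..<n} \<union> end_var ` bvars (serre (n, W))) (serre_p n W) (serre_q n W))
    (kosz end_var (odd n) {0..<n} ({} \<union> end_var ` bvars (serre (n, W)))
      (\<lambda>i. ksign (odd n) * rename end_var (diff_quot i W))
      (\<lambda>i. ksign (odd n) * (var (end_var (Tgt i)) - var (end_var (Src i)))))"
proof -
  let ?S = "serre (n, W)"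
  define vv where "vv = (\<lambda>k. (Suc (k div n), k mod n))"
  define th where "th = (\<lambda>k. chain_pos (k div n) * n + k mod n)"
  \<comment> \<open>Every level is replaced directly by the source level 0, since the preceding
    level has been replaced by then.\<close>
  define rt where "rt = (\<lambda>x :: nat \<times> nat. (0 :: nat, snd x))"
  let ?c = "\<lambda>k. k div n = 5"
  define \<phi> where "\<phi> = (\<lambda>k x. if x \<in> vv ` {..<k} then rt x else x)"
  define V where "V = {1..8} \<times> {..<n} \<union> end_var ` bvars ?S"
  let ?w = "rename Tgt W - rename Src W :: (bvar, 'k) mpoly"
  have st: "src ?S = (n, W)" "tgt ?S = (n, W)"
    by (simp_all add: serre_def comp_def runit_def runit_inv_def relabel_def)
  have bv: "bvars ?S = Src ` {..<n} \<union> Tgt ` {..<n}" by (simp add: bvars_def st)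
  have ends: "end_var ` bvars ?S = {0, 9} \<times> {..<n}" by (auto simp: bv image_Un image_image)
  have vv_block: "vv (s * n + i) = (Suc s, i)" and th_block: "th (s * n + i) = chain_pos s * n + i" if "i < n" for s i
    using that by (simp_all add: vv_def th_def)
  have inj_vv: "inj_on vv {..<8 * n}"
    by (rule inj_onI) (metis Suc_inject div_mult_mod_eq prod.inject vv_def)
  have im_vv: "vv ` {..<8 * n} = {1..8} \<times> {..<n}"
  proof (intro equalityI subsetI)
    fix x assume "x \<in> vv ` {..<8 * n}"
    then obtain k where k: "x = vv k" "k < 8 * n" by auto
    from k(2) obtain s i where "s < 8" "i < n" "k = s * n + i" by (rule block_index)
    then show "x \<in> {1..8} \<times> {..<n}" by (simp add: k(1) vv_block)
  next
    fix x :: "nat \<times> nat" assume "x \<in> {1..8} \<times> {..<n}"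
    then obtain s i where si: "x = (Suc s, i)" "s < 8" "i < n" by (cases x) (auto dest!: Suc_le_D)
    then show "x \<in> vv ` {..<8 * n}"
      using block_less[OF si(2,3)] by (intro image_eqI[of _ _ "s * n + i"]) (simp_all add: vv_block)
  qed
  have inj_th: "inj_on th {..<8 * n}"
  proof (rule inj_onI)
    fix k l assume "k \<in> {..<8 * n}" "l \<in> {..<8 * n}" and eq: "th k = th l"
    then have "k < 8 * n" "l < 8 * n" by auto
    from this(1) obtain s i where si: "s < 8" "i < n" "k = s * n + i" by (rule block_index)
    from \<open>l < 8 * n\<close> obtain t j where tj: "t < 8" "j < n" "l = t * n + j" by (rule block_index)
    have *: "chain_pos s * n + i = chain_pos t * n + j" using eq si tj by (simp add: th_block)
    have "chain_pos s = chain_pos t" using arg_cong[OF *, of "\<lambda>x. x div n"] si tj by simp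
    moreover have "i = j" using arg_cong[OF *, of "\<lambda>x. x mod n"] si tj by simp
    ultimately show "k = l" using chain_pos_inj si tj by simp
  qed
  \<comment> \<open>An injective map into a set of the same size \<open>8 * n\<close> is onto, so
    \<open>chain_pos\<close> need not be inverted.\<close>
  have im_th: "th ` {..<8 * n} = {n..<9 * n}"
  proof (rule card_subset_eq)
    show "th ` {..<8 * n} \<subseteq> {n..<9 * n}"
    proof (rule image_subsetI)
      fix k assume "k \<in> {..<8 * n}"
      then have "k < 8 * n" by simp
      then obtain s i where si: "s < 8" "i < n" "k = s * n + i" by (rule block_index)
      obtain t where "chain_pos s = Suc t" "t < 8" using chain_pos_range[OF si(1)] by (cases "chain_pos s") auto
      then show "th k \<in> {n..<9 * n}" using si block_less[of "Suc t" 9 i n] by (simp add: th_block)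
    qed
    show "card (th ` {..<8 * n}) = card {n..<9 * n}" using inj_th by (simp add: card_image)
  qed simp
  have c: "curved end_var {..<9 * n} ({1..8} \<times> {..<n}) (serre_p n W) (serre_q n W) ?S"
    using realizes_serre[OF W] by (simp add: realizes_def)
  have lin: "\<exists>b. rename (\<phi> k) ((if ?c k then serre_p n W else serre_q n W) (th k)) =
      ksign b * (var (vv k) - var (rt (vv k)))" if "k < 8 * n" for k
  proof -
    from that obtain s i where si: "s < 8" "i < n" "k = s * n + i" "k div n = s" by (rule block_index)
    have 1: "\<phi> k (Suc s, i) = (Suc s, i)"
    proof -
      have "vv k \<notin> vv ` {..<k}" using inj_onD[OF inj_vv, of k] that by fastforce
      then show ?thesis using si by (simp add: \<phi>_def vv_block)
    qed
    \<comment> \<open>The other variable of the linear form is either the source variable or was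
      eliminated \<open>n\<close> steps earlier.\<close>
    have 2: "\<phi> k (s, i) = (0, i)"
    proof (cases s)
      case (Suc t)
      have "(s, i) = vv (t * n + i)" using si Suc by (simp add: vv_block)
      moreover have "t * n + i < k" using si Suc by simp
      ultimately have "(s, i) \<in> vv ` {..<k}" by auto
      then show ?thesis by (simp add: \<phi>_def rt_def)
    qed (auto simp: \<phi>_def vv_def)
    have "rename (\<phi> k) (ksign (s = 4) * (var (Suc s, i) - var (s, i))) =
        ksign (s = 4) * (var (vv k) - var (rt (vv k)) :: (nat \<times> nat, 'k) mpoly)"
    proof -
      have "vv k = (Suc s, i)" using si by (simp add: vv_block)
      then show ?thesis by (simp add: rename_mult rename_diff 1 2 rt_def)
    qed
    then show ?thesis using serre_chain[OF si(1,2), of W] si by (auto simp: th_block)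
  qed
  let ?K = "\<lambda>k. kosz end_var (flips ?c k) ({..<9 * n} - th ` {..<k}) (V - vv ` {..<k})
      (\<lambda>j. ksign (flips ?c k) * rename (\<phi> k) (serre_p n W j)) (\<lambda>j. ksign (flips ?c k) * rename (\<phi> k) (serre_q n W j))"
  let ?V = "{} \<union> end_var ` bvars ?S"
  have "heq (polys (bvars ?S)) (?K 0) (?K (8 * n))"
    unfolding \<phi>_def
  proof (rule heq_eliminate_all[where N = "8 * n" and w = ?w and vv = vv and th = th and rt = rt
        and c = ?c, THEN conjunct1])
    show "rt (vv k) \<in> V - vv ` {..<8 * n}" if "k < 8 * n" for k
    proof -
      have "vv k \<in> {1..8} \<times> {..<n}" unfolding im_vv[symmetric] using that by simp
      then show ?thesis unfolding im_vv V_def ends rt_def by auto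
    qed
    show "?w \<in> polys (bvars ?S)"
      by (intro polys_diff rename_polys[OF W]) (auto simp: bv)
    show "(\<Sum>j<9 * n. serre_p n W j * serre_q n W j) = rename end_var ?w"
      using c by (simp add: curved_def st rename_diff rename_comp)
    show "serre_p n W j \<in> polys V" "serre_q n W j \<in> polys V" if "j \<in> {..<9 * n}" for j
      using c that by (auto simp: curved_def V_def)
  qed (use inj_vv inj_th lin in \<open>auto simp: im_vv im_th V_def ends \<phi>_def\<close>)
  moreover have "\<phi> 0 = id" by (auto simp: \<phi>_def)
  moreover have "flips ?c (8 * n) = odd n" by (subst flips_block) simp_all
  moreover have "{..<9 * n} - th ` {..<8 * n} = {0..<n}" unfolding im_th by auto
  moreover have "V - vv ` {..<8 * n} = ?V" unfolding im_vv V_def ends by auto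
  moreover have "kosz end_var (odd n) {0..<n} ?V (\<lambda>j. ksign (odd n) * rename (\<phi> (8 * n)) (serre_p n W j))
        (\<lambda>j. ksign (odd n) * rename (\<phi> (8 * n)) (serre_q n W j)) = kosz end_var (odd n) {0..<n} ?V
        (\<lambda>i. ksign (odd n) * rename end_var (diff_quot i W)) (\<lambda>i. ksign (odd n) * (var (end_var (Tgt i)) - var (end_var (Src i))))"
  proof (rule kosz_cong)
    fix j assume j: "j \<in> {0..<n}"
    have ph: "\<phi> (8 * n) (8, i) = (0, i)" "\<phi> (8 * n) (9, i) = (9, i)" if "i < n" for i
      using that unfolding \<phi>_def im_vv rt_def by auto
    have "rename (\<phi> (8 * n)) (serre_p n W j) = rename (\<phi> (8 * n) \<circ> case_bvar (Pair 8) (Pair 9)) (diff_quot j W)"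
      using j by (simp add: serre_p_def rename_comp)
    also have "\<dots> = rename end_var (diff_quot j W)"
      by (rule rename_cong[OF diff_quot(2)[OF W]]) (use j ph in auto)
    finally show "ksign (odd n) * rename (\<phi> (8 * n)) (serre_p n W j) = ksign (odd n) * rename end_var (diff_quot j W) \<and>
        ksign (odd n) * rename (\<phi> (8 * n)) (serre_q n W j) = ksign (odd n) * (var (end_var (Tgt j)) - var (end_var (Src j)))"
      using j ph by (simp add: serre_q_def rename_diff)
  qed
  ultimately show ?thesis by (simp add: base_ring_eq V_def ksign_def)
qed

theorem lemma3p8:
  fixes n :: nat and W :: "(nat, 'k::field_char_0) mpoly"
  assumes "lg_object (n, W)"
  shows "lg_iso (n, W) (n, W) (serre (n, W)) (shift_pow n (unit1 (n, W)))"
proof -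
  have W: "W \<in> polys {..<n}"
    using assms by (auto simp: lg_object_def unit_obj_def potential_def)
  let ?A = "(n, W)" and ?S = "serre (n, W)" and ?U = "shift_pow n (unit1 (n, W))"
  have st: "src ?S = ?A" "tgt ?S = ?A" "src ?U = ?A" "tgt ?U = ?A"
    by (simp_all add: serre_def comp_def runit_def runit_inv_def relabel_def)
  have bv: "bvars ?S = Src ` {..<n} \<union> Tgt ` {..<n}" "bvars ?U = Src ` {..<n} \<union> Tgt ` {..<n}"
    by (simp_all add: bvars_def st)
  have inj: "inj_on end_var (bvars ?S)" "inj_on end_var (bvars ?U)"
    unfolding bv by (auto simp: inj_on_def)
  have disj: "{1..8} \<times> {..<n} \<inter> end_var ` bvars ?S = {}" by (auto simp: bv)
  have "realizes end_var False {0..<n} {} (\<lambda>i. rename end_var (diff_quot i W))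
      (\<lambda>i. var (end_var (Tgt i)) - var (end_var (Src i))) (unit1 ?A)"
    by (rule realizes_unit[where lo = 0]) (simp_all add: W)
  note U = realizes_shift_pow[OF this, of n]
  note S = realizes_serre[OF W]
  note heq = heq_serre_kosz[OF W]
  have fin: "finite (basis ?U)" by (simp add: unit1_def)
  \<comment> \<open>Finite subsets are encoded as numbers; the shifted unit is the finite-rank
    witness for both 1-morphisms.\<close>
  have enc: "inj_on set_encode (basis ?U)"
    by (rule inj_on_subset[OF inj_on_set_encode]) (auto simp: unit1_def finite_subset)
  have "lg_mor ?A ?A ?S"
    by (rule realizes_lg_mor[OF S U st _ _ _ _ inj(1) disj _ heq fin enc]) (simp_all add: W)
  moreover have "lg_mor ?A ?A ?U"
    by (rule realizes_lg_mor[OF U U st(3,4) st(3,4) _ _ _ _ inj(2) _ _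
          heq_refl[OF realizes_heq(2)[OF U _ inj(2)]] fin enc]) (simp_all add: W)
  moreover have "iso_hmf ?S ?U"
    by (rule realizes_iso_hmf[OF S U _ _ _ _ inj(1) disj _ heq]) (simp_all add: st)
  ultimately show ?thesis by (simp add: lg_iso_def)
qed

end
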